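(* Let $\eta>0$ be a constant such that $\|B(u,v)\|_{\mathcal X_3}\le \eta\|u\|_{\mathcal X_3}\|v\|_{\mathcal X_3}$ for all $u,v\in\mathcal X_3$, and let $0<\varepsilon<1/(4\eta)$. Let $u_0,\tilde u_0\in L^{3,\infty}$ and $F,\tilde F\in\mathcal Y_3$ satisfy $\|u_0\|_{3,\infty}+\|F\|_{\mathcal Y_3}<\varepsilon$ and $\|\tilde u_0\|_{3,\infty}+\|\tilde F\|_{\mathcal Y_3}<\varepsilon$. Let $u,\tilde u\in\mathcal X_3$ be the unique solutions with $\|u\|_{\mathcal X_3}\le2\varepsilon$, $\|\tilde u\|_{\mathcal X_3}\le2\varepsilon$ of the Navier--Stokes Cauchy problem $$u_t-\Delta u+\mathbb P\nabla\cdot(u\otimes u)=\mathbb PF,\quad x\in\mathbb R^3,\ t>0,\qquad u(0)=u_0,$$ corresponding to $(u_0,F)$ and to $(\tilde u_0,\tilde F)$, respectively. Suppose that $$\lim_{t\to\infty}\left\|S(t)(u_0-\tilde u_0)+\int_0^tS(t-\tau)\mathbb P\big(F(\tau)-\tilde F(\tau)\big)\,d\tau\right\|_{3,\infty}=0.$$ Then $$\lim_{t\to\infty}\|u(\cdot,t)-\tilde u(\cdot,t)\|_{3,\infty}=0.$$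
   Context: All functions are on $\mathbb R^3$; $u,u_0,F$ are $\mathbb R^3$-valued, membership in a space is understood componentwise, and the norm of a vector (or matrix) valued function is the maximum of the norms of its components. $L^{p,\infty}=L^{p,\infty}(\mathbb R^3)$, $1<p<\infty$, is the Marcinkiewicz (weak $L^p$) space with norm $\|f\|_{p,\infty}=\sup_E |E|^{-1/q}\int_E|f|\,dx$, $1/p+1/q=1$, the supremum being over Borel sets $E$ of finite positive measure. $S(t)$ is the heat semigroup: convolution with $p(x,t)=(4\pi t)^{-3/2}e^{-|x|^2/(4t)}$. $\mathbb P$ is the Leray projection $\mathbb P(v_1,v_2,v_3)=(v_1-R_1\sigma,v_2-R_2\sigma,v_3-R_3\sigma)$, $\sigma=R_1v_1+R_2v_2+R_3v_3$, where $R_j$ is the Riesz transform with symbol $\xi_j/|\xi|$. For vector fields $a,b$, $(\nabla\cdot(a\otimes b))_i=\sum_j\partial_j(a_jb_i)$. $C_w([0,\infty),L^{p,\infty})$ is the space of functions $u$ that are bounded and continuous from $(0,\infty)$ to $L^{p,\infty}$ in the norm topology and satisfy $u(\cdot,t)\to u(\cdot,0)$ weakly as $t\searrow0$. $\mathcal X_3=C_w([0,\infty),L^{3,\infty})$ with norm $\|u\|_{\mathcal X_3}=\sup_{t}\|u(t)\|_{3,\infty}$. $\mathcal Y_3$ is the set of $F\in C([0,\infty),\mathcal S'(\mathbb R^3))$ such that $\int_0^tS(t-\tau)\mathbb PF(\tau)\,d\tau$ makes sense and, as a function of $t$, belongs to $\mathcal X_3$; $\|F\|_{\mathcal Y_3}=\sup_{t>0}\|\int_0^tS(t-\tau)\mathbb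 PF(\tau)\,d\tau\|_{3,\infty}$. The bilinear form is $B(u,v)(t)=-\int_0^tS(t-\tau)\mathbb P\nabla\cdot(u\otimes v)(\tau)\,d\tau$; it is known to be bounded on $\mathcal X_3$, so that a constant $\eta$ as in the claim exists. A solution of the Cauchy problem means a solution of the integral equation $u(t)=S(t)u_0+B(u,u)(t)+\int_0^tS(t-\tau)\mathbb PF(\tau)\,d\tau$. Under the stated smallness condition there is exactly one solution with $\|u\|_{\mathcal X_3}\le2\varepsilon$. *)

theory Defs
  imports "HOL-Analysis.Analysis"
begin

section \<open>Marcinkiewicz spaces\<close>

text \<open>Elements of a space of (classes of) functions are represented by Borel functions, and
  equality of elements is equality almost everywhere.  Norms take values in \<^typ>\<open>ennreal\<close>.
  The exponent of \<^term>\<open>E\<close> below is \<open>-1/q = 1/p - 1\<close>.\<close>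

definition weak_norm :: "real \<Rightarrow> (real^3 \<Rightarrow> real) \<Rightarrow> ennreal" where
  "weak_norm p f =
    (SUP E \<in> {E \<in> sets borel. 0 < emeasure lborel E \<and> emeasure lborel E < \<infinity>}.
       ennreal (measure lborel E powr (1 / p - 1)) * (\<integral>\<^sup>+ x\<in>E. ennreal \<bar>f x\<bar> \<partial>lborel))"

definition vweak_norm :: "real \<Rightarrow> (real^3 \<Rightarrow> real^3) \<Rightarrow> ennreal" where
  "vweak_norm p v = Max (range (\<lambda>i. weak_norm p (\<lambda>x. v x $ i)))"

definition weak_L :: "real \<Rightarrow> (real^3 \<Rightarrow> real^3) set" where
  "weak_L p = {v \<in> borel_measurable lborel. vweak_norm p v < \<infinity>}"

text \<open>The Lorentz space \<open>L\<^bsup>q,1\<^esup>\<close>, whose dual is \<open>L\<^bsup>p,\<infinity>\<^esup>\<close> for \<open>1/p + 1/q = 1\<close>.\<close>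

definition lorentz_one :: "real \<Rightarrow> (real^3 \<Rightarrow> real) set" where
  "lorentz_one q = {g \<in> borel_measurable lborel.
     (\<forall>s>0. emeasure lborel {x. s < \<bar>g x\<bar>} < \<infinity>) \<and>
     (\<integral>\<^sup>+ s\<in>{0<..}. ennreal (measure lborel {x. s < \<bar>g x\<bar>} powr (1 / q)) \<partial>lborel) < \<infinity>}"

text \<open>The weak convergence at \<open>t = 0\<close> is that of \<open>L\<^bsup>p,\<infinity>\<^esup>\<close> as the dual of \<open>L\<^bsup>q,1\<^esup>\<close>.
  (With the bidual as test space even \<open>S(t)u\<^sub>0\<close> would fail to be weakly continuous
  at \<open>0\<close>, for instance if \<open>u\<^sub>0\<close> is homogeneous of degree \<open>-1\<close> and \<open>p = 3\<close>.)\<close>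

definition C_w :: "real \<Rightarrow> (real \<Rightarrow> real^3 \<Rightarrow> real^3) set" where
  "C_w p = {u.
     (\<forall>t\<ge>0. u t \<in> weak_L p) \<and>
     (SUP t\<in>{0<..}. vweak_norm p (u t)) < \<infinity> \<and>
     (\<forall>t>0. ((\<lambda>s. vweak_norm p (\<lambda>x. u s x - u t x)) \<longlongrightarrow> 0) (at t)) \<and>
     (\<forall>i. \<forall>g \<in> lorentz_one (p / (p - 1)).
        ((\<lambda>t. LINT x|lborel. u t x $ i * g x) \<longlongrightarrow> (LINT x|lborel. u 0 x $ i * g x)) (at_right 0))}"

definition X3 :: "(real \<Rightarrow> real^3 \<Rightarrow> real^3) set" where
  "X3 = C_w 3"

definition norm_X3 :: "(real \<Rightarrow> real^3 \<Rightarrow> real^3) \<Rightarrow> ennreal" where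
  "norm_X3 u = (SUP t\<in>{0..}. vweak_norm 3 (u t))"


section \<open>Schwartz functions and tempered distributions\<close>

definition partial :: "3 \<Rightarrow> (real^3 \<Rightarrow> 'b::real_normed_vector) \<Rightarrow> real^3 \<Rightarrow> 'b" where
  "partial i f x = frechet_derivative f (at x) (axis i 1)"

definition partials :: "3 list \<Rightarrow> (real^3 \<Rightarrow> 'b::real_normed_vector) \<Rightarrow> real^3 \<Rightarrow> 'b" where
  "partials js f = foldr partial js f"

definition schwartz :: "(real^3 \<Rightarrow> 'b::real_normed_vector) set" where
  "schwartz = {\<phi>. \<forall>js. partials js \<phi> differentiable_on UNIV \<and>
     (\<forall>k::nat. bounded (range (\<lambda>x. (1 + norm x) ^ k *\<^sub>R partials js \<phi> x)))}"

definition schwartz_seminorm :: "nat \<Rightarrow> (real^3 \<Rightarrow> 'b::real_normed_vector) \<Rightarrow> real" where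
  "schwartz_seminorm N \<phi> =
     Sup {(1 + norm x) ^ N * norm (partials js \<phi> x) | js x. length js \<le> N}"

text \<open>Distributions are bilinear (not sesquilinear) in their pairing with complex valued test
  functions; a real distribution is one that commutes with complex conjugation.  Only the values
  on \<^const>\<open>schwartz\<close> matter.\<close>

type_synonym dist = "(real^3 \<Rightarrow> complex) \<Rightarrow> complex"

definition tempered :: "dist \<Rightarrow> bool" where
  "tempered T \<longleftrightarrow>
     (\<forall>\<phi>\<in>schwartz. \<forall>\<psi>\<in>schwartz. T (\<lambda>x. \<phi> x + \<psi> x) = T \<phi> + T \<psi>) \<and>
     (\<forall>c. \<forall>\<phi>\<in>schwartz. T (\<lambda>x. c * \<phi> x) = c * T \<phi>) \<and>
     (\<exists>N C. \<forall>\<phi>\<in>schwartz. cmod (T \<phi>) \<le> C * schwartz_seminorm N \<phi>)"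

definition real_tempered :: "dist \<Rightarrow> bool" where
  "real_tempered T \<longleftrightarrow> tempered T \<and> (\<forall>\<phi>\<in>schwartz. T (\<lambda>x. cnj (\<phi> x)) = cnj (T \<phi>))"

text \<open>\<open>C([0,\<infinity>), S')\<close> for vector valued distributions, with the weak-star topology on \<open>S'\<close>.\<close>

definition C_tempered :: "(real \<Rightarrow> dist^3) set" where
  "C_tempered = {F. (\<forall>t\<ge>0. \<forall>i. real_tempered (F t $ i)) \<and>
     (\<forall>i. \<forall>\<phi>\<in>schwartz. continuous_on {0..} (\<lambda>t. (F t $ i) \<phi>))}"

text \<open>Pairings of a vector valued distribution, resp. a vector field, with a test field.\<close>

definition act :: "dist^3 \<Rightarrow> (real^3 \<Rightarrow> complex^3) \<Rightarrow> complex" where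
  "act T \<Phi> = (\<Sum>i\<in>UNIV. (T $ i) (\<lambda>x. \<Phi> x $ i))"

definition act_fun :: "(real^3 \<Rightarrow> real^3) \<Rightarrow> (real^3 \<Rightarrow> complex^3) \<Rightarrow> complex" where
  "act_fun w \<Phi> = (\<Sum>i\<in>UNIV. LINT x|lborel. complex_of_real (w x $ i) * \<Phi> x $ i)"

text \<open>The distribution with components \<open>\<Sum>\<^sub>j \<partial>\<^sub>j (a\<^sub>j b\<^sub>i)\<close>.\<close>

definition div_tensor :: "(real^3 \<Rightarrow> real^3) \<Rightarrow> (real^3 \<Rightarrow> real^3) \<Rightarrow> dist^3" where
  "div_tensor a b = (\<chi> i. (\<lambda>\<phi>.
     - (\<Sum>j\<in>UNIV. LINT x|lborel. complex_of_real (a x $ j * b x $ i) * partial j \<phi> x)))"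


section \<open>Heat semigroup, Riesz transforms and Leray projection\<close>

definition heat_kernel :: "real \<Rightarrow> real^3 \<Rightarrow> real" where
  "heat_kernel t x = (4 * pi * t) powr (- 3 / 2) * exp (- (norm x)\<^sup>2 / (4 * t))"

text \<open>\<open>S(0)\<close> is the identity.\<close>

definition heat :: "real \<Rightarrow> (real^3 \<Rightarrow> 'b::euclidean_space) \<Rightarrow> real^3 \<Rightarrow> 'b" where
  "heat t f x = (if t \<le> 0 then f x else LINT y|lborel. heat_kernel t (x - y) *\<^sub>R f y)"

definition fourier :: "(real^3 \<Rightarrow> complex) \<Rightarrow> real^3 \<Rightarrow> complex" where
  "fourier f \<xi> = (LINT x|lborel. cis (- (x \<bullet> \<xi>)) * f x)"

definition inv_fourier :: "(real^3 \<Rightarrow> complex) \<Rightarrow> real^3 \<Rightarrow> complex" where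
  "inv_fourier g x = complex_of_real (1 / (2 * pi) ^ 3) * (LINT \<xi>|lborel. cis (x \<bullet> \<xi>) * g \<xi>)"

definition riesz :: "3 \<Rightarrow> (real^3 \<Rightarrow> complex) \<Rightarrow> real^3 \<Rightarrow> complex" where
  "riesz j f = inv_fourier (\<lambda>\<xi>. complex_of_real (\<xi> $ j / norm \<xi>) * fourier f \<xi>)"

definition riesz_sum :: "(real^3 \<Rightarrow> complex^3) \<Rightarrow> real^3 \<Rightarrow> complex" where
  "riesz_sum v x = (\<Sum>j\<in>UNIV. riesz j (\<lambda>y. v y $ j) x)"

definition leray :: "(real^3 \<Rightarrow> complex^3) \<Rightarrow> real^3 \<Rightarrow> complex^3" where
  "leray v x = (\<chi> i. v x $ i - riesz i (riesz_sum v) x)"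

text \<open>On distributions, \<open>S(s)\<close> and the Leray projection are defined by duality.  Both are symmetric
  for the bilinear pairing (the heat kernel is even, and the symbol
  \<open>\<delta>\<^sub>i\<^sub>j - \<xi>\<^sub>i \<xi>\<^sub>j / |\<xi>|\<^sup>2\<close> is a symmetric matrix, even in \<open>\<xi>\<close>).  As this symbol is not smooth at \<open>0\<close>,
  the Leray projection of a tempered distribution can only be tested against
  Schwartz fields whose Leray projection is again a Schwartz field; these are the sums of a
  gradient of a Schwartz function and a divergence free Schwartz field, and they are dense
  enough to determine an element of \<open>L\<^bsup>p,\<infinity>\<^esup>\<close>.  The integrability condition makes sure that all
  Fourier integrals occurring in \<^const>\<open>leray\<close> converge.\<close>

definition test_fields :: "(real^3 \<Rightarrow> complex^3) set" where
  "test_fields = {\<Phi> \<in> schwartz. integrable lborel (riesz_sum \<Phi>) \<and> leray \<Phi> \<in> schwartz}"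

definition leray_dist :: "dist^3 \<Rightarrow> (real^3 \<Rightarrow> complex^3) \<Rightarrow> complex" where
  "leray_dist T \<Phi> = act T (leray \<Phi>)"

definition heat_dist ::
    "real \<Rightarrow> ((real^3 \<Rightarrow> complex^3) \<Rightarrow> complex) \<Rightarrow> (real^3 \<Rightarrow> complex^3) \<Rightarrow> complex" where
  "heat_dist s T \<Phi> = T (heat s \<Phi>)"


section \<open>The Duhamel integral and the integral equation\<close>

text \<open>\<open>is_duhamel G t w\<close> says that \<open>\<integral>\<^sub>0\<^sup>t S(t - \<tau>) P G(\<tau>) d\<tau>\<close> converges, as a weak integral of
  distributions, to the vector field \<open>w\<close>.\<close>

definition is_duhamel :: "(real \<Rightarrow> dist^3) \<Rightarrow> real \<Rightarrow> (real^3 \<Rightarrow> real^3) \<Rightarrow> bool" where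
  "is_duhamel G t w \<longleftrightarrow> (\<forall>\<Phi>\<in>test_fields.
     set_integrable lborel {0<..<t} (\<lambda>\<tau>. heat_dist (t - \<tau>) (leray_dist (G \<tau>)) \<Phi>) \<and>
     act_fun w \<Phi> = (LINT \<tau>:{0<..<t}|lborel. heat_dist (t - \<tau>) (leray_dist (G \<tau>)) \<Phi>))"

definition duhamel_exists :: "(real \<Rightarrow> dist^3) \<Rightarrow> real \<Rightarrow> bool" where
  "duhamel_exists G t \<longleftrightarrow> (\<exists>w \<in> weak_L 3. is_duhamel G t w)"

text \<open>The integral is unique up to equality almost everywhere, when it exists in \<open>L\<^bsup>3,\<infinity>\<^esup>\<close>; otherwise
  the value below is meaningless.\<close>

definition duhamel :: "(real \<Rightarrow> dist^3) \<Rightarrow> real \<Rightarrow> real^3 \<Rightarrow> real^3" where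
  "duhamel G t = (SOME w. w \<in> weak_L 3 \<and> is_duhamel G t w)"

definition Y3 :: "(real \<Rightarrow> dist^3) set" where
  "Y3 = {F \<in> C_tempered. (\<forall>t\<ge>0. duhamel_exists F t) \<and> duhamel F \<in> X3}"

definition norm_Y3 :: "(real \<Rightarrow> dist^3) \<Rightarrow> ennreal" where
  "norm_Y3 F = (SUP t\<in>{0<..}. vweak_norm 3 (duhamel F t))"

definition bilin ::
    "(real \<Rightarrow> real^3 \<Rightarrow> real^3) \<Rightarrow> (real \<Rightarrow> real^3 \<Rightarrow> real^3) \<Rightarrow> real \<Rightarrow> real^3 \<Rightarrow> real^3" where
  "bilin u v t x = - duhamel (\<lambda>\<tau>. div_tensor (u \<tau>) (v \<tau>)) t x"

definition bilin_exists ::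
    "(real \<Rightarrow> real^3 \<Rightarrow> real^3) \<Rightarrow> (real \<Rightarrow> real^3 \<Rightarrow> real^3) \<Rightarrow> bool" where
  "bilin_exists u v \<longleftrightarrow> (\<forall>t\<ge>0. duhamel_exists (\<lambda>\<tau>. div_tensor (u \<tau>) (v \<tau>)) t)"

definition NS_solution ::
    "(real^3 \<Rightarrow> real^3) \<Rightarrow> (real \<Rightarrow> dist^3) \<Rightarrow> (real \<Rightarrow> real^3 \<Rightarrow> real^3) \<Rightarrow> bool" where
  "NS_solution u0 F u \<longleftrightarrow>
     (\<forall>t\<ge>0. AE x in lborel. u t x = heat t u0 x + bilin u u t x + duhamel F t x)"

end

theory Submission
  imports Defs "HOL-Probability.Probability"
begin

text \<open>Let \<open>w = u - u'\<close>.  Subtracting the two integral equations gives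
  \<open>w = d + B(w, u) + B(u', w)\<close>, where \<open>d\<close> is the linear part whose norm is assumed to vanish as
  \<open>t \<rightarrow> \<infinity>\<close>.  The claim would follow by taking the upper limit \<open>m\<close> of the norms of both sides
  if the bilinear terms obeyed \<open>limsup \<parallel>B(v, w)(t)\<parallel> \<le> \<eta> limsup \<parallel>v(t)\<parallel> limsup \<parallel>w(t)\<parallel>\<close>: then
  \<open>m \<le> 4 \<eta> \<epsilon> m\<close> with \<open>4 \<eta> \<epsilon> < 1\<close>, hence \<open>m = 0\<close>.  The point is therefore that the Duhamel
  integral forgets the remote past, and this has to be extracted from the bound \<open>\<eta>\<close> itself.

  Write \<open>D(t)\<close> for the Duhamel integral of \<open>\<nabla> \<cdot> (v \<otimes> w)\<close> over \<open>(0, t)\<close> and cut at \<open>a = t / (N + 1)\<close>: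
  \<open>D(t) = S(N a) D(a) +\<close> (the Duhamel integral of the fields shifted by \<open>a\<close>), see
  \<open>duhamel_split\<close>.  Shifted fields stay in \<open>X\<^sub>3\<close>, so the second part is bounded by \<open>\<eta>\<close> times the
  suprema of \<open>\<parallel>v\<parallel>\<close> and \<open>\<parallel>w\<parallel>\<close> over \<open>[a, \<infinity>)\<close>.  What remains is to show that \<open>S(N a) D(a)\<close> is small
  for large \<open>N\<close>, uniformly in \<open>a\<close>.  The heat flow of a function in \<open>L\<^bsup>3,\<infinity>\<^esup>\<close> need not
  decay in norm (take one homogeneous of degree \<open>-1\<close>), so more than \<open>\<parallel>D(a)\<parallel> \<le> \<eta> \<parallel>v\<parallel> \<parallel>w\<parallel>\<close> is needed.

  The extra information comes from repeating the past periodically.  Suppose \<open>v\<close> and \<open>w\<close> vanish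
  near \<open>0\<close> and near \<open>a\<close>; their extensions with period \<open>a\<close> lie in \<open>X\<^sub>3\<close> with no larger norms, so
  the Duhamel integrals \<open>Q\<^sub>n\<close> of the periodic fields at the times \<open>n a\<close> are all bounded by
  \<open>\<eta> \<parallel>v\<parallel> \<parallel>w\<parallel>\<close>, although \<open>Q\<^sub>n\<close> is the sum of \<open>S(k a) z\<close> over \<open>k < n\<close>, \<open>z = D(a)\<close>.  Splitting
  \<open>Q\<^bsub>n+1\<^esub>\<close> at \<open>a\<close> and at \<open>n a\<close> gives \<open>S(a) Q\<^sub>n + z = S(n a) z + Q\<^sub>n\<close>, and therefore
  \<open>S(N a) z = (S(N a) - S((N + 1) a)) Q\<^sub>n + S((N + n) a) z\<close>.  As \<open>n \<rightarrow> \<infinity>\<close> the last term tends to \<open>0\<close>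
  uniformly in space, and the operator in front of \<open>Q\<^sub>n\<close> has norm at most the \<open>L\<^sup>1\<close> distance of
  two heat kernels, at most \<open>2 (1 - (N / (N + 1))\<^bsup>3/2\<^esup>)\<close>.  This is the content of
  \<open>weak_norm_heat_of_bounded_sums\<close> and \<open>heat_D_periodise_le\<close>.  General \<open>v\<close> and \<open>w\<close> are first
  multiplied by cutoffs in time, which are then removed by dominated convergence and Fatou's
  lemma (\<open>heat_D_le\<close>).  The argument thus rests on \<open>\<eta>\<close> and on the invariance of the
  problem under translations in time.

  All this takes place among weakly defined integrals, so a supply of explicit test fields is
  needed on which \<open>S(t)\<close> and the Leray projection can be computed.  The fields
  \<open>\<Delta>p\<^sub>s(x - y) e\<^sub>i\<close>, with \<open>p\<^sub>s\<close> the heat kernel, serve: the heat semigroup only shifts \<open>s\<close>, and their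
  Leray projection has the components \<open>\<delta>\<^sub>i\<^sub>j \<Delta>p\<^sub>s - \<partial>\<^sub>i\<partial>\<^sub>j p\<^sub>s\<close>, again a polynomial times a Gaussian.
  The factor \<open>|\<xi>|\<^sup>2\<close> in the Fourier transform of \<open>\<Delta>p\<^sub>s\<close> is what makes the Riesz transform in between
  integrable.  These pairings determine an element of \<open>L\<^bsup>3,\<infinity>\<^esup>\<close> (\<open>lap_pairing_injective\<close>): they are the
  time derivatives of its heat extension, which decays as \<open>s \<rightarrow> \<infinity>\<close> and is injective.\<close>

section \<open>The weak \<open>L\<^sup>3\<close> norm\<close>

lemma powr_two_thirds_cancel:
  fixes m :: real assumes "m > 0"
  shows "ennreal (m powr (1/3 - 1)) * (ennreal (m powr (2/3)) * K) = K"
    and "ennreal (m powr (2/3)) * (ennreal (m powr (1/3 - 1)) * K) = K"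
proof -
  have "m powr (1/3 - 1) * m powr (2/3) = 1"
    using assms by (simp add: powr_add [symmetric])
  then have "ennreal (m powr (1/3 - 1)) * ennreal (m powr (2/3)) = 1"
    by (metis ennreal_1 ennreal_mult powr_ge_zero)
  then show "ennreal (m powr (1/3 - 1)) * (ennreal (m powr (2/3)) * K) = K"
    and "ennreal (m powr (2/3)) * (ennreal (m powr (1/3 - 1)) * K) = K"
    by (metis mult.assoc mult.commute mult_1)+
qed

text \<open>The definition of the norm divides by \<open>|E|\<close> to the power \<open>2/3 = 1 - 1/3\<close>.  Null sets, which
  the supremum there leaves out, contribute nothing on either side; so this inequality and its
  converse \<open>weak_norm_le\<close> characterise the norm without the side condition \<open>|E| > 0\<close>.\<close>
lemma set_integral_le_weak_norm:
  assumes E: "E \<in> sets borel" "emeasure lborel E < \<infinity>"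
  shows "(\<integral>\<^sup>+x\<in>E. ennreal \<bar>f x\<bar> \<partial>lborel) \<le> ennreal (measure lborel E powr (2/3)) * weak_norm 3 f"
proof (cases "emeasure lborel E = 0")
  case True
  then have "E \<in> null_sets lborel" using E by auto
  then have "(\<integral>\<^sup>+x\<in>E. ennreal \<bar>f x\<bar> \<partial>lborel) = 0"
    by (rule nn_integral_null_set)
  then show ?thesis by simp
next
  case False
  define m where "m = measure lborel E"
  define I where "I = (\<integral>\<^sup>+x\<in>E. ennreal \<bar>f x\<bar> \<partial>lborel)"
  have "m > 0"
    using False E(2) by (simp add: m_def measure_def enn2real_positive_iff zero_less_iff_neq_zero less_top)
  have "ennreal (m powr (1/3 - 1)) * I \<le> weak_norm 3 f"
    unfolding weak_norm_def m_def I_def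
    by (rule SUP_upper) (use E False in \<open>auto simp: zero_less_iff_neq_zero\<close>)
  then have "ennreal (m powr (2/3)) * (ennreal (m powr (1/3 - 1)) * I) \<le> ennreal (m powr (2/3)) * weak_norm 3 f"
    by (rule mult_left_mono) simp
  moreover have "ennreal (m powr (2/3)) * (ennreal (m powr (1/3 - 1)) * I) = I"
    by (rule powr_two_thirds_cancel [OF \<open>m > 0\<close>])
  ultimately show ?thesis by (simp add: m_def I_def)
qed

lemma weak_norm_le:
  assumes "\<And>E. E \<in> sets borel \<Longrightarrow> emeasure lborel E < \<infinity> \<Longrightarrow>
    (\<integral>\<^sup>+x\<in>E. ennreal \<bar>f x\<bar> \<partial>lborel) \<le> ennreal (measure lborel E powr (2/3)) * K"
  shows "weak_norm 3 f \<le> K"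
  unfolding weak_norm_def
proof (rule SUP_least, clarify)
  fix E :: "(real^3) set"
  assume E: "E \<in> sets borel" and pos: "0 < emeasure lborel E" and fin: "emeasure lborel E < \<infinity>"
  define m where "m = measure lborel E"
  have "m > 0"
    using pos fin by (simp add: m_def measure_def enn2real_positive_iff less_top)
  have "ennreal (m powr (1/3 - 1)) * (\<integral>\<^sup>+x\<in>E. ennreal \<bar>f x\<bar> \<partial>lborel)
      \<le> ennreal (m powr (1/3 - 1)) * (ennreal (m powr (2/3)) * K)"
    unfolding m_def by (intro mult_left_mono assms E fin) simp
  also have "\<dots> = K"
    by (rule powr_two_thirds_cancel [OF \<open>m > 0\<close>])
  finally show "ennreal (measure lborel E powr (1/3 - 1)) * (\<integral>\<^sup>+x\<in>E. ennreal \<bar>f x\<bar> \<partial>lborel) \<le> K"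
    by (simp add: m_def)
qed

lemma weak_norm_mono:
  assumes "AE x in lborel. \<bar>f x\<bar> \<le> \<bar>g x\<bar>"
  shows "weak_norm 3 f \<le> weak_norm 3 g"
proof (rule weak_norm_le)
  fix E :: "(real^3) set" assume "E \<in> sets borel" "emeasure lborel E < \<infinity>"
  then have "(\<integral>\<^sup>+x\<in>E. ennreal \<bar>g x\<bar> \<partial>lborel) \<le> ennreal (measure lborel E powr (2/3)) * weak_norm 3 g"
    by (rule set_integral_le_weak_norm)
  moreover have "(\<integral>\<^sup>+x\<in>E. ennreal \<bar>f x\<bar> \<partial>lborel) \<le> (\<integral>\<^sup>+x\<in>E. ennreal \<bar>g x\<bar> \<partial>lborel)"
    by (rule nn_integral_mono_AE) (use assms in \<open>auto simp: indicator_def elim!: eventually_mono intro: ennreal_leI\<close>)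
  ultimately show "(\<integral>\<^sup>+x\<in>E. ennreal \<bar>f x\<bar> \<partial>lborel) \<le> ennreal (measure lborel E powr (2/3)) * weak_norm 3 g"
    by order
qed

lemma weak_norm_add_le:
  assumes [measurable]: "f \<in> borel_measurable lborel" "g \<in> borel_measurable lborel"
  shows "weak_norm 3 (\<lambda>x. f x + g x) \<le> weak_norm 3 f + weak_norm 3 g"
proof (rule weak_norm_le)
  fix E :: "(real^3) set" assume E[measurable]: "E \<in> sets borel" "emeasure lborel E < \<infinity>"
  have "(\<integral>\<^sup>+x\<in>E. ennreal \<bar>f x + g x\<bar> \<partial>lborel) \<le>
     (\<integral>\<^sup>+x. ennreal \<bar>f x\<bar> * indicator E x + ennreal \<bar>g x\<bar> * indicator E x \<partial>lborel)"
    by (rule nn_integral_mono)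
       (auto simp: indicator_def ennreal_plus [symmetric] simp del: ennreal_plus intro!: ennreal_leI)
  also have "\<dots> = (\<integral>\<^sup>+x\<in>E. ennreal \<bar>f x\<bar> \<partial>lborel) + (\<integral>\<^sup>+x\<in>E. ennreal \<bar>g x\<bar> \<partial>lborel)"
    by (rule nn_integral_add) auto
  also have "\<dots> \<le> ennreal (measure lborel E powr (2/3)) * (weak_norm 3 f + weak_norm 3 g)"
    unfolding distrib_left by (intro add_mono set_integral_le_weak_norm E)
  finally show "(\<integral>\<^sup>+x\<in>E. ennreal \<bar>f x + g x\<bar> \<partial>lborel)
      \<le> ennreal (measure lborel E powr (2/3)) * (weak_norm 3 f + weak_norm 3 g)" .
qed

lemma weak_norm_uminus [simp]: "weak_norm p (\<lambda>x. - f x) = weak_norm p f"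
  by (simp add: weak_norm_def)

lemma weak_norm_cmult_le:
  assumes [measurable]: "f \<in> borel_measurable lborel"
  shows "weak_norm 3 (\<lambda>x. c * f x) \<le> ennreal \<bar>c\<bar> * weak_norm 3 f"
proof (rule weak_norm_le)
  fix E :: "(real^3) set" assume E[measurable]: "E \<in> sets borel" "emeasure lborel E < \<infinity>"
  have "(\<integral>\<^sup>+x\<in>E. ennreal \<bar>c * f x\<bar> \<partial>lborel) = ennreal \<bar>c\<bar> * (\<integral>\<^sup>+x\<in>E. ennreal \<bar>f x\<bar> \<partial>lborel)"
    by (subst nn_integral_cmult [symmetric]) (auto simp: abs_mult ennreal_mult mult.assoc)
  also have "\<dots> \<le> ennreal \<bar>c\<bar> * (ennreal (measure lborel E powr (2/3)) * weak_norm 3 f)"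
    by (intro mult_left_mono set_integral_le_weak_norm E) simp
  finally show "(\<integral>\<^sup>+x\<in>E. ennreal \<bar>c * f x\<bar> \<partial>lborel)
      \<le> ennreal (measure lborel E powr (2/3)) * (ennreal \<bar>c\<bar> * weak_norm 3 f)"
    by (simp add: mult_ac)
qed

lemma weak_norm_zero [simp]: "weak_norm 3 (\<lambda>x. 0) = 0"
  using weak_norm_le [of "\<lambda>x. 0" 0] by simp

lemma vweak_norm_le_iff: "vweak_norm p v \<le> K \<longleftrightarrow> (\<forall>i. weak_norm p (\<lambda>x. v x $ i) \<le> K)"
  unfolding vweak_norm_def by (subst Max_le_iff) auto

lemma weak_norm_component_le: "weak_norm p (\<lambda>x. v x $ i) \<le> vweak_norm p v"
  using vweak_norm_le_iff by blast

lemma measurable_vec_nth [measurable (raw)]: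
  assumes "v \<in> borel_measurable M"
  shows "(\<lambda>x. v x $ i :: real) \<in> borel_measurable M"
  using assms by (rule measurable_compose) (intro borel_measurable_continuous_onI continuous_intros)

lemma weak_LD:
  assumes "v \<in> weak_L 3"
  shows "v \<in> borel_measurable lborel" "vweak_norm 3 v < \<infinity>"
    "(\<lambda>x. v x $ i) \<in> borel_measurable lborel" "weak_norm 3 (\<lambda>x. v x $ i) < \<infinity>"
proof -
  show 1: "v \<in> borel_measurable lborel" and "vweak_norm 3 v < \<infinity>"
    using assms by (auto simp: weak_L_def)
  then show "weak_norm 3 (\<lambda>x. v x $ i) < \<infinity>"
    using weak_norm_component_le [of 3 v i] by (auto intro: le_less_trans)
  show "(\<lambda>x. v x $ i) \<in> borel_measurable lborel" using 1 by simp
qed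

lemma vweak_norm_mono:
  assumes "AE x in lborel. \<forall>i. \<bar>v x $ i\<bar> \<le> \<bar>w x $ i\<bar>"
  shows "vweak_norm 3 v \<le> vweak_norm 3 w"
  unfolding vweak_norm_le_iff
proof
  fix i
  have "weak_norm 3 (\<lambda>x. v x $ i) \<le> weak_norm 3 (\<lambda>x. w x $ i)"
    by (rule weak_norm_mono) (use assms in \<open>auto elim!: eventually_mono\<close>)
  then show "weak_norm 3 (\<lambda>x. v x $ i) \<le> vweak_norm 3 w"
    using weak_norm_component_le by (rule order_trans)
qed

lemma vweak_norm_cong_AE:
  assumes "AE x in lborel. v x = w x"
  shows "vweak_norm 3 v = vweak_norm 3 w"
  by (rule antisym; rule vweak_norm_mono) (use assms in \<open>auto elim!: eventually_mono\<close>)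

lemma vweak_norm_add_le:
  assumes "v \<in> borel_measurable lborel" "w \<in> borel_measurable lborel"
  shows "vweak_norm 3 (\<lambda>x. v x + w x) \<le> vweak_norm 3 v + vweak_norm 3 w"
  unfolding vweak_norm_le_iff
proof
  fix i
  have "weak_norm 3 (\<lambda>x. v x $ i + w x $ i) \<le> weak_norm 3 (\<lambda>x. v x $ i) + weak_norm 3 (\<lambda>x. w x $ i)"
    by (rule weak_norm_add_le) (use assms in simp_all)
  also have "\<dots> \<le> vweak_norm 3 v + vweak_norm 3 w"
    by (intro add_mono weak_norm_component_le)
  finally show "weak_norm 3 (\<lambda>x. (v x + w x) $ i) \<le> vweak_norm 3 v + vweak_norm 3 w" by simp
qed

lemma vweak_norm_uminus [simp]: "vweak_norm p (\<lambda>x. - v x) = vweak_norm p v"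
  by (simp add: vweak_norm_def)

lemma vweak_norm_diff_le:
  assumes "v \<in> borel_measurable lborel" "w \<in> borel_measurable lborel"
  shows "vweak_norm 3 (\<lambda>x. v x - w x) \<le> vweak_norm 3 v + vweak_norm 3 w"
  using vweak_norm_add_le [of v "\<lambda>x. - w x"] assms by simp

lemma vweak_norm_scaleR_le:
  assumes "v \<in> borel_measurable lborel"
  shows "vweak_norm 3 (\<lambda>x. c *\<^sub>R v x) \<le> ennreal \<bar>c\<bar> * vweak_norm 3 v"
  unfolding vweak_norm_le_iff
proof
  fix i
  have "weak_norm 3 (\<lambda>x. c * v x $ i) \<le> ennreal \<bar>c\<bar> * weak_norm 3 (\<lambda>x. v x $ i)"
    by (rule weak_norm_cmult_le) (use assms in simp_all)
  also have "\<dots> \<le> ennreal \<bar>c\<bar> * vweak_norm 3 v"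
    by (intro mult_left_mono weak_norm_component_le) simp
  finally show "weak_norm 3 (\<lambda>x. (c *\<^sub>R v x) $ i) \<le> ennreal \<bar>c\<bar> * vweak_norm 3 v" by simp
qed

lemma vweak_norm_zero [simp]: "vweak_norm 3 (\<lambda>x. 0) = 0"
  using vweak_norm_le_iff [of 3 "\<lambda>x. 0" 0] by simp

lemma weak_L_add: "v \<in> weak_L 3 \<Longrightarrow> w \<in> weak_L 3 \<Longrightarrow> (\<lambda>x. v x + w x) \<in> weak_L 3"
  using vweak_norm_add_le [of v w] by (auto simp: weak_L_def intro: le_less_trans)

lemma weak_L_uminus: "v \<in> weak_L 3 \<Longrightarrow> (\<lambda>x. - v x) \<in> weak_L 3"
  by (auto simp: weak_L_def)

lemma weak_L_diff: "v \<in> weak_L 3 \<Longrightarrow> w \<in> weak_L 3 \<Longrightarrow> (\<lambda>x. v x - w x) \<in> weak_L 3"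
  using weak_L_add [of v "\<lambda>x. - w x"] weak_L_uminus [of w] by simp

lemma weak_L_scaleR: "v \<in> weak_L 3 \<Longrightarrow> (\<lambda>x. c *\<^sub>R v x) \<in> weak_L 3"
  using vweak_norm_scaleR_le [of v c]
  by (auto simp: weak_L_def ennreal_mult_less_top intro: le_less_trans)

section \<open>Integrability against weak \<open>L\<^sup>3\<close> functions\<close>

text \<open>Chebyshev's inequality on \<open>E = {|f| > l}\<close>: \<open>l |E| \<le> A |E|\<^bsup>2/3\<^esup>\<close>.  Dividing by \<open>|E|\<^bsup>2/3\<^esup>\<close>
  presupposes \<open>|E| < \<infinity>\<close>, so \<open>E\<close> is exhausted by its intersections with balls.\<close>
lemma measure_superlevel_le:
  assumes f [measurable]: "f \<in> borel_measurable lborel" and A: "weak_norm 3 f \<le> ennreal A" "0 \<le> A"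
    and l: "0 < l"
  shows "emeasure lborel {x. l < \<bar>f x\<bar>} \<le> ennreal ((A / l) ^ 3)"
proof -
  define E where "E n = {x. l < \<bar>f x\<bar>} \<inter> ball 0 (real n)" for n
  have E[measurable]: "E n \<in> sets borel" for n unfolding E_def by measurable
  have fin: "emeasure lborel (E n) < \<infinity>" for n
  proof -
    have "emeasure lborel (E n) \<le> emeasure lborel (ball (0::real^3) n)"
      by (rule emeasure_mono) (auto simp: E_def)
    also have "\<dots> < \<infinity>" using emeasure_lborel_ball_finite by (simp add: less_top)
    finally show ?thesis .
  qed
  have bound: "emeasure lborel (E n) \<le> ennreal ((A / l) ^ 3)" for n
  proof -
    define m where "m = measure lborel (E n)"
    have em: "emeasure lborel (E n) = ennreal m"
      unfolding m_def using fin[of n] by (simp add: emeasure_eq_ennreal_measure less_top)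
    have "ennreal (l * m) = (\<integral>\<^sup>+x\<in>E n. ennreal l \<partial>lborel)"
      using l by (simp add: nn_integral_cmult em ennreal_mult m_def)
    also have "\<dots> \<le> (\<integral>\<^sup>+x\<in>E n. ennreal \<bar>f x\<bar> \<partial>lborel)"
      by (rule nn_integral_mono) (auto simp: E_def indicator_def intro: ennreal_leI)
    also have "\<dots> \<le> ennreal (m powr (2/3)) * weak_norm 3 f"
      unfolding m_def by (intro set_integral_le_weak_norm fin E)
    also have "\<dots> \<le> ennreal (m powr (2/3)) * ennreal A"
      by (intro mult_left_mono A) simp
    finally have le: "l * m \<le> m powr (2/3) * A"
      using A by (simp add: ennreal_mult [symmetric] ennreal_le_iff)
    have "m \<le> (A/l)^3"
    proof (cases "m = 0")
      case False
      then have "m > 0" by (simp add: m_def zero_less_measure_iff)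
      have "m = m powr (2/3) * m powr (1/3)" using \<open>m > 0\<close> by (simp add: powr_add [symmetric])
      then have "m powr (2/3) * (l * m powr (1/3)) \<le> m powr (2/3) * A"
        using le by (metis mult.assoc mult.commute)
      then have "l * m powr (1/3) \<le> A" using \<open>m > 0\<close> by simp
      then have "m powr (1/3) \<le> A / l" using l by (simp add: field_simps)
      then have "(m powr (1/3)) ^ 3 \<le> (A/l)^3" by (rule power_mono) simp
      moreover have "(m powr (1/3)) ^ 3 = m" using \<open>m > 0\<close> by (simp add: powr_power)
      ultimately show ?thesis by simp
    qed (use A l in simp)
    then show ?thesis by (simp add: em ennreal_leI)
  qed
  have "{x. l < \<bar>f x\<bar>} = (\<Union>n. E n)"
  proof (intro set_eqI iffI)
    fix x assume "x \<in> {x. l < \<bar>f x\<bar>}"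
    moreover obtain n where "norm x < real n" using reals_Archimedean2 by blast
    ultimately show "x \<in> (\<Union>n. E n)" by (auto simp: E_def)
  qed (auto simp: E_def)
  then have "emeasure lborel {x. l < \<bar>f x\<bar>} = (SUP n. emeasure lborel (E n))"
    by (subst SUP_emeasure_incseq) (auto simp: E_def incseq_def)
  also have "\<dots> \<le> ennreal ((A / l) ^ 3)" by (rule SUP_least) (rule bound)
  finally show ?thesis .
qed

text \<open>Test the norm on the superlevel set, whose measure is at most \<open>(A / l)\<^sup>3\<close>.\<close>
lemma weak_tail_integral_le:
  assumes f [measurable]: "f \<in> borel_measurable lborel" and A: "weak_norm 3 f \<le> ennreal A" "0 \<le> A"
    and l: "0 < l"
  shows "(\<integral>\<^sup>+x. ennreal \<bar>f x\<bar> * indicator {x. l < \<bar>f x\<bar>} x \<partial>lborel) \<le> ennreal (A ^ 3 / l\<^sup>2)"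
proof -
  define E where "E = {x. l < \<bar>f x\<bar>}"
  have [measurable]: "E \<in> sets borel" unfolding E_def by measurable
  have le: "emeasure lborel E \<le> ennreal ((A / l) ^ 3)"
    unfolding E_def by (rule measure_superlevel_le [OF assms])
  then have fin: "emeasure lborel E < \<infinity>" by (auto intro: le_less_trans)
  have m: "measure lborel E \<le> (A/l)^3"
    using le A l fin by (simp add: emeasure_eq_ennreal_measure less_top ennreal_le_iff)
  have "(\<integral>\<^sup>+x\<in>E. ennreal \<bar>f x\<bar> \<partial>lborel) \<le> ennreal (measure lborel E powr (2/3)) * weak_norm 3 f"
    by (intro set_integral_le_weak_norm fin) simp
  also have "\<dots> \<le> ennreal ((A/l)^2) * ennreal A"
  proof (intro mult_mono A ennreal_leI)
    have "measure lborel E powr (2/3) \<le> ((A/l)^3) powr (2/3)"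
      by (rule powr_mono2) (use m in auto)
    also have "\<dots> = (A/l)^2"
    proof (cases "A = 0")
      case False
      then have "A/l > 0" using A l by simp
      then have "((A/l)^3) powr (2/3) = ((A/l) powr real 3) powr (2/3)"
        using powr_realpow [OF \<open>A/l > 0\<close>, of 3] by simp
      also have "\<dots> = (A/l) powr real 2" by (simp add: powr_powr)
      also have "\<dots> = (A/l)^2" using \<open>A/l > 0\<close> by (rule powr_realpow)
      finally show ?thesis .
    qed simp
    finally show "measure lborel E powr (2/3) \<le> (A/l)\<^sup>2" .
  qed auto
  also have "\<dots> = ennreal (A ^ 3 / l\<^sup>2)"
    using A l by (simp add: ennreal_mult [symmetric] power_divide power3_eq_cube power2_eq_square)
  finally show ?thesis by (simp add: E_def)
qed

text \<open>A weak \<open>L\<^sup>3\<close> function is the sum of a function bounded by \<open>l\<close> and an integrable one; the kernel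
  takes the first part by its \<open>L\<^sup>1\<close> norm and the second by its maximum.  The free height \<open>l\<close> is
  what later turns this into decay of the heat semigroup.\<close>
lemma nn_integral_weak_mult_le:
  fixes k :: "real^3 \<Rightarrow> real"
  assumes f [measurable]: "f \<in> borel_measurable lborel" and A: "weak_norm 3 f \<le> ennreal A" "0 \<le> A"
    and k [measurable]: "k \<in> borel_measurable lborel" and K: "\<And>x. \<bar>k x\<bar> \<le> K" and l: "0 < l"
  shows "(\<integral>\<^sup>+x. ennreal \<bar>f x * k x\<bar> \<partial>lborel)
     \<le> ennreal l * (\<integral>\<^sup>+x. ennreal \<bar>k x\<bar> \<partial>lborel) + ennreal (K * A ^ 3 / l\<^sup>2)"
proof -
  have "K \<ge> 0" using K [of 0] by auto
  have "(\<integral>\<^sup>+x. ennreal \<bar>f x * k x\<bar> \<partial>lborel) \<le>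
     (\<integral>\<^sup>+x. ennreal l * ennreal \<bar>k x\<bar> + ennreal K * (ennreal \<bar>f x\<bar> * indicator {x. l < \<bar>f x\<bar>} x) \<partial>lborel)"
  proof (rule nn_integral_mono)
    fix x
    show "ennreal \<bar>f x * k x\<bar> \<le> ennreal l * ennreal \<bar>k x\<bar> + ennreal K * (ennreal \<bar>f x\<bar> * indicator {x. l < \<bar>f x\<bar>} x)"
    proof (cases "l < \<bar>f x\<bar>")
      case True
      have "ennreal \<bar>f x * k x\<bar> \<le> ennreal (K * \<bar>f x\<bar>)"
        using K[of x] by (intro ennreal_leI) (simp add: abs_mult mult.commute [of K] mult_left_mono)
      also have "\<dots> = ennreal K * (ennreal \<bar>f x\<bar> * indicator {x. l < \<bar>f x\<bar>} x)"
        using True \<open>K \<ge> 0\<close> by (simp add: ennreal_mult)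
      finally show ?thesis by (simp add: add_increasing)
    next
      case False
      have "ennreal \<bar>f x * k x\<bar> \<le> ennreal (l * \<bar>k x\<bar>)"
        using False by (intro ennreal_leI) (simp add: abs_mult mult_right_mono)
      also have "\<dots> = ennreal l * ennreal \<bar>k x\<bar>" using l by (simp add: ennreal_mult)
      finally show ?thesis by (simp add: add_increasing2)
    qed
  qed
  also have "\<dots> = ennreal l * (\<integral>\<^sup>+x. ennreal \<bar>k x\<bar> \<partial>lborel) +
      ennreal K * (\<integral>\<^sup>+x. ennreal \<bar>f x\<bar> * indicator {x. l < \<bar>f x\<bar>} x \<partial>lborel)"
    by (subst nn_integral_add) (auto simp: nn_integral_cmult)
  also have "\<dots> \<le> ennreal l * (\<integral>\<^sup>+x. ennreal \<bar>k x\<bar> \<partial>lborel) + ennreal K * ennreal (A ^ 3 / l\<^sup>2)"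
    by (intro add_left_mono mult_left_mono weak_tail_integral_le assms) auto
  also have "\<dots> = ennreal l * (\<integral>\<^sup>+x. ennreal \<bar>k x\<bar> \<partial>lborel) + ennreal (K * A ^ 3 / l\<^sup>2)"
    using \<open>K \<ge> 0\<close> A by (simp add: ennreal_mult [symmetric])
  finally show ?thesis .
qed

lemma weak_norm_realE:
  assumes "weak_norm 3 f < \<infinity>"
  obtains A where "A \<ge> 0" "weak_norm 3 f \<le> ennreal A"
  using assms by (metis ennreal_enn2real enn2real_nonneg infinity_ennreal_def order_refl)

lemma weak_integrable_mult:
  fixes k :: "real^3 \<Rightarrow> 'b::{banach, second_countable_topology}"
  assumes f [measurable]: "f \<in> borel_measurable lborel" and fin: "weak_norm 3 f < \<infinity>"
    and k: "integrable lborel k" and K: "\<And>x. norm (k x) \<le> K"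
  shows "integrable lborel (\<lambda>x. f x *\<^sub>R k x)"
proof -
  have [measurable]: "k \<in> borel_measurable lborel" using k by simp
  obtain A where A: "A \<ge> 0" "weak_norm 3 f \<le> ennreal A" using fin by (rule weak_norm_realE)
  have "(\<integral>\<^sup>+x. ennreal (norm (f x *\<^sub>R k x)) \<partial>lborel) = (\<integral>\<^sup>+x. ennreal \<bar>f x * norm (k x)\<bar> \<partial>lborel)"
    by (simp add: abs_mult)
  also have "\<dots> \<le> ennreal 1 * (\<integral>\<^sup>+x. ennreal \<bar>norm (k x)\<bar> \<partial>lborel) + ennreal (K * A ^ 3 / 1\<^sup>2)"
    by (rule nn_integral_weak_mult_le) (use A K in auto)
  also have "\<dots> < \<infinity>"
    using k by (auto simp: integrable_iff_bounded)
  finally show ?thesis by (simp add: integrable_iff_bounded)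
qed

text \<open>The tail integral decays like \<open>l\<^bsup>-2\<^esup>\<close>, so the dyadic layers \<open>2\<^sup>n < |f| \<le> 2\<^bsup>n+1\<^esup>\<close> contribute
  \<open>O(2\<^sup>n 4\<^bsup>-n\<^esup>)\<close> to the integral of \<open>f\<^sup>2\<close>: away from its small values, \<open>f\<close> is square integrable.\<close>
lemma weak_square_tail_finite:
  assumes f [measurable]: "f \<in> borel_measurable lborel" and fin: "weak_norm 3 f < \<infinity>"
  shows "(\<integral>\<^sup>+x. ennreal ((f x)\<^sup>2) * indicator {x. 1 < \<bar>f x\<bar>} x \<partial>lborel) < \<infinity>"
proof -
  obtain A where A: "A \<ge> 0" "weak_norm 3 f \<le> ennreal A" using fin by (rule weak_norm_realE)
  define T where "T n x = ennreal (2 ^ Suc n) * (ennreal \<bar>f x\<bar> * indicator {x. 2 ^ n < \<bar>f x\<bar>} x)" for n x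
  have [measurable]: "T n \<in> borel_measurable lborel" for n unfolding T_def by measurable
  have "(\<integral>\<^sup>+x. ennreal ((f x)\<^sup>2) * indicator {x. 1 < \<bar>f x\<bar>} x \<partial>lborel) \<le> (\<integral>\<^sup>+x. (\<Sum>n. T n x) \<partial>lborel)"
  proof (rule nn_integral_mono)
    fix x
    show "ennreal ((f x)\<^sup>2) * indicator {x. 1 < \<bar>f x\<bar>} x \<le> (\<Sum>n. T n x)"
    proof (cases "1 < \<bar>f x\<bar>")
      case True
      \<comment> \<open>\<open>n\<close> is the dyadic level of \<open>\<bar>f x\<bar>\<close>: \<open>2 ^ n < \<bar>f x\<bar> \<le> 2 ^ Suc n\<close>\<close>
      define n where "n = (LEAST n. \<bar>f x\<bar> \<le> 2 ^ Suc n)"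
      obtain m where "\<bar>f x\<bar> < 2 ^ m" using real_arch_pow [of 2 "\<bar>f x\<bar>"] by auto
      then have "\<bar>f x\<bar> \<le> 2 ^ Suc m" by (simp add: less_imp_le order.trans [OF less_imp_le])
      then have n: "\<bar>f x\<bar> \<le> 2 ^ Suc n" unfolding n_def by (rule LeastI)
      have n': "2 ^ n < \<bar>f x\<bar>"
      proof (cases n)
        case (Suc j)
        then have "\<not> \<bar>f x\<bar> \<le> 2 ^ Suc j" unfolding n_def by (intro not_less_Least) simp
        then show ?thesis using Suc by simp
      qed (use True in simp)
      have "(f x)\<^sup>2 \<le> 2 ^ Suc n * \<bar>f x\<bar>"
        using n by (metis abs_ge_zero mult_right_mono power2_abs power2_eq_square)
      then have "ennreal ((f x)\<^sup>2) * indicator {x. 1 < \<bar>f x\<bar>} x \<le> T n x"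
        using True n' by (simp add: T_def ennreal_mult [symmetric] ennreal_leI del: power_Suc)
      also have "\<dots> = (\<Sum>i\<in>{n}. T i x)" by simp
      also have "\<dots> \<le> (\<Sum>n. T n x)" by (rule sum_le_suminf) auto
      finally show ?thesis .
    qed simp
  qed
  also have "\<dots> = (\<Sum>n. \<integral>\<^sup>+x. T n x \<partial>lborel)" by (rule nn_integral_suminf) simp
  also have "\<dots> \<le> (\<Sum>n. ennreal (2 * A ^ 3 * (1/2) ^ n))"
  proof (rule suminf_le)
    fix n
    have "(\<integral>\<^sup>+x. T n x \<partial>lborel) = ennreal (2 ^ Suc n) * (\<integral>\<^sup>+x. ennreal \<bar>f x\<bar> * indicator {x. 2 ^ n < \<bar>f x\<bar>} x \<partial>lborel)"
      unfolding T_def by (rule nn_integral_cmult) simp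
    also have "\<dots> \<le> ennreal (2 ^ Suc n) * ennreal (A ^ 3 / (2 ^ n)\<^sup>2)"
      by (intro mult_left_mono weak_tail_integral_le A) auto
    also have "\<dots> = ennreal (2 * A ^ 3 * (1/2) ^ n)"
      using A by (simp add: ennreal_mult [symmetric] power2_eq_square field_simps)
    finally show "(\<integral>\<^sup>+x. T n x \<partial>lborel) \<le> ennreal (2 * A ^ 3 * (1/2) ^ n)" .
  qed auto
  also have "\<dots> = ennreal (\<Sum>n. 2 * A ^ 3 * (1/2) ^ n)"
    by (rule suminf_ennreal2) (use A in \<open>auto intro!: summable_mult summable_geometric\<close>)
  also have "\<dots> < \<infinity>" by simp
  finally show ?thesis .
qed

text \<open>Both factors lie in \<open>L\<^sup>2 + L\<^sup>\<infinity>\<close>, hence their product in \<open>L\<^sup>1 + L\<^sup>\<infinity>\<close>.  This makes the pairings of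
  \<open>v \<otimes> w\<close> with derivatives of test functions converge absolutely, so that they are
  bilinear in \<open>v\<close> and \<open>w\<close>.\<close>
lemma weak_integrable_mult2:
  fixes k :: "real^3 \<Rightarrow> 'b::{banach, second_countable_topology}"
  assumes f [measurable]: "f \<in> borel_measurable lborel" and ff: "weak_norm 3 f < \<infinity>"
    and g [measurable]: "g \<in> borel_measurable lborel" and gf: "weak_norm 3 g < \<infinity>"
    and k: "integrable lborel k" and K: "\<And>x. norm (k x) \<le> K"
  shows "integrable lborel (\<lambda>x. (f x * g x) *\<^sub>R k x)"
proof -
  have [measurable]: "k \<in> borel_measurable lborel" using k by simp
  have "K \<ge> 0" using K [of 0] norm_ge_zero order_trans by blast
  define F where "F h x = ennreal (h x ^ 2) * indicator {x. 1 < \<bar>h x\<bar>} x" for h :: "real^3 \<Rightarrow> real" and x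
  have [measurable]: "F f \<in> borel_measurable lborel" "F g \<in> borel_measurable lborel"
    unfolding F_def by measurable
  have sq: "ennreal (h x ^ 2) \<le> 1 + F h x" for h x
  proof (cases "1 < \<bar>h x\<bar>")
    case False
    then have "h x ^ 2 \<le> 1" by (simp add: abs_square_le_1)
    then show ?thesis using False by (auto simp: F_def)
  qed (auto simp: F_def add_increasing)
  have "(\<integral>\<^sup>+x. ennreal (norm ((f x * g x) *\<^sub>R k x)) \<partial>lborel)
     \<le> (\<integral>\<^sup>+x. 2 * ennreal (norm (k x)) + ennreal K * (F f x + F g x) \<partial>lborel)"
  proof (rule nn_integral_mono)
    fix x
    have "\<bar>f x * g x\<bar> \<le> (f x)\<^sup>2 + (g x)\<^sup>2"
    proof -
      have "0 \<le> (\<bar>f x\<bar> - \<bar>g x\<bar>)\<^sup>2" by simp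
      then have "2 * (\<bar>f x\<bar> * \<bar>g x\<bar>) \<le> (f x)\<^sup>2 + (g x)\<^sup>2" by (simp add: power2_diff)
      moreover have "0 \<le> \<bar>f x\<bar> * \<bar>g x\<bar>" by simp
      ultimately show ?thesis unfolding abs_mult by linarith
    qed
    then have "norm ((f x * g x) *\<^sub>R k x) \<le> norm (k x) * ((f x)\<^sup>2 + (g x)\<^sup>2)"
      by (simp add: mult_left_mono mult.commute [of _ "norm (k x)"])
    then have "ennreal (norm ((f x * g x) *\<^sub>R k x)) \<le> ennreal (norm (k x)) * (ennreal ((f x)\<^sup>2) + ennreal ((g x)\<^sup>2))"
      by (simp add: ennreal_mult [symmetric] ennreal_leI ennreal_plus [symmetric] del: ennreal_plus)
    also have "\<dots> \<le> ennreal (norm (k x)) * ((1 + F f x) + (1 + F g x))"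
      by (intro mult_left_mono add_mono sq) simp
    also have "\<dots> = 2 * ennreal (norm (k x)) + ennreal (norm (k x)) * (F f x + F g x)"
      by (simp add: distrib_left mult_2 add_ac)
    also have "\<dots> \<le> 2 * ennreal (norm (k x)) + ennreal K * (F f x + F g x)"
      by (intro add_left_mono mult_right_mono ennreal_leI K) simp
    finally show "ennreal (norm ((f x * g x) *\<^sub>R k x)) \<le> 2 * ennreal (norm (k x)) + ennreal K * (F f x + F g x)" .
  qed
  also have "\<dots> = 2 * (\<integral>\<^sup>+x. ennreal (norm (k x)) \<partial>lborel) + ennreal K * ((\<integral>\<^sup>+x. F f x \<partial>lborel) + (\<integral>\<^sup>+x. F g x \<partial>lborel))"
    by (subst nn_integral_add) (auto simp: nn_integral_cmult nn_integral_add)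
  also have "\<dots> < \<infinity>"
    using k weak_square_tail_finite [OF f ff] weak_square_tail_finite [OF g gf]
    by (auto simp: integrable_iff_bounded F_def ennreal_mult_less_top)
  finally show ?thesis by (simp add: integrable_iff_bounded)
qed

text \<open>The quasi-norm of \<open>L\<^bsup>3/2,1\<^esup>\<close>, whose finiteness defines membership in \<^term>\<open>lorentz_one (3 / (3 - 1))\<close>.\<close>
definition lorentz_norm :: "(real^3 \<Rightarrow> real) \<Rightarrow> ennreal" where
  "lorentz_norm g = (\<integral>\<^sup>+ s\<in>{0<..}. ennreal (measure lborel {x. s < \<bar>g x\<bar>} powr (2/3)) \<partial>lborel)"

lemma lorentz_oneD:
  assumes "g \<in> lorentz_one (3 / (3 - 1))"
  shows "g \<in> borel_measurable lborel" "lorentz_norm g < \<infinity>"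
    "0 < s \<Longrightarrow> emeasure lborel {x. s < \<bar>g x\<bar>} < \<infinity>"
  using assms by (auto simp: lorentz_one_def lorentz_norm_def)

text \<open>Write \<open>|g|\<close> as the integral of the indicators of its superlevel sets (layer cake) and apply the
  definition of the weak norm to each of these sets.  This is what makes convergence in the weak
  \<open>L\<^sup>3\<close> norm imply the weak convergence at \<open>t = 0\<close> in the definition of \<open>X\<^sub>3\<close>.\<close>
lemma lorentz_duality:
  assumes f [measurable]: "f \<in> borel_measurable lborel" and g: "g \<in> lorentz_one (3 / (3 - 1))"
  shows "(\<integral>\<^sup>+x. ennreal \<bar>f x * g x\<bar> \<partial>lborel) \<le> weak_norm 3 f * lorentz_norm g"
proof -
  note [measurable] = lorentz_oneD(1) [OF g]
  have layer: "ennreal \<bar>g x\<bar> = (\<integral>\<^sup>+ s. indicator {0<..} s * indicator {s. s < \<bar>g x\<bar>} s \<partial>lborel)" for x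
  proof -
    have "(\<integral>\<^sup>+ s. indicator {0<..} s * indicator {s. s < \<bar>g x\<bar>} s \<partial>lborel)
        = (\<integral>\<^sup>+ s. indicator {0<..<\<bar>g x\<bar>} s \<partial>lborel)"
      by (rule nn_integral_cong) (auto simp: indicator_def)
    then show ?thesis by simp
  qed
  have "(\<integral>\<^sup>+x. ennreal \<bar>f x * g x\<bar> \<partial>lborel)
      = (\<integral>\<^sup>+x. \<integral>\<^sup>+s. ennreal \<bar>f x\<bar> * (indicator {0<..} s * indicator {s. s < \<bar>g x\<bar>} s) \<partial>lborel \<partial>lborel)"
    by (subst nn_integral_cmult) (auto simp: layer abs_mult ennreal_mult)
  also have "\<dots> = (\<integral>\<^sup>+s. \<integral>\<^sup>+x. ennreal \<bar>f x\<bar> * (indicator {0<..} s * indicator {s. s < \<bar>g x\<bar>} s) \<partial>lborel \<partial>lborel)"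
  proof (rule lborel_pair.Fubini' [symmetric])
    have "(\<lambda>(x, s). ennreal \<bar>f x\<bar> * (indicator {0<..} s * indicator {z. snd z < \<bar>g (fst z)\<bar>} (x, s)))
      \<in> borel_measurable (lborel \<Otimes>\<^sub>M lborel)" by measurable
    then show "(\<lambda>(x, s). ennreal \<bar>f x\<bar> * (indicator {0<..} s * indicator {s. s < \<bar>g x\<bar>} s))
      \<in> borel_measurable (lborel \<Otimes>\<^sub>M lborel)"
      by (simp add: indicator_def cong: if_cong)
  qed
  also have "\<dots> \<le> (\<integral>\<^sup>+s. weak_norm 3 f * (ennreal (measure lborel {x. s < \<bar>g x\<bar>} powr (2/3)) * indicator {0<..} s) \<partial>lborel)"
  proof (rule nn_integral_mono)
    fix s :: real
    show "(\<integral>\<^sup>+x. ennreal \<bar>f x\<bar> * (indicator {0<..} s * indicator {s. s < \<bar>g x\<bar>} s) \<partial>lborel)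
       \<le> weak_norm 3 f * (ennreal (measure lborel {x. s < \<bar>g x\<bar>} powr (2/3)) * indicator {0<..} s)"
    proof (cases "0 < s")
      case True
      have "(\<integral>\<^sup>+x. ennreal \<bar>f x\<bar> * (indicator {0<..} s * indicator {s. s < \<bar>g x\<bar>} s) \<partial>lborel)
         = (\<integral>\<^sup>+x\<in>{x. s < \<bar>g x\<bar>}. ennreal \<bar>f x\<bar> \<partial>lborel)"
        using True by (intro nn_integral_cong) (auto simp: indicator_def)
      also have "\<dots> \<le> ennreal (measure lborel {x. s < \<bar>g x\<bar>} powr (2/3)) * weak_norm 3 f"
        by (rule set_integral_le_weak_norm) (use lorentz_oneD(3)[OF g True] in auto)
      finally show ?thesis using True by (simp add: mult.commute)
    qed simp
  qed
  also have "\<dots> = weak_norm 3 f * lorentz_norm g"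
    unfolding lorentz_norm_def
  proof (rule nn_integral_cmult)
    have "(\<lambda>s. measure lborel {x. s < \<bar>g x\<bar>}) = (\<lambda>s. enn2real (\<integral>\<^sup>+x. indicator {z. fst z < \<bar>g (snd z)\<bar>} (s, x) \<partial>lborel))"
      by (intro ext) (simp add: measure_def nn_integral_indicator [symmetric] indicator_def del: nn_integral_indicator)
    also have "\<dots> \<in> borel_measurable lborel" by measurable
    finally have [measurable]: "(\<lambda>s. measure lborel {x. s < \<bar>g x\<bar>}) \<in> borel_measurable lborel" .
    show "(\<lambda>s. ennreal (measure lborel {x. s < \<bar>g x\<bar>} powr (2/3)) * indicator {0<..} s) \<in> borel_measurable lborel"
      by measurable
  qed
  finally show ?thesis .
qed

lemma lorentz_integrable:
  assumes "f \<in> borel_measurable lborel" "weak_norm 3 f < \<infinity>" "g \<in> lorentz_one (3 / (3 - 1))"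
  shows "integrable lborel (\<lambda>x. f x * g x)"
  using lorentz_duality [OF assms(1,3)] lorentz_oneD(1,2)[OF assms(3)] assms(1,2)
  by (auto simp: integrable_iff_bounded ennreal_mult_less_top intro: le_less_trans)

section \<open>Translation invariance\<close>

lemma lborel_integral_translate:
  fixes f :: "'a::euclidean_space \<Rightarrow> 'b::{banach, second_countable_topology}"
  assumes [measurable]: "f \<in> borel_measurable borel"
  shows "(LINT x|lborel. f (x + h)) = (LINT x|lborel. f x)"
proof -
  have "(LINT x|lborel. f x) = (LINT x|distr lborel borel ((+) h). f x)"
    by (simp add: lborel_distr_plus)
  also have "\<dots> = (LINT x|lborel. f (h + x))" by (rule integral_distr) auto
  finally show ?thesis by (simp add: add.commute)
qed

lemma lborel_nn_integral_translate:
  fixes f :: "'a::euclidean_space \<Rightarrow> ennreal"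
  assumes [measurable]: "f \<in> borel_measurable borel"
  shows "(\<integral>\<^sup>+x. f (x + h) \<partial>lborel) = (\<integral>\<^sup>+x. f x \<partial>lborel)"
proof -
  have "(\<integral>\<^sup>+x. f x \<partial>lborel) = (\<integral>\<^sup>+x. f x \<partial>distr lborel borel ((+) h))"
    by (simp add: lborel_distr_plus)
  also have "\<dots> = (\<integral>\<^sup>+x. f (h + x) \<partial>lborel)" by (rule nn_integral_distr) auto
  finally show ?thesis by (simp add: add.commute)
qed

lemma lborel_distr_reflect:
  "distr lborel borel (\<lambda>x. t - x) = (lborel :: 'a::euclidean_space measure)"
  using lborel_affine [of "-1" t] by (simp add: density_1 one_ennreal_def [symmetric])

lemma lborel_nn_integral_reflect:
  fixes f :: "'a::euclidean_space \<Rightarrow> ennreal"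
  assumes [measurable]: "f \<in> borel_measurable borel"
  shows "(\<integral>\<^sup>+x. f (t - x) \<partial>lborel) = (\<integral>\<^sup>+x. f x \<partial>lborel)"
proof -
  have "(\<integral>\<^sup>+x. f x \<partial>lborel) = (\<integral>\<^sup>+x. f x \<partial>distr lborel borel (\<lambda>x. t - x))"
    by (simp add: lborel_distr_reflect)
  also have "\<dots> = (\<integral>\<^sup>+x. f (t - x) \<partial>lborel)" by (rule nn_integral_distr) auto
  finally show ?thesis by simp
qed

lemma lborel_integral_reflect:
  fixes f :: "'a::euclidean_space \<Rightarrow> 'b::{banach, second_countable_topology}"
  assumes [measurable]: "f \<in> borel_measurable borel"
  shows "(LINT x|lborel. f (t - x)) = (LINT x|lborel. f x)"
proof -
  have "(LINT x|lborel. f x) = (LINT x|distr lborel borel (\<lambda>x. t - x). f x)"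
    by (simp add: lborel_distr_reflect)
  also have "\<dots> = (LINT x|lborel. f (t - x))" by (rule integral_distr) auto
  finally show ?thesis by simp
qed

lemma lborel_integrable_translate:
  fixes f :: "'a::euclidean_space \<Rightarrow> 'b::{banach, second_countable_topology}"
  assumes "integrable lborel f"
  shows "integrable lborel (\<lambda>x. f (x + h))"
proof -
  have [measurable]: "f \<in> borel_measurable borel" using assms by auto
  show ?thesis
    using assms lborel_nn_integral_translate [of "\<lambda>x. ennreal (norm (f x))" h]
    by (simp add: integrable_iff_bounded)
qed

lemma lborel_integrable_reflect:
  fixes f :: "'a::euclidean_space \<Rightarrow> 'b::{banach, second_countable_topology}"
  assumes "integrable lborel f"
  shows "integrable lborel (\<lambda>x. f (t - x))"
proof -
  have [measurable]: "f \<in> borel_measurable borel" using assms by auto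
  show ?thesis
    using assms lborel_nn_integral_reflect [of "\<lambda>x. ennreal (norm (f x))" t]
    by (simp add: integrable_iff_bounded)
qed

text \<open>Integration by parts without boundary terms: by the fundamental theorem of calculus, the
  average of \<open>G\<close> over segments of direction \<open>h\<close> is a difference of translates of \<open>F\<close>, and
  translates have equal integrals.\<close>
lemma integral_directional_derivative_eq_0:
  fixes F G :: "real^3 \<Rightarrow> 'b::euclidean_space"
  assumes F: "integrable lborel F" and G: "integrable lborel G" and cont: "continuous_on UNIV G"
    and deriv: "\<And>x. \<exists>D. (F has_derivative D) (at x) \<and> D h = G x"
  shows "(LINT x|lborel. G x) = 0"
proof -
  have [measurable]: "F \<in> borel_measurable borel" "G \<in> borel_measurable borel" using F G by auto
  have FTC: "(LINT r|lborel. indicator {0..1} r *\<^sub>R G (x + r *\<^sub>R h)) = F (x + h) - F x" for x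
  proof -
    have "(LINT r|lborel. indicator {0..1} r *\<^sub>R G (x + r *\<^sub>R h)) = F (x + 1 *\<^sub>R h) - F (x + 0 *\<^sub>R h)"
    proof (rule integral_FTC_Icc)
      show "((\<lambda>r. F (x + r *\<^sub>R h)) has_vector_derivative G (x + r *\<^sub>R h)) (at r within {0..1})" for r
      proof -
        obtain D where D: "(F has_derivative D) (at (x + r *\<^sub>R h))" "D h = G (x + r *\<^sub>R h)"
          using deriv by blast
        have "((\<lambda>r. x + r *\<^sub>R h) has_derivative (\<lambda>r. r *\<^sub>R h)) (at r within {0..1})"
          by (auto intro!: derivative_eq_intros)
        then have "((\<lambda>r. F (x + r *\<^sub>R h)) has_derivative (\<lambda>s. D (s *\<^sub>R h))) (at r within {0..1})"
          using D(1) by (rule has_derivative_compose [where g = F])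
        moreover have "D (s *\<^sub>R h) = s *\<^sub>R D h" for s
          using D(1) has_derivative_bounded_linear bounded_linear.linear linear_scale by blast
        ultimately show ?thesis by (simp add: has_vector_derivative_def D(2))
      qed
      show "continuous_on {0..1} (\<lambda>r. G (x + r *\<^sub>R h))"
        by (rule continuous_on_compose2 [OF cont]) (auto intro!: continuous_intros)
    qed auto
    then show ?thesis by simp
  qed
  have "0 = (LINT x|lborel. F (x + h)) - (LINT x|lborel. F x)"
    by (simp add: lborel_integral_translate)
  also have "\<dots> = (LINT x|lborel. F (x + h) - F x)"
    using F by (intro Bochner_Integration.integral_diff [symmetric] lborel_integrable_translate)
  also have "\<dots> = (LINT x|lborel. LINT r|lborel. indicator {0..1} r *\<^sub>R G (x + r *\<^sub>R h))"
    by (simp add: FTC)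
  also have "\<dots> = (LINT r|lborel. LINT x|lborel. indicator {0..1} r *\<^sub>R G (x + r *\<^sub>R h))"
  proof (rule lborel_pair.Fubini_integral [symmetric])
    have "(\<integral>\<^sup>+z. ennreal (norm (indicator {0..1} (snd z) *\<^sub>R G (fst z + snd z *\<^sub>R h))) \<partial>(lborel \<Otimes>\<^sub>M lborel))
      = (\<integral>\<^sup>+r. \<integral>\<^sup>+x. ennreal (norm (indicator {0..1} r *\<^sub>R G (x + r *\<^sub>R h))) \<partial>lborel \<partial>lborel)"
      by (subst lborel_pair.nn_integral_snd [symmetric]) auto
    also have "\<dots> = (\<integral>\<^sup>+r. indicator {0..1::real} r * (\<integral>\<^sup>+x. ennreal (norm (G x)) \<partial>lborel) \<partial>lborel)"
    proof (rule nn_integral_cong)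
      fix r :: real
      show "(\<integral>\<^sup>+x. ennreal (norm (indicator {0..1} r *\<^sub>R G (x + r *\<^sub>R h))) \<partial>lborel)
          = indicator {0..1} r * (\<integral>\<^sup>+x. ennreal (norm (G x)) \<partial>lborel)"
        using lborel_nn_integral_translate [of "\<lambda>x. ennreal (norm (G x))" "r *\<^sub>R h"]
        by (auto simp: indicator_def)
    qed
    also have "\<dots> = (\<integral>\<^sup>+x. ennreal (norm (G x)) \<partial>lborel)"
      by (subst nn_integral_multc) auto
    also have "\<dots> < \<infinity>" using G by (simp add: integrable_iff_bounded)
    finally show "integrable (lborel \<Otimes>\<^sub>M lborel) (\<lambda>(x, r). indicator {0..1} r *\<^sub>R G (x + r *\<^sub>R h))"
      by (simp add: integrable_iff_bounded case_prod_beta)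
  qed
  also have "\<dots> = (LINT r|lborel. indicator {0..1::real} r *\<^sub>R (LINT x|lborel. G x))"
    by (simp add: lborel_integral_translate)
  also have "\<dots> = (LINT x|lborel. G x)"
  proof -
    have "has_bochner_integral lborel (\<lambda>r. indicator {0..1::real} r *\<^sub>R (LINT x|lborel. G x))
        (measure lborel {0..1::real} *\<^sub>R (LINT x|lborel. G x))"
      by (rule has_bochner_integral_indicator) auto
    then show ?thesis by (simp add: has_bochner_integral_integral_eq)
  qed
  finally show ?thesis by simp
qed

section \<open>Polynomials times Gaussians\<close>

definition gauss :: "real \<Rightarrow> real^3 \<Rightarrow> real" where
  "gauss c x = exp (- c * (norm x)\<^sup>2)"

lemma gauss_pos [simp]: "0 < gauss c x" and gauss_nonneg [simp]: "0 \<le> gauss c x"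
  by (auto simp: gauss_def)

lemma continuous_on_gauss [continuous_intros]:
  "continuous_on A f \<Longrightarrow> continuous_on A (\<lambda>x. gauss c (f x))"
  unfolding gauss_def by (intro continuous_intros)

lemma gauss_has_derivative:
  "(gauss c has_derivative (\<lambda>v. - 2 * c * (x \<bullet> v) * gauss c x)) (at x)"
proof -
  have "((\<lambda>x::real^3. - c * (x \<bullet> x)) has_derivative (\<lambda>v. - 2 * c * (x \<bullet> v))) (at x)"
  proof -
    have "((\<lambda>x::real^3. x \<bullet> x) has_derivative (\<lambda>v. x \<bullet> v + v \<bullet> x)) (at x)"
      by (intro has_derivative_inner has_derivative_ident)
    then have "((\<lambda>x::real^3. - c * (x \<bullet> x)) has_derivative (\<lambda>v. - c * (x \<bullet> v + v \<bullet> x))) (at x)"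
      by (rule has_derivative_mult_right)
    then show ?thesis by (rule has_derivative_eq_rhs) (auto simp: inner_commute)
  qed
  from has_derivative_compose [OF this DERIV_exp [unfolded has_field_derivative_def]]
  show ?thesis
    unfolding gauss_def power2_norm_eq_inner by (simp add: mult_ac)
qed

lemma gauss_measurable [measurable]: "gauss c \<in> borel_measurable borel"
  by (intro borel_measurable_continuous_onI continuous_intros)

lemma real_polynomial_function_growth:
  fixes q :: "'a::real_normed_vector \<Rightarrow> real"
  assumes "real_polynomial_function q"
  shows "\<exists>C n. 0 \<le> C \<and> (\<forall>x. \<bar>q x\<bar> \<le> C * (1 + norm x) ^ n)"
  using assms
proof induction
  case (linear f)
  obtain K where K: "0 < K" "\<And>x. norm (f x) \<le> norm x * K" using bounded_linear.pos_bounded [OF linear] by blast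
  have "\<bar>f x\<bar> \<le> K * (1 + norm x) ^ 1" for x
    using K(2)[of x] K(1) by (simp add: algebra_simps)
  then show ?case using K(1) by (meson less_imp_le)
next
  case (const c)
  have "\<bar>c\<bar> \<le> \<bar>c\<bar> * (1 + norm x) ^ 0" for x :: 'a by simp
  then show ?case by (meson abs_ge_zero)
next
  case (add f g)
  then obtain C n D m where C: "0 \<le> C" "\<And>x. \<bar>f x\<bar> \<le> C * (1 + norm x) ^ n"
    and D: "0 \<le> D" "\<And>x. \<bar>g x\<bar> \<le> D * (1 + norm x) ^ m" by blast
  have "\<bar>f x + g x\<bar> \<le> (C + D) * (1 + norm x) ^ (n + m)" for x
  proof -
    have "C * (1 + norm x) ^ n \<le> C * (1 + norm x) ^ (n + m)"
      "D * (1 + norm x) ^ m \<le> D * (1 + norm x) ^ (n + m)"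
      using C(1) D(1) by (auto intro!: mult_left_mono power_increasing)
    then show ?thesis using C(2)[of x] D(2)[of x] by (simp add: distrib_right)
  qed
  then show ?case using C(1) D(1) by (meson add_nonneg_nonneg)
next
  case (mult f g)
  then obtain C n D m where C: "0 \<le> C" "\<And>x. \<bar>f x\<bar> \<le> C * (1 + norm x) ^ n"
    and D: "0 \<le> D" "\<And>x. \<bar>g x\<bar> \<le> D * (1 + norm x) ^ m" by blast
  have "\<bar>f x * g x\<bar> \<le> (C * D) * (1 + norm x) ^ (n + m)" for x
  proof -
    have "\<bar>f x\<bar> * \<bar>g x\<bar> \<le> (C * (1 + norm x) ^ n) * (D * (1 + norm x) ^ m)"
      by (rule mult_mono) (use C D in auto)
    then show ?thesis by (simp add: abs_mult power_add mult_ac)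
  qed
  then show ?case using C(1) D(1) by (meson mult_nonneg_nonneg)
qed

lemma real_polynomial_function_derivative:
  fixes q :: "'a::real_normed_vector \<Rightarrow> real"
  assumes "real_polynomial_function q"
  shows "\<exists>D. (\<forall>x. (q has_derivative D x) (at x)) \<and> (\<forall>h. real_polynomial_function (\<lambda>x. D x h))"
  using assms
proof induction
  case (linear f)
  then show ?case
    by (intro exI [of _ "\<lambda>x. f"]) (auto intro: bounded_linear_imp_has_derivative)
next
  case (const c)
  then show ?case
    by (intro exI [of _ "\<lambda>x h. 0"]) auto
next
  case (add f g)
  then obtain D E where "\<forall>x. (f has_derivative D x) (at x)" "\<forall>h. real_polynomial_function (\<lambda>x. D x h)"
    "\<forall>x. (g has_derivative E x) (at x)" "\<forall>h. real_polynomial_function (\<lambda>x. E x h)" by blast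
  then show ?case
    by (intro exI [of _ "\<lambda>x h. D x h + E x h"]) (auto intro!: has_derivative_add)
next
  case (mult f g)
  then obtain D E where "\<forall>x. (f has_derivative D x) (at x)" "\<forall>h. real_polynomial_function (\<lambda>x. D x h)"
    "\<forall>x. (g has_derivative E x) (at x)" "\<forall>h. real_polynomial_function (\<lambda>x. E x h)" by blast
  then show ?case
    using mult.hyps
    by (intro exI [of _ "\<lambda>x h. f x * E x h + D x h * g x"])
       (auto intro!: has_derivative_mult real_polynomial_function.intros(3,4))
qed

lemma real_polynomial_function_continuous:
  fixes q :: "'a::real_normed_vector \<Rightarrow> real"
  assumes "real_polynomial_function q" shows "continuous_on A q"
  using real_polynomial_function_derivative [OF assms]
  by (meson continuous_at_imp_continuous_on has_derivative_continuous)

lemma real_polynomial_function_inner [intro]: "real_polynomial_function (\<lambda>x. x \<bullet> h)"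
  by (intro real_polynomial_function.intros(1) bounded_linear_inner_left)

lemma real_polynomial_function_nth [intro]: "real_polynomial_function (\<lambda>x::real^3. x $ i)"
  by (intro real_polynomial_function.intros(1) bounded_linear_vec_nth)

lemma real_polynomial_function_norm_sq [intro]: "real_polynomial_function (\<lambda>x::real^3. (norm x)\<^sup>2)"
proof -
  have "(\<lambda>x::real^3. (norm x)\<^sup>2) = (\<lambda>x. \<Sum>i\<in>UNIV. x $ i * x $ i)"
    by (simp add: power2_norm_eq_inner inner_vec_def)
  moreover have "real_polynomial_function (\<lambda>x::real^3. \<Sum>i\<in>UNIV. x $ i * x $ i)"
    by (intro real_polynomial_function_sum real_polynomial_function.intros(4)) auto
  ultimately show ?thesis by simp
qed

text \<open>\<open>(1 + r)\<^sup>n \<le> e\<^bsup>n r\<^esup>\<close>, and \<open>n r - c r\<^sup>2\<close> is maximal at \<open>r = n / (2 c)\<close>.\<close>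
lemma power_times_gauss_bounded:
  assumes "0 < c"
  shows "(1 + norm x) ^ n * gauss c x \<le> exp ((real n)\<^sup>2 / (4 * c))"
proof -
  have "(1 + norm x) ^ n \<le> exp (norm x) ^ n"
    by (rule power_mono) auto
  also have "\<dots> = exp (real n * norm x)" by (simp add: exp_of_nat_mult)
  finally have "(1 + norm x) ^ n * gauss c x \<le> exp (real n * norm x) * gauss c x"
    by (rule mult_right_mono) simp
  also have "\<dots> = exp (real n * norm x - c * (norm x)\<^sup>2)"
    by (simp add: gauss_def exp_add [symmetric])
  also have "\<dots> \<le> exp ((real n)\<^sup>2 / (4 * c))"
  proof -
    have "0 \<le> (2 * c * norm x - real n)\<^sup>2" by simp
    then have "real n * norm x * (4 * c) - c * (norm x)\<^sup>2 * (4 * c) \<le> (real n)\<^sup>2"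
      by (simp add: power2_diff power2_eq_square algebra_simps)
    then have "real n * norm x - c * (norm x)\<^sup>2 \<le> (real n)\<^sup>2 / (4 * c)"
      using assms by (simp add: field_simps)
    then show ?thesis by simp
  qed
  finally show ?thesis .
qed

lemma gauss_split: "gauss c x = gauss (c/2) x * gauss (c/2) x"
  by (simp add: gauss_def exp_add [symmetric])

text \<open>Half of the exponent absorbs the polynomial, the other half remains to be integrated.\<close>
lemma polynomial_gauss_le:
  assumes "real_polynomial_function q" "0 < c"
  shows "\<exists>B\<ge>0. \<forall>x. \<bar>q x * gauss c x\<bar> \<le> B * gauss (c/2) x"
proof -
  obtain C n where C: "0 \<le> C" "\<And>x. \<bar>q x\<bar> \<le> C * (1 + norm x) ^ n"
    using real_polynomial_function_growth [OF assms(1)] by blast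
  define B where "B = C * exp ((real n)\<^sup>2 / (4 * (c/2)))"
  have "\<bar>q x * gauss c x\<bar> \<le> B * gauss (c/2) x" for x
  proof -
    have "\<bar>q x * gauss c x\<bar> \<le> (C * (1 + norm x) ^ n) * gauss c x"
      using C(2) by (simp add: abs_mult mult_right_mono)
    also have "\<dots> = C * ((1 + norm x) ^ n * gauss (c/2) x) * gauss (c/2) x"
      by (simp add: gauss_split [of c] mult_ac)
    also have "\<dots> \<le> B * gauss (c/2) x"
      unfolding B_def using C(1) assms(2)
      by (intro mult_right_mono mult_left_mono power_times_gauss_bounded) auto
    finally show ?thesis .
  qed
  moreover have "0 \<le> B" using C(1) by (simp add: B_def)
  ultimately show ?thesis by blast
qed

text \<open>The characteristic function of the standard normal distribution, rescaled by \<open>\<surd>(2 c)\<close>.\<close>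
lemma gaussian_char_1d:
  assumes "0 < c"
  shows "integrable lborel (\<lambda>x::real. cis (x * \<eta>) * complex_of_real (exp (- c * x\<^sup>2)))" (is ?int)
    and "(LINT x|lborel. cis (x * \<eta>) * complex_of_real (exp (- c * x\<^sup>2)))
        = complex_of_real (sqrt (pi / c) * exp (- \<eta>\<^sup>2 / (4 * c)))" (is ?eq)
proof -
  have cisb: "(\<lambda>x::real. cis (x * t)) \<in> borel_measurable borel" for t
    by (intro borel_measurable_continuous_onI continuous_intros)
  have int0: "integrable lborel (\<lambda>x::real. cis (x * t) * complex_of_real (exp (- x\<^sup>2 / 2)))" for t
  proof -
    have "integrable lborel (\<lambda>x. sqrt (2 * pi) * std_normal_density x)"
      by (intro integrable_mult_right) (simp add: integrable_normal_density)
    then have "integrable lborel (\<lambda>x::real. exp (- x\<^sup>2 / 2))" by (simp add: std_normal_density_def)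
    then show ?thesis
      by (rule Bochner_Integration.integrable_bound) (use cisb in \<open>auto simp: norm_mult\<close>)
  qed
  have base: "(LINT x|lborel. cis (x * t) * complex_of_real (exp (- x\<^sup>2 / 2)))
      = complex_of_real (sqrt (2 * pi) * exp (- t\<^sup>2 / 2))" for t
  proof -
    have "complex_of_real (exp (- (t^2) / 2)) = char std_normal_distribution t"
      by (simp add: char_std_normal_distribution)
    also have "\<dots> = (LINT x|lborel. std_normal_density x *\<^sub>R iexp (t * x))"
      unfolding char_def by (subst integral_density) (auto simp: normal_density_nonneg)
    also have "\<dots> = (LINT x|lborel. complex_of_real (1 / sqrt (2 * pi)) * (cis (x * t) * complex_of_real (exp (- x\<^sup>2 / 2))))"
      by (intro Bochner_Integration.integral_cong)
         (auto simp: std_normal_density_def scaleR_conv_of_real cis_conv_exp mult_ac)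
    also have "\<dots> = complex_of_real (1 / sqrt (2 * pi)) * (LINT x|lborel. cis (x * t) * complex_of_real (exp (- x\<^sup>2 / 2)))"
      by simp
    finally show ?thesis by (simp add: field_simps)
  qed
  define s where "s = sqrt (2 * c)"
  have s: "s > 0" "s\<^sup>2 = 2 * c" using assms by (auto simp: s_def)
  have sub: "cis ((0 + s * x) * (\<eta> / s)) * complex_of_real (exp (- (0 + s * x)\<^sup>2 / 2))
      = cis (x * \<eta>) * complex_of_real (exp (- c * x\<^sup>2))" for x
    using s by (simp add: power_mult_distrib)
  show ?int
    using lborel_integrable_real_affine [OF int0 [of "\<eta>/s"], of s 0] s unfolding sub by simp
  have "complex_of_real (sqrt (2 * pi) * exp (- (\<eta>/s)\<^sup>2 / 2)) = s *\<^sub>R (LINT x|lborel. cis (x * \<eta>) * complex_of_real (exp (- c * x\<^sup>2)))"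
    unfolding base [symmetric] by (subst lborel_integral_real_affine [of s _ 0]) (use s in \<open>simp_all only: sub, simp\<close>)
  moreover have "sqrt (2 * pi) = s * sqrt (pi / c)"
    using assms by (simp add: s_def real_sqrt_mult [symmetric])
  moreover have "(\<eta>/s)\<^sup>2 / 2 = \<eta>\<^sup>2 / (4 * c)"
    using s by (simp add: power_divide)
  ultimately show ?eq using s by (simp add: scaleR_conv_of_real)
qed

text \<open>The integrand is a product over the coordinates, so the one-dimensional formula applies to
  each factor.\<close>
lemma gauss_char:
  assumes c: "0 < c"
  shows "integrable lborel (\<lambda>x. cis (x \<bullet> \<xi>) * complex_of_real (gauss c x))" (is ?int)
    and "(LINT x|lborel. cis (x \<bullet> \<xi>) * complex_of_real (gauss c x))
        = complex_of_real (sqrt (pi / c) ^ 3 * gauss (1 / (4 * c)) \<xi>)" (is ?eq)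
proof -
  interpret product_sigma_finite "\<lambda>b::real^3. lborel :: real measure" ..
  let ?f = "\<lambda>(b::real^3) (r::real). cis (r * (\<xi> \<bullet> b)) * complex_of_real (exp (- c * r\<^sup>2))"
  have prod_eq: "cis ((\<Sum>b\<in>Basis. w b *\<^sub>R b) \<bullet> \<xi>) * complex_of_real (gauss c (\<Sum>b\<in>Basis. w b *\<^sub>R b))
     = (\<Prod>b\<in>Basis. ?f b (w b))" for w
  proof -
    define x where "x = (\<Sum>b\<in>Basis. w b *\<^sub>R b)"
    have w: "x \<bullet> b = w b" if "b \<in> Basis" for b
      using that by (simp add: x_def)
    have "cis (x \<bullet> \<xi>) = (\<Prod>b\<in>Basis. cis (w b * (\<xi> \<bullet> b)))"
      by (subst euclidean_inner) (simp add: cis_conv_exp exp_sum [symmetric] sum_distrib_left w)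
    moreover have "gauss c x = (\<Prod>b\<in>Basis. exp (- c * (w b)\<^sup>2))"
      unfolding gauss_def power2_norm_eq_inner
      by (subst euclidean_inner) (simp add: exp_sum [symmetric] sum_distrib_left w power2_eq_square)
    ultimately show ?thesis by (simp add: x_def prod.distrib)
  qed
  have meas: "(\<lambda>x. cis (x \<bullet> \<xi>) * complex_of_real (gauss c x)) \<in> borel_measurable borel"
    by (intro borel_measurable_continuous_onI continuous_intros)
  have mT: "(\<lambda>w. \<Sum>b\<in>Basis. w b *\<^sub>R (b::real^3)) \<in> (\<Pi>\<^sub>M b\<in>Basis. lborel) \<rightarrow>\<^sub>M borel" by measurable
  have "integrable (\<Pi>\<^sub>M b\<in>Basis. lborel) (\<lambda>w. \<Prod>b\<in>Basis. ?f b (w b))"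
    by (intro product_integrable_prod gaussian_char_1d(1) c) simp
  then show ?int
    by (subst lborel_eq) (simp only: integrable_distr_eq [OF mT meas] prod_eq)
  have "(LINT x|lborel. cis (x \<bullet> \<xi>) * complex_of_real (gauss c x)) = (\<Prod>b\<in>Basis. LINT r|lborel. ?f b r)"
    by (subst lborel_eq, subst integral_distr [OF mT meas], unfold prod_eq)
       (intro product_integral_prod gaussian_char_1d(1) c, simp)
  also have "\<dots> = (\<Prod>b\<in>Basis. complex_of_real (sqrt (pi / c) * exp (- (\<xi> \<bullet> b)\<^sup>2 / (4 * c))))"
    using gaussian_char_1d(2) [OF c] by simp
  also have "\<dots> = complex_of_real (\<Prod>b\<in>(Basis::(real^3) set). sqrt (pi / c) * exp (- (\<xi> \<bullet> b)\<^sup>2 / (4 * c)))"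
    by simp
  also have "(\<Prod>b\<in>(Basis::(real^3) set). sqrt (pi / c) * exp (- (\<xi> \<bullet> b)\<^sup>2 / (4 * c)))
      = sqrt (pi / c) ^ 3 * gauss (1 / (4 * c)) \<xi>"
    unfolding gauss_def power2_norm_eq_inner prod.distrib
    by (subst euclidean_inner) (simp add: exp_sum [symmetric] sum_negf [symmetric] sum_divide_distrib power2_eq_square)
  finally show ?eq .
qed

lemma gauss_integrable: "0 < c \<Longrightarrow> integrable lborel (gauss c)"
  using integrable_norm [OF gauss_char(1) [of c 0]] by simp

lemma integral_gauss: "0 < c \<Longrightarrow> (LINT x|lborel. gauss c x) = sqrt (pi / c) ^ 3"
proof -
  assume "0 < c"
  have "complex_of_real (LINT x|lborel. gauss c x) = complex_of_real (sqrt (pi / c) ^ 3 * gauss (1 / (4 * c)) 0)"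
    using gauss_char(2) [OF \<open>0 < c\<close>, of 0]
    by (simp only: inner_zero_right cis_zero mult_1 integral_complex_of_real)
  then show ?thesis by (simp only: of_real_eq_iff) (simp add: gauss_def)
qed

lemma polynomial_gauss_integrable:
  assumes q: "real_polynomial_function q" and c: "0 < c"
  shows "integrable lborel (\<lambda>x. q x * gauss c x)"
proof -
  obtain B where B: "B \<ge> 0" "\<And>x. \<bar>q x * gauss c x\<bar> \<le> B * gauss (c/2) x"
    using polynomial_gauss_le [OF assms] by blast
  have 1: "integrable lborel (\<lambda>x. B * gauss (c/2) x)"
    using c by (intro integrable_mult_right gauss_integrable) simp
  have 2: "(\<lambda>x. q x * gauss c x) \<in> borel_measurable lborel"
    unfolding measurable_lborel2
    by (intro borel_measurable_continuous_onI continuous_intros real_polynomial_function_continuous [OF q])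
  show ?thesis
  proof (rule Bochner_Integration.integrable_bound [OF 1 2])
    have "norm (q x * gauss c x) \<le> norm (B * gauss (c/2) x)" for x
      unfolding real_norm_def using B(2) abs_ge_self by (rule order_trans)
    then show "AE x in lborel. norm (q x * gauss c x) \<le> norm (B * gauss (c/2) x)" by simp
  qed
qed

section \<open>Fourier transforms\<close>

abbreviation rfourier :: "(real^3 \<Rightarrow> real) \<Rightarrow> real^3 \<Rightarrow> complex" where
  "rfourier f \<equiv> fourier (\<lambda>x. complex_of_real (f x))"

lemma cis_inner_measurable [measurable]:
  "(\<lambda>x::real^3. cis (x \<bullet> \<xi>)) \<in> borel_measurable borel"
  "(\<lambda>x::real^3. cis (- (x \<bullet> \<xi>))) \<in> borel_measurable borel"
  by (intro borel_measurable_continuous_onI continuous_intros)+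

lemma cis_mult_integrable:
  fixes f :: "real^3 \<Rightarrow> complex"
  assumes "integrable lborel f"
  shows "integrable lborel (\<lambda>x. cis (- (x \<bullet> \<xi>)) * f x)" "integrable lborel (\<lambda>x. cis (x \<bullet> \<xi>) * f x)"
proof -
  have [measurable]: "f \<in> borel_measurable borel" using assms by auto
  show "integrable lborel (\<lambda>x. cis (- (x \<bullet> \<xi>)) * f x)" "integrable lborel (\<lambda>x. cis (x \<bullet> \<xi>) * f x)"
    by (rule Bochner_Integration.integrable_bound [OF assms]; simp add: norm_mult)+
qed

lemma fourier_diff:
  assumes "integrable lborel f" "integrable lborel g"
  shows "fourier (\<lambda>x. f x - g x) \<xi> = fourier f \<xi> - fourier g \<xi>"
  unfolding fourier_def right_diff_distrib
  by (intro Bochner_Integration.integral_diff cis_mult_integrable assms)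

lemma fourier_cmult: "fourier (\<lambda>x. a * f x) \<xi> = a * fourier f \<xi>"
  unfolding fourier_def by (simp add: mult.left_commute)

lemma fourier_sum:
  assumes "\<And>i. i \<in> I \<Longrightarrow> integrable lborel (f i)"
  shows "fourier (\<lambda>x. \<Sum>i\<in>I. f i x) \<xi> = (\<Sum>i\<in>I. fourier (f i) \<xi>)"
  unfolding fourier_def sum_distrib_left
  by (intro Bochner_Integration.integral_sum cis_mult_integrable assms)

lemma fourier_translate:
  assumes "f \<in> borel_measurable borel"
  shows "fourier (\<lambda>x. f (x - y)) \<xi> = cis (- (y \<bullet> \<xi>)) * fourier f \<xi>"
proof -
  note [measurable] = assms
  have "fourier f \<xi> = (LINT x|lborel. cis (- ((x + - y) \<bullet> \<xi>)) * f (x + - y))"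
    unfolding fourier_def by (rule lborel_integral_translate [symmetric]) measurable
  also have "\<dots> = (LINT x|lborel. cis (y \<bullet> \<xi>) * (cis (- (x \<bullet> \<xi>)) * f (x - y)))"
  proof (rule Bochner_Integration.integral_cong [OF refl])
    fix x
    have "cis (- ((x + - y) \<bullet> \<xi>)) = cis (y \<bullet> \<xi>) * cis (- (x \<bullet> \<xi>))"
      by (simp add: cis_mult inner_diff_left)
    then show "cis (- ((x + - y) \<bullet> \<xi>)) * f (x + - y) = cis (y \<bullet> \<xi>) * (cis (- (x \<bullet> \<xi>)) * f (x - y))"
      by simp
  qed
  also have "\<dots> = cis (y \<bullet> \<xi>) * fourier (\<lambda>x. f (x - y)) \<xi>" unfolding fourier_def by simp
  finally have "cis (- (y \<bullet> \<xi>)) * fourier f \<xi>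
      = (cis (- (y \<bullet> \<xi>)) * cis (y \<bullet> \<xi>)) * fourier (\<lambda>x. f (x - y)) \<xi>"
    by (simp only: mult.assoc)
  then show ?thesis by (simp add: cis_mult)
qed

lemma fourier_gauss:
  assumes "0 < c"
  shows "rfourier (gauss c) \<xi> = complex_of_real (sqrt (pi / c) ^ 3 * gauss (1 / (4 * c)) \<xi>)"
  using gauss_char(2) [OF assms, of "- \<xi>"] unfolding fourier_def by (simp add: gauss_def)

text \<open>The left-hand side is the Fourier transform of the derivative of \<^term>\<open>\<lambda>x. q x * gauss c x\<close>
  in direction \<open>h\<close>; integrate by parts.\<close>
lemma fourier_gauss_derivative:
  assumes q: "real_polynomial_function q" and D: "\<And>x. (q has_derivative D x) (at x)"
    and Dh: "real_polynomial_function (\<lambda>x. D x h)" and c: "0 < c"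
  shows "rfourier (\<lambda>x. (D x h - 2 * c * (x \<bullet> h) * q x) * gauss c x) \<xi>
       = \<i> * complex_of_real (\<xi> \<bullet> h) * rfourier (\<lambda>x. q x * gauss c x) \<xi>"
proof -
  define p where "p x = D x h - 2 * c * (x \<bullet> h) * q x" for x
  have p: "real_polynomial_function p"
    unfolding p_def using q Dh by (intro real_polynomial_function_diff real_polynomial_function.intros(2,4)) auto
  define F where "F x = cis (- (x \<bullet> \<xi>)) * complex_of_real (q x * gauss c x)" for x
  define G where "G x = cis (- (x \<bullet> \<xi>)) * complex_of_real (p x * gauss c x)
      - \<i> * complex_of_real (\<xi> \<bullet> h) * F x" for x
  have int: "integrable lborel (\<lambda>x. complex_of_real (q x * gauss c x))"
    "integrable lborel (\<lambda>x. complex_of_real (p x * gauss c x))"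
    by (intro integrable_of_real polynomial_gauss_integrable q p c)+
  have F: "integrable lborel F" unfolding F_def by (intro cis_mult_integrable int)
  have P: "integrable lborel (\<lambda>x. cis (- (x \<bullet> \<xi>)) * complex_of_real (p x * gauss c x))"
    by (intro cis_mult_integrable int)
  have "(LINT x|lborel. G x) = 0"
  proof (rule integral_directional_derivative_eq_0 [OF F])
    show "integrable lborel G" unfolding G_def by (intro Bochner_Integration.integrable_diff P integrable_mult_right F)
    show "continuous_on UNIV G"
      unfolding G_def F_def
      by (intro continuous_intros real_polynomial_function_continuous [OF q] real_polynomial_function_continuous [OF p])
    fix x
    have 1: "((\<lambda>x. cis (- (x \<bullet> \<xi>))) has_derivative (\<lambda>v. (- (v \<bullet> \<xi>)) *\<^sub>R (\<i> * cis (- (x \<bullet> \<xi>))))) (at x)"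
    proof -
      have cd: "(cis has_derivative (\<lambda>r. r *\<^sub>R (\<i> * cis a))) (at a)" for a
      proof -
        have "((\<lambda>r. \<i> * complex_of_real r) has_derivative (\<lambda>r. \<i> * complex_of_real r)) (at a)"
          by (auto intro!: derivative_eq_intros)
        from has_derivative_compose [OF this DERIV_exp [unfolded has_field_derivative_def]]
        moreover have "cis = (\<lambda>r. exp (\<i> * complex_of_real r))" by (auto simp: cis_conv_exp)
        ultimately show ?thesis by (simp add: scaleR_conv_of_real mult_ac cis_conv_exp)
      qed
      have "((\<lambda>x. - (x \<bullet> \<xi>)) has_derivative (\<lambda>v. - (v \<bullet> \<xi>))) (at x)"
        by (auto intro!: derivative_eq_intros)
      from has_derivative_compose [OF this cd] show ?thesis .
    qed
    have 2: "((\<lambda>x. q x * gauss c x) has_derivative (\<lambda>v. (D x v - 2 * c * (x \<bullet> v) * q x) * gauss c x)) (at x)"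
      by (rule has_derivative_eq_rhs [OF has_derivative_mult [OF D gauss_has_derivative]]) (auto simp: algebra_simps)
    have "(F has_derivative (\<lambda>v. cis (- (x \<bullet> \<xi>)) * complex_of_real ((D x v - 2 * c * (x \<bullet> v) * q x) * gauss c x)
        + ((- (v \<bullet> \<xi>)) *\<^sub>R (\<i> * cis (- (x \<bullet> \<xi>)))) * complex_of_real (q x * gauss c x))) (at x)"
      unfolding F_def by (intro has_derivative_mult 1 has_derivative_of_real 2)
    moreover have "cis (- (x \<bullet> \<xi>)) * complex_of_real ((D x h - 2 * c * (x \<bullet> h) * q x) * gauss c x)
        + ((- (h \<bullet> \<xi>)) *\<^sub>R (\<i> * cis (- (x \<bullet> \<xi>)))) * complex_of_real (q x * gauss c x) = G x"
      by (simp add: G_def F_def p_def scaleR_conv_of_real inner_commute)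
    ultimately show "\<exists>D. (F has_derivative D) (at x) \<and> D h = G x" by blast
  qed
  moreover have "(LINT x|lborel. G x) = rfourier (\<lambda>x. p x * gauss c x) \<xi> - \<i> * complex_of_real (\<xi> \<bullet> h) * rfourier (\<lambda>x. q x * gauss c x) \<xi>"
  proof -
    have "(LINT x|lborel. G x) = (LINT x|lborel. cis (- (x \<bullet> \<xi>)) * complex_of_real (p x * gauss c x))
        - (LINT x|lborel. \<i> * complex_of_real (\<xi> \<bullet> h) * F x)"
      unfolding G_def by (intro Bochner_Integration.integral_diff P integrable_mult_right F)
    then show ?thesis by (simp add: fourier_def F_def)
  qed
  ultimately show ?thesis by (simp add: p_def)
qed

text \<open>The derivative rule solved for the term in which the Gaussian is differentiated: multiplication by
  a coordinate is reduced to polynomials of lower degree.  Iterating it gives the Fourier transforms of all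
  derivatives of the heat kernel below.\<close>
lemma fourier_gauss_coord_mult:
  assumes q: "real_polynomial_function q" and D: "\<And>x. (q has_derivative D x) (at x)"
    and Dh: "real_polynomial_function (\<lambda>x. D x (axis i 1))" and c: "0 < c"
  shows "rfourier (\<lambda>x. x $ i * q x * gauss c x) \<xi>
     = (rfourier (\<lambda>x. D x (axis i 1) * gauss c x) \<xi> - \<i> * complex_of_real (\<xi> $ i) * rfourier (\<lambda>x. q x * gauss c x) \<xi>) / complex_of_real (2 * c)"
proof -
  have int: "integrable lborel (\<lambda>x. complex_of_real (D x (axis i 1) * gauss c x))"
    "integrable lborel (\<lambda>x. complex_of_real (2 * c) * complex_of_real (x $ i * q x * gauss c x))"
    by (intro integrable_of_real integrable_mult_right polynomial_gauss_integrable
        real_polynomial_function.intros(4) real_polynomial_function_nth q Dh c)+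
  have "\<i> * complex_of_real (\<xi> $ i) * rfourier (\<lambda>x. q x * gauss c x) \<xi>
      = rfourier (\<lambda>x. (D x (axis i 1) - 2 * c * (x \<bullet> axis i 1) * q x) * gauss c x) \<xi>"
    by (subst fourier_gauss_derivative [OF q D Dh c]) (simp add: inner_axis)
  also have "\<dots> = fourier (\<lambda>x. complex_of_real (D x (axis i 1) * gauss c x)
      - complex_of_real (2 * c) * complex_of_real (x $ i * q x * gauss c x)) \<xi>"
    by (intro arg_cong [of _ _ "\<lambda>f. fourier f \<xi>"] ext) (simp add: inner_axis algebra_simps)
  also have "\<dots> = rfourier (\<lambda>x. D x (axis i 1) * gauss c x) \<xi>
      - complex_of_real (2 * c) * rfourier (\<lambda>x. x $ i * q x * gauss c x) \<xi>"
    by (subst fourier_diff [OF int]) (simp only: fourier_cmult)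
  finally show ?thesis using c by (simp add: field_simps)
qed

lemma fourier_gauss_coord:
  assumes c: "0 < c"
  shows "rfourier (\<lambda>x. x $ i * gauss c x) \<xi> = - \<i> * complex_of_real (\<xi> $ i / (2 * c)) * rfourier (gauss c) \<xi>"
proof -
  have "rfourier (\<lambda>x. x $ i * 1 * gauss c x) \<xi>
     = (rfourier (\<lambda>x. 0 * gauss c x) \<xi> - \<i> * complex_of_real (\<xi> $ i) * rfourier (\<lambda>x. 1 * gauss c x) \<xi>) / complex_of_real (2 * c)"
    by (rule fourier_gauss_coord_mult [where D = "\<lambda>x h. 0"]) (use c in auto)
  moreover have "rfourier (\<lambda>x. 0 * gauss c x) \<xi> = 0" by (simp add: fourier_def)
  ultimately show ?thesis by simp
qed

lemma fourier_gauss_coord2: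
  assumes c: "0 < c"
  shows "rfourier (\<lambda>x. x $ i * x $ j * gauss c x) \<xi>
    = complex_of_real ((if i = j then 1 / (2 * c) else 0) - \<xi> $ i * \<xi> $ j / (4 * c\<^sup>2)) * rfourier (gauss c) \<xi>"
proof -
  define E where "E = rfourier (gauss c) \<xi>"
  have "rfourier (\<lambda>x. x $ i * x $ j * gauss c x) \<xi>
     = (rfourier (\<lambda>x. (axis i 1 :: real^3) $ j * gauss c x) \<xi> - \<i> * complex_of_real (\<xi> $ i) * rfourier (\<lambda>x. x $ j * gauss c x) \<xi>) / complex_of_real (2 * c)"
    by (rule fourier_gauss_coord_mult [where D = "\<lambda>x h. h $ j"])
       (use c in \<open>auto intro!: bounded_linear_imp_has_derivative bounded_linear_vec_nth\<close>)
  moreover have "rfourier (\<lambda>x. (axis i 1 :: real^3) $ j * gauss c x) \<xi> = (if i = j then 1 else 0) * rfourier (gauss c) \<xi>"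
    by (auto simp: axis_def fourier_def)
  ultimately have "rfourier (\<lambda>x. x $ i * x $ j * gauss c x) \<xi> = ((if i = j then 1 else 0) * E
      - \<i> * complex_of_real (\<xi> $ i) * (- \<i> * complex_of_real (\<xi> $ j / (2 * c)) * E)) / complex_of_real (2 * c)"
    by (simp only: fourier_gauss_coord [OF c] E_def)
  then show ?thesis
    unfolding E_def [symmetric] using c by (auto simp: power2_eq_square field_simps)
qed

lemma fourier_gauss_norm_sq:
  assumes c: "0 < c"
  shows "rfourier (\<lambda>x. (norm x)\<^sup>2 * gauss c x) \<xi>
    = complex_of_real (3 / (2 * c) - (norm \<xi>)\<^sup>2 / (4 * c\<^sup>2)) * rfourier (gauss c) \<xi>"
proof -
  have "rfourier (\<lambda>x. (norm x)\<^sup>2 * gauss c x) \<xi> = fourier (\<lambda>x. \<Sum>i\<in>UNIV. complex_of_real (x $ i * x $ i * gauss c x)) \<xi>"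
    by (intro arg_cong [of _ _ "\<lambda>f. fourier f \<xi>"] ext)
       (simp add: power2_norm_eq_inner inner_vec_def sum_distrib_right)
  also have "\<dots> = (\<Sum>i\<in>UNIV. rfourier (\<lambda>x. x $ i * x $ i * gauss c x) \<xi>)"
    by (intro fourier_sum integrable_of_real polynomial_gauss_integrable
        real_polynomial_function.intros(4) real_polynomial_function_nth c)
  also have "\<dots> = (\<Sum>i\<in>UNIV. complex_of_real (1 / (2 * c) - \<xi> $ i * \<xi> $ i / (4 * c\<^sup>2))) * rfourier (gauss c) \<xi>"
    unfolding fourier_gauss_coord2 [OF c] by (simp add: sum_distrib_right)
  also have "(\<Sum>i\<in>UNIV. complex_of_real (1 / (2 * c) - \<xi> $ i * \<xi> $ i / (4 * c\<^sup>2)))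
      = complex_of_real (3 / (2 * c) - (norm \<xi>)\<^sup>2 / (4 * c\<^sup>2))"
    unfolding of_real_sum [symmetric]
    by (intro arg_cong [of _ _ complex_of_real])
       (simp add: power2_norm_eq_inner inner_vec_def sum_subtractf sum_divide_distrib)
  finally show ?thesis .
qed

lemma fourier_gauss_coord_norm_sq:
  assumes c: "0 < c"
  shows "rfourier (\<lambda>x. x $ i * (norm x)\<^sup>2 * gauss c x) \<xi>
    = - \<i> * complex_of_real (\<xi> $ i * (5 / (4 * c\<^sup>2) - (norm \<xi>)\<^sup>2 / (8 * c ^ 3))) * rfourier (gauss c) \<xi>"
proof -
  define E where "E = rfourier (gauss c) \<xi>"
  have "((\<lambda>x::real^3. (norm x)\<^sup>2) has_derivative (\<lambda>h. 2 * (x \<bullet> h))) (at x)" for x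
    unfolding power2_norm_eq_inner
    by (rule has_derivative_eq_rhs [OF has_derivative_inner [OF has_derivative_ident has_derivative_ident]])
       (auto simp: inner_commute)
  then have "rfourier (\<lambda>x. x $ i * (norm x)\<^sup>2 * gauss c x) \<xi>
     = (rfourier (\<lambda>x. 2 * (x \<bullet> axis i 1) * gauss c x) \<xi> - \<i> * complex_of_real (\<xi> $ i) * rfourier (\<lambda>x. (norm x)\<^sup>2 * gauss c x) \<xi>) / complex_of_real (2 * c)"
    by (intro fourier_gauss_coord_mult [where D = "\<lambda>x h. 2 * (x \<bullet> h)"] c
        real_polynomial_function.intros(2,4) real_polynomial_function_norm_sq real_polynomial_function_inner)
  moreover have "rfourier (\<lambda>x. 2 * (x \<bullet> axis i 1) * gauss c x) \<xi> = 2 * rfourier (\<lambda>x. x $ i * gauss c x) \<xi>"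
    using fourier_cmult [of 2 "\<lambda>x. complex_of_real (x $ i * gauss c x)"] by (simp add: inner_axis mult.assoc)
  ultimately have "rfourier (\<lambda>x. x $ i * (norm x)\<^sup>2 * gauss c x) \<xi> = (2 * (- \<i> * complex_of_real (\<xi> $ i / (2 * c)) * E)
      - \<i> * complex_of_real (\<xi> $ i) * (complex_of_real (3 / (2 * c) - (norm \<xi>)\<^sup>2 / (4 * c\<^sup>2)) * E)) / complex_of_real (2 * c)"
    by (simp only: fourier_gauss_coord [OF c] fourier_gauss_norm_sq [OF c] E_def)
  then show ?thesis
    unfolding E_def [symmetric] using c by (auto simp: power2_eq_square power3_eq_cube field_simps)
qed

section \<open>The heat kernel and its derivatives\<close>

text \<open>\<open>hess_heat\<close>, \<open>lap_heat\<close> and \<open>grad_lap_heat\<close> are closed forms of \<open>\<partial>\<^sub>i\<partial>\<^sub>jp\<^sub>t\<close>, \<open>\<Delta>p\<^sub>t\<close> and \<open>\<partial>\<^sub>i\<Delta>p\<^sub>t\<close>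
  for the heat kernel \<open>p\<^sub>t\<close>.\<close>
abbreviation hess_heat :: "3 \<Rightarrow> 3 \<Rightarrow> real \<Rightarrow> real^3 \<Rightarrow> real" where
  "hess_heat i j t x \<equiv> (x $ i * x $ j / (4 * t\<^sup>2) - (if i = j then 1 / (2 * t) else 0)) * heat_kernel t x"

definition lap_heat :: "real \<Rightarrow> real^3 \<Rightarrow> real" where
  "lap_heat t x = ((norm x)\<^sup>2 / (4 * t\<^sup>2) - 3 / (2 * t)) * heat_kernel t x"

definition grad_lap_heat :: "3 \<Rightarrow> real \<Rightarrow> real^3 \<Rightarrow> real" where
  "grad_lap_heat i t x = x $ i * (5 / (4 * t\<^sup>2) - (norm x)\<^sup>2 / (8 * t ^ 3)) * heat_kernel t x"

lemma heat_kernel_gauss: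
  assumes "0 < t"
  shows "heat_kernel t x = gauss (1 / (4 * t)) x / sqrt (4 * pi * t) ^ 3"
proof -
  have "(4 * pi * t) powr (- 3 / 2) = 1 / sqrt (4 * pi * t) ^ 3"
    using assms by (simp add: powr_minus_divide powr_half_sqrt [symmetric] powr_powr flip: powr_realpow)
  then show ?thesis by (simp add: heat_kernel_def gauss_def)
qed

lemma fourier_heat_kernel:
  assumes t: "0 < t"
  shows "rfourier (gauss (1 / (4 * t))) \<xi> = complex_of_real (sqrt (4 * pi * t) ^ 3 * gauss t \<xi>)"
  using fourier_gauss [of "1 / (4 * t)" \<xi>] t by (simp add: mult_ac)

lemma lap_heat_poly:
  assumes "0 < t"
  obtains q where "real_polynomial_function q" "lap_heat t = (\<lambda>x. q x * gauss (1 / (4 * t)) x)"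
proof
  show "real_polynomial_function (\<lambda>x::real^3. ((norm x)\<^sup>2 / (4 * t\<^sup>2) - 3 / (2 * t)) / sqrt (4 * pi * t) ^ 3)"
    by (intro real_polynomial_function_divide real_polynomial_function_diff real_polynomial_function.intros(2) real_polynomial_function_norm_sq)
qed (use assms in \<open>auto simp: lap_heat_def heat_kernel_gauss\<close>)

lemma fourier_lap_heat:
  assumes t: "0 < t"
  shows "rfourier (lap_heat t) \<xi> = - complex_of_real ((norm \<xi>)\<^sup>2 * gauss t \<xi>)"
proof -
  define N where "N = sqrt (4 * pi * t) ^ 3"
  have N: "N > 0" using t by (simp add: N_def)
  define c where "c = 1 / (4 * t)"
  have c: "c > 0" using t by (simp add: c_def)
  have E: "rfourier (gauss c) \<xi> = complex_of_real (N * gauss t \<xi>)"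
    unfolding c_def N_def by (rule fourier_heat_kernel [OF t])
  have i1: "integrable lborel (\<lambda>x. complex_of_real (1 / (4 * t\<^sup>2 * N)) * complex_of_real ((norm x)\<^sup>2 * gauss c x))"
    by (intro integrable_of_real integrable_mult_right polynomial_gauss_integrable real_polynomial_function_norm_sq c)
  have i2: "integrable lborel (\<lambda>x. complex_of_real (3 / (2 * t * N)) * complex_of_real (gauss c x))"
    by (intro integrable_of_real integrable_mult_right gauss_integrable c)
  have "rfourier (lap_heat t) \<xi> = fourier (\<lambda>x. complex_of_real (1 / (4 * t\<^sup>2 * N)) * complex_of_real ((norm x)\<^sup>2 * gauss c x)
     - complex_of_real (3 / (2 * t * N)) * complex_of_real (gauss c x)) \<xi>"
  proof (intro arg_cong [of _ _ "\<lambda>f. fourier f \<xi>"] ext)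
    fix x
    have "lap_heat t x = 1 / (4 * t\<^sup>2 * N) * ((norm x)\<^sup>2 * gauss c x) - 3 / (2 * t * N) * gauss c x"
      unfolding lap_heat_def heat_kernel_gauss [OF t] N_def [symmetric] c_def [symmetric]
      using t N by (simp add: field_simps power2_eq_square)
    then show "complex_of_real (lap_heat t x) = complex_of_real (1 / (4 * t\<^sup>2 * N)) * complex_of_real ((norm x)\<^sup>2 * gauss c x)
        - complex_of_real (3 / (2 * t * N)) * complex_of_real (gauss c x)"
      by (simp only: of_real_mult of_real_diff)
  qed
  also have "\<dots> = complex_of_real (1 / (4 * t\<^sup>2 * N)) * rfourier (\<lambda>x. (norm x)\<^sup>2 * gauss c x) \<xi>
     - complex_of_real (3 / (2 * t * N)) * rfourier (gauss c) \<xi>"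
    by (subst fourier_diff [OF i1 i2]) (simp only: fourier_cmult)
  also have "\<dots> = complex_of_real (1 / (4 * t\<^sup>2 * N) * (3 / (2 * c) - (norm \<xi>)\<^sup>2 / (4 * c\<^sup>2)) * (N * gauss t \<xi>)
     - 3 / (2 * t * N) * (N * gauss t \<xi>))"
    unfolding fourier_gauss_norm_sq [OF c] E by (simp only: of_real_mult of_real_diff mult.assoc)
  also have "1 / (4 * t\<^sup>2 * N) * (3 / (2 * c) - (norm \<xi>)\<^sup>2 / (4 * c\<^sup>2)) * (N * gauss t \<xi>)
     - 3 / (2 * t * N) * (N * gauss t \<xi>) = - ((norm \<xi>)\<^sup>2 * gauss t \<xi>)"
    using t N by (simp add: c_def power2_eq_square field_simps)
  finally show ?thesis by simp
qed

lemma fourier_grad_lap_heat: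
  assumes t: "0 < t"
  shows "rfourier (grad_lap_heat i t) \<xi> = - \<i> * complex_of_real (\<xi> $ i * (norm \<xi>)\<^sup>2 * gauss t \<xi>)"
proof -
  define N where "N = sqrt (4 * pi * t) ^ 3"
  have N: "N > 0" using t by (simp add: N_def)
  define c where "c = 1 / (4 * t)"
  have c: "c > 0" using t by (simp add: c_def)
  have E: "rfourier (gauss c) \<xi> = complex_of_real (N * gauss t \<xi>)"
    unfolding c_def N_def by (rule fourier_heat_kernel [OF t])
  have i1: "integrable lborel (\<lambda>x. complex_of_real (5 / (4 * t\<^sup>2 * N)) * complex_of_real (x $ i * gauss c x))"
    by (intro integrable_of_real integrable_mult_right polynomial_gauss_integrable real_polynomial_function_nth c)
  have i2: "integrable lborel (\<lambda>x. complex_of_real (1 / (8 * t ^ 3 * N)) * complex_of_real (x $ i * (norm x)\<^sup>2 * gauss c x))"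
    by (intro integrable_of_real integrable_mult_right polynomial_gauss_integrable real_polynomial_function_nth
        real_polynomial_function_norm_sq real_polynomial_function.intros(4) c)
  have "rfourier (grad_lap_heat i t) \<xi> = fourier (\<lambda>x. complex_of_real (5 / (4 * t\<^sup>2 * N)) * complex_of_real (x $ i * gauss c x)
     - complex_of_real (1 / (8 * t ^ 3 * N)) * complex_of_real (x $ i * (norm x)\<^sup>2 * gauss c x)) \<xi>"
  proof (intro arg_cong [of _ _ "\<lambda>f. fourier f \<xi>"] ext)
    fix x
    have "grad_lap_heat i t x = 5 / (4 * t\<^sup>2 * N) * (x $ i * gauss c x) - 1 / (8 * t ^ 3 * N) * (x $ i * (norm x)\<^sup>2 * gauss c x)"
      unfolding grad_lap_heat_def heat_kernel_gauss [OF t] N_def [symmetric] c_def [symmetric]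
      using t N by (simp add: field_simps power2_eq_square power3_eq_cube)
    then show "complex_of_real (grad_lap_heat i t x) = complex_of_real (5 / (4 * t\<^sup>2 * N)) * complex_of_real (x $ i * gauss c x)
        - complex_of_real (1 / (8 * t ^ 3 * N)) * complex_of_real (x $ i * (norm x)\<^sup>2 * gauss c x)"
      by (simp only: of_real_mult of_real_diff)
  qed
  also have "\<dots> = complex_of_real (5 / (4 * t\<^sup>2 * N)) * rfourier (\<lambda>x. x $ i * gauss c x) \<xi>
     - complex_of_real (1 / (8 * t ^ 3 * N)) * rfourier (\<lambda>x. x $ i * (norm x)\<^sup>2 * gauss c x) \<xi>"
    by (subst fourier_diff [OF i1 i2]) (simp only: fourier_cmult)
  also have "\<dots> = - \<i> * complex_of_real ((5 / (4 * t\<^sup>2 * N) * (\<xi> $ i / (2 * c))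
     - 1 / (8 * t ^ 3 * N) * (\<xi> $ i * (5 / (4 * c\<^sup>2) - (norm \<xi>)\<^sup>2 / (8 * c ^ 3)))) * (N * gauss t \<xi>))"
    unfolding fourier_gauss_coord [OF c] fourier_gauss_coord_norm_sq [OF c] E
    by (simp only: of_real_mult of_real_diff) (simp only: ring_distribs mult_ac minus_mult_left minus_mult_right)
  also have "(5 / (4 * t\<^sup>2 * N) * (\<xi> $ i / (2 * c))
     - 1 / (8 * t ^ 3 * N) * (\<xi> $ i * (5 / (4 * c\<^sup>2) - (norm \<xi>)\<^sup>2 / (8 * c ^ 3)))) * (N * gauss t \<xi>)
     = \<xi> $ i * (norm \<xi>)\<^sup>2 * gauss t \<xi>"
    using t N by (simp add: c_def power2_eq_square power3_eq_cube field_simps)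
  finally show ?thesis .
qed

lemma inv_fourier_eq: "inv_fourier g x = complex_of_real (1 / (2 * pi) ^ 3) * fourier g (- x)"
  by (simp add: inv_fourier_def fourier_def inner_commute)

lemma inv_fourier_translate:
  "inv_fourier (\<lambda>\<xi>. cis (- (y \<bullet> \<xi>)) * g \<xi>) x = inv_fourier g (x - y)"
  by (simp add: inv_fourier_def mult.assoc [symmetric] cis_mult inner_diff_left)

text \<open>The constants of the two Fourier integrals multiply up to that of the heat kernel; this factor
  is common to the inverse transforms of all polynomials times \<^term>\<open>gauss t\<close>.\<close>
lemma inv_fourier_gauss_factor:
  assumes t: "0 < t"
  shows "complex_of_real (1 / (2 * pi) ^ 3) * rfourier (gauss t) (- x) = complex_of_real (heat_kernel t x)"
proof -
  have "sqrt (pi / t) / (2 * pi) = 1 / sqrt (4 * pi * t)"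
    using t by (simp add: real_sqrt_mult real_sqrt_divide field_simps)
  then have "1 / (2 * pi) ^ 3 * sqrt (pi / t) ^ 3 = 1 / sqrt (4 * pi * t) ^ 3"
    by (metis (no_types, lifting) mult.commute mult_1 power_divide power_one times_divide_eq_right)
  moreover have "gauss (1 / (4 * t)) (- x) = gauss (1 / (4 * t)) x" by (simp add: gauss_def)
  ultimately have "1 / (2 * pi) ^ 3 * (sqrt (pi / t) ^ 3 * gauss (1 / (4 * t)) (- x)) = heat_kernel t x"
    using heat_kernel_gauss [OF t, of x] by (simp only: mult.assoc [symmetric]) simp
  then show ?thesis unfolding fourier_gauss [OF t] by (simp only: of_real_mult [symmetric])
qed

lemma inv_fourier_coord2:
  assumes t: "0 < t"
  shows "inv_fourier (\<lambda>\<xi>. complex_of_real (\<xi> $ i * \<xi> $ j * gauss t \<xi>)) x = - complex_of_real (hess_heat i j t x)"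
  unfolding inv_fourier_eq fourier_gauss_coord2 [OF t] mult.left_commute [of "complex_of_real (1 / (2 * pi) ^ 3)"]
    inv_fourier_gauss_factor [OF t]
  by (simp add: algebra_simps)

lemma inv_fourier_coord_norm_sq:
  assumes t: "0 < t"
  shows "inv_fourier (\<lambda>\<xi>. complex_of_real (\<xi> $ i * (norm \<xi>)\<^sup>2 * gauss t \<xi>)) x = \<i> * complex_of_real (grad_lap_heat i t x)"
  unfolding inv_fourier_eq fourier_gauss_coord_norm_sq [OF t] mult.left_commute [of "complex_of_real (1 / (2 * pi) ^ 3)"]
    inv_fourier_gauss_factor [OF t] grad_lap_heat_def
  by (simp add: mult_ac)

lemma heat_kernel_nonneg [simp]: "0 \<le> heat_kernel t x"
  by (simp add: heat_kernel_def)

lemma heat_kernel_minus [simp]: "heat_kernel t (- x) = heat_kernel t x"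
  by (simp add: heat_kernel_def)

lemma heat_kernel_commute: "heat_kernel t (x - y) = heat_kernel t (y - x)"
  by (simp add: heat_kernel_def norm_minus_commute)

lemma heat_kernel_measurable' [measurable (raw)]:
  assumes [measurable]: "f \<in> borel_measurable M" "g \<in> borel_measurable M"
  shows "(\<lambda>x. heat_kernel (f x) (g x)) \<in> borel_measurable M"
  unfolding heat_kernel_def by measurable

lemma lap_heat_measurable' [measurable (raw)]:
  assumes [measurable]: "f \<in> borel_measurable M" "g \<in> borel_measurable M"
  shows "(\<lambda>x. lap_heat (f x) (g x)) \<in> borel_measurable M"
  unfolding lap_heat_def by measurable

lemma grad_lap_heat_measurable' [measurable (raw)]:
  assumes [measurable]: "f \<in> borel_measurable M" "g \<in> borel_measurable M"
  shows "(\<lambda>x. grad_lap_heat i (f x) (g x)) \<in> borel_measurable M"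
  unfolding grad_lap_heat_def by measurable

lemma heat_kernel_integrable: "0 < t \<Longrightarrow> integrable lborel (heat_kernel t)"
  using gauss_integrable [of "1 / (4 * t)"] by (simp add: heat_kernel_gauss cong: Bochner_Integration.integrable_cong)

lemma integral_heat_kernel: "0 < t \<Longrightarrow> (LINT x|lborel. heat_kernel t x) = 1"
  using integral_gauss [of "1 / (4 * t)"] by (simp add: heat_kernel_gauss mult_ac)

lemma nn_integral_heat_kernel: "0 < t \<Longrightarrow> (\<integral>\<^sup>+x. ennreal (heat_kernel t x) \<partial>lborel) = 1"
  by (simp add: nn_integral_eq_integral heat_kernel_integrable integral_heat_kernel)

lemma heat_kernel_le:
  assumes "0 < t" shows "heat_kernel t x \<le> 1 / sqrt (4 * pi * t) ^ 3"
  using assms by (simp add: heat_kernel_gauss gauss_def divide_right_mono)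

text \<open>Doubling the time leaves a spare Gaussian factor, which beats the polynomials in front of
  \<open>p\<^sub>t\<close> in its derivatives.\<close>
lemma heat_kernel_double_gauss:
  assumes t: "0 < t"
  shows "heat_kernel t x = sqrt 2 ^ 3 * heat_kernel (2 * t) x * exp (- (norm x)\<^sup>2 / (8 * t))"
proof -
  have "gauss (1 / (4 * t)) x = gauss (1 / (4 * (2 * t))) x * exp (- (norm x)\<^sup>2 / (8 * t))"
    using t by (simp add: gauss_def exp_add [symmetric] field_simps)
  moreover have "sqrt (4 * pi * (2 * t)) = sqrt 2 * sqrt (4 * pi * t)"
    using real_sqrt_mult [of 2 "4 * pi * t"] by (simp add: mult.left_commute)
  ultimately show ?thesis
    using t by (simp add: heat_kernel_gauss power_mult_distrib)
qed

text \<open>With \<open>a = |x|\<^sup>2 / (8 t)\<close> the polynomial factor is \<open>(2 a - 3/2) / t\<close>, at most \<open>2 e\<^sup>a / t\<close>, and \<open>e\<^sup>a\<close>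
  is cancelled by the spare Gaussian factor.\<close>
lemma lap_heat_le:
  assumes t: "0 < t"
  shows "\<bar>lap_heat t x\<bar> \<le> 12 / t * heat_kernel (2 * t) x"
proof -
  define a where "a = (norm x)\<^sup>2 / (8 * t)"
  have a: "a \<ge> 0" using t by (simp add: a_def)
  have hk: "heat_kernel t x = sqrt 2 ^ 3 * heat_kernel (2 * t) x * exp (- a)"
    using heat_kernel_double_gauss [OF t, of x] by (simp add: a_def)
  have "sqrt 2 \<le> 3 / 2" by (rule real_le_lsqrt) (auto simp: power2_eq_square)
  then have "sqrt 2 ^ 3 \<le> (3/2) ^ 3" by (intro power_mono) auto
  then have s: "sqrt 2 ^ 3 \<le> 4" by (simp add: power3_eq_cube)
  have "\<bar>(norm x)\<^sup>2 / (4 * t\<^sup>2) - 3 / (2 * t)\<bar> = \<bar>2 * a - 3/2\<bar> / t"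
    using t by (simp add: a_def power2_eq_square abs_divide field_simps flip: abs_mult_pos)
  also have "\<dots> \<le> 2 * exp a / t"
  proof -
    have "\<bar>2 * a - 3/2\<bar> \<le> 2 * exp a" using a exp_ge_add_one_self [of a] by linarith
    then show ?thesis using t by (simp add: divide_right_mono)
  qed
  finally have le: "\<bar>(norm x)\<^sup>2 / (4 * t\<^sup>2) - 3 / (2 * t)\<bar> \<le> 2 * exp a / t" .
  have "\<bar>lap_heat t x\<bar> = \<bar>(norm x)\<^sup>2 / (4 * t\<^sup>2) - 3 / (2 * t)\<bar> * heat_kernel t x"
    by (simp add: lap_heat_def abs_mult)
  also have "\<dots> \<le> (2 * exp a / t) * (sqrt 2 ^ 3 * heat_kernel (2 * t) x * exp (- a))"
    unfolding hk by (intro mult_right_mono le) auto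
  also have "\<dots> = 2 / t * sqrt 2 ^ 3 * heat_kernel (2 * t) x"
    by (simp add: exp_minus)
  also have "\<dots> \<le> 2 / t * 4 * heat_kernel (2 * t) x"
    using s t by (intro mult_right_mono mult_left_mono) auto
  also have "\<dots> \<le> 12 / t * heat_kernel (2 * t) x"
    using t by (intro mult_right_mono) (auto simp: field_simps)
  finally show ?thesis .
qed

text \<open>As for the Laplacian, with \<open>u = |x| / \<surd>t\<close>: the cubic polynomial in \<open>u\<close> is dominated by the first
  terms of the series of \<open>exp (u\<^sup>2 / 8)\<close>, and the powers of \<open>t\<close> combine to \<open>t\<^bsup>-3/2\<^esup>\<close>.\<close>
lemma grad_lap_heat_le:
  assumes t: "0 < t"
  shows "\<bar>grad_lap_heat i t x\<bar> \<le> 600 / (t * sqrt t) * heat_kernel (2 * t) x"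
proof -
  define a where "a = (norm x)\<^sup>2 / (8 * t)"
  define u where "u = norm x / sqrt t"
  have u: "u \<ge> 0" using t by (simp add: u_def)
  have hk: "heat_kernel t x = sqrt 2 ^ 3 * heat_kernel (2 * t) x * exp (- a)"
    using heat_kernel_double_gauss [OF t, of x] by (simp add: a_def)
  have a: "a = u\<^sup>2 / 8" using t by (simp add: a_def u_def power_divide)
  have a0: "a \<ge> 0" using t by (simp add: a_def)
  have "sqrt 2 \<le> 3 / 2" by (rule real_le_lsqrt) (auto simp: power2_eq_square)
  then have "sqrt 2 ^ 3 \<le> (3/2) ^ 3" by (intro power_mono) auto
  then have s: "sqrt 2 ^ 3 \<le> 4" by (simp add: power3_eq_cube)
  have "\<bar>x $ i * (5 / (4 * t\<^sup>2) - (norm x)\<^sup>2 / (8 * t ^ 3))\<bar>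
      \<le> norm x * (5 / (4 * t\<^sup>2) + (norm x)\<^sup>2 / (8 * t ^ 3))"
    unfolding abs_mult
  proof (rule mult_mono)
    show "\<bar>5 / (4 * t\<^sup>2) - (norm x)\<^sup>2 / (8 * t ^ 3)\<bar> \<le> 5 / (4 * t\<^sup>2) + (norm x)\<^sup>2 / (8 * t ^ 3)"
      using t by (intro order_trans [OF abs_triangle_ineq4]) auto
  qed (auto simp: component_le_norm_cart)
  also have "\<dots> = (u * (5 / 4 + u\<^sup>2 / 8)) / (t * sqrt t)"
  proof -
    have "norm x = u * sqrt t" using t by (simp add: u_def)
    then show ?thesis using t
      by (simp add: power_mult_distrib divide_simps power2_eq_square power3_eq_cube)
        (simp add: algebra_simps)
  qed
  also have "\<dots> \<le> (150 * exp a) / (t * sqrt t)"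
  proof -
    have "1 + a + a\<^sup>2 / 2 \<le> exp a"
      by (rule exp_lower_Taylor_quadratic [OF a0])
    then have "1 + u\<^sup>2 / 8 + u ^ 4 / 128 \<le> exp a" by (simp add: a power_divide flip: power_mult)
    moreover have "u * (5 / 4 + u\<^sup>2 / 8) \<le> 150 * (1 + u\<^sup>2 / 8 + u ^ 4 / 128)"
    proof -
      have "2 * u \<le> u\<^sup>2 + 1" using zero_le_power2 [of "u - 1"] by (simp add: power2_diff)
      then have "u \<le> 1 + u\<^sup>2" using u by linarith
      moreover have "u * u\<^sup>2 \<le> u\<^sup>2 + u ^ 4"
      proof -
        have "u\<^sup>2 * u \<le> u\<^sup>2 * (1 + u\<^sup>2)" using \<open>u \<le> 1 + u\<^sup>2\<close> by (intro mult_left_mono) auto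
        then show ?thesis by (simp add: algebra_simps flip: power_add)
      qed
      moreover have "0 \<le> u\<^sup>2" "0 \<le> u ^ 4" by auto
      moreover have "u * (5 / 4 + u\<^sup>2 / 8) = 5 / 4 * u + u * u\<^sup>2 / 8" by (simp add: algebra_simps)
      moreover have "5 / 4 * U + K / 8 \<le> 150 * (1 + V / 8 + W / 128)"
        if "U \<le> 1 + V" "K \<le> V + W" "0 \<le> V" "0 \<le> W" for U V W K :: real
        using that by (simp add: field_simps)
      ultimately show ?thesis by presburger
    qed
    ultimately have "u * (5 / 4 + u\<^sup>2 / 8) \<le> 150 * exp a"
      by (elim order_trans) (rule mult_left_mono, auto)
    then show ?thesis using t by (intro divide_right_mono) auto
  qed
  finally have le: "\<bar>x $ i * (5 / (4 * t\<^sup>2) - (norm x)\<^sup>2 / (8 * t ^ 3))\<bar> \<le> (150 * exp a) / (t * sqrt t)" .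
  have "\<bar>grad_lap_heat i t x\<bar> = \<bar>x $ i * (5 / (4 * t\<^sup>2) - (norm x)\<^sup>2 / (8 * t ^ 3))\<bar> * heat_kernel t x"
    by (simp add: grad_lap_heat_def abs_mult)
  also have "\<dots> \<le> (150 * exp a) / (t * sqrt t) * (sqrt 2 ^ 3 * heat_kernel (2 * t) x * exp (- a))"
    unfolding hk by (intro mult_right_mono le) auto
  also have "\<dots> = 150 / (t * sqrt t) * sqrt 2 ^ 3 * heat_kernel (2 * t) x"
    by (simp add: exp_minus)
  also have "\<dots> \<le> 150 / (t * sqrt t) * 4 * heat_kernel (2 * t) x"
    using s t by (intro mult_right_mono mult_left_mono) auto
  finally show ?thesis by simp
qed

lemma lap_heat_bounded:
  assumes "0 < t" shows "\<bar>lap_heat t x\<bar> \<le> 12 / t * (1 / sqrt (4 * pi * (2 * t)) ^ 3)"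
  using assms by (intro order_trans [OF lap_heat_le] mult_left_mono heat_kernel_le) auto

lemma heat_kernel_time_derivative:
  assumes t: "0 < t"
  shows "((\<lambda>t. heat_kernel t x) has_real_derivative lap_heat t x) (at t)"
proof -
  have "((\<lambda>t. (4 * pi * t) powr (- 3 / 2)) has_real_derivative (- 3 / 2) * (4 * pi * t) powr (- 3 / 2 - 1) * (4 * pi)) (at t)"
    using t by (auto intro!: derivative_eq_intros)
  moreover have "((\<lambda>t. exp (- (norm x)\<^sup>2 / (4 * t))) has_real_derivative exp (- (norm x)\<^sup>2 / (4 * t)) * ((norm x)\<^sup>2 / (4 * t\<^sup>2))) (at t)"
    using t by (auto intro!: derivative_eq_intros simp: power2_eq_square field_simps)
  ultimately have "((\<lambda>t. heat_kernel t x) has_real_derivative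
     (- 3 / 2) * (4 * pi * t) powr (- 3 / 2 - 1) * (4 * pi) * exp (- (norm x)\<^sup>2 / (4 * t))
     + exp (- (norm x)\<^sup>2 / (4 * t)) * ((norm x)\<^sup>2 / (4 * t\<^sup>2)) * (4 * pi * t) powr (- 3 / 2)) (at t)"
    unfolding heat_kernel_def by (rule DERIV_mult)
  moreover have "(4 * pi * t) powr (- 3 / 2 - 1) * (4 * pi) = (4 * pi * t) powr (- 3 / 2) / t"
    using t by (subst powr_diff) (simp add: field_simps)
  ultimately show ?thesis
    unfolding lap_heat_def heat_kernel_def
    by (elim DERIV_cong) (simp add: algebra_simps)
qed

text \<open>Completing the square in \<open>z\<close>: the product of two Gaussians in \<open>z\<close> is a Gaussian centred at the
  weighted mean \<open>m\<close> of \<open>x\<close> and \<open>y\<close>.  Convolutions with a heat kernel become Gaussian moments.\<close>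
lemma heat_kernel_mult:
  fixes x y :: "real^3"
  assumes r: "0 < r" and s: "0 < s"
  defines "m \<equiv> (1 / (r + s)) *\<^sub>R (s *\<^sub>R x + r *\<^sub>R y)"
  shows "heat_kernel r (x - z) * heat_kernel s (z - y)
    = heat_kernel (r + s) (x - y) * heat_kernel (r * s / (r + s)) (z - m)"
proof -
  define \<rho> where "\<rho> = r * s / (r + s)"
  have \<rho>: "\<rho> > 0" using r s by (simp add: \<rho>_def)
  have "(norm (x - z))\<^sup>2 / (4 * r) + (norm (z - y))\<^sup>2 / (4 * s) = (norm (x - y))\<^sup>2 / (4 * (r + s)) + (norm (z - m))\<^sup>2 / (4 * \<rho>)"
  proof -
    have e: "z - m = (1 / (r + s)) *\<^sub>R ((r + s) *\<^sub>R z - (s *\<^sub>R x + r *\<^sub>R y))"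
      using r s by (simp add: m_def scaleR_diff_right)
    have "(norm (z - m))\<^sup>2 = (norm ((r + s) *\<^sub>R z - (s *\<^sub>R x + r *\<^sub>R y)))\<^sup>2 / (r + s)\<^sup>2"
      unfolding e using r s by (simp add: power_divide)
    moreover have "(norm ((r + s) *\<^sub>R z - (s *\<^sub>R x + r *\<^sub>R y)))\<^sup>2
      = (r + s)\<^sup>2 * (z \<bullet> z) - 2 * (r + s) * (s * (x \<bullet> z) + r * (y \<bullet> z)) + s\<^sup>2 * (x \<bullet> x) + 2 * r * s * (x \<bullet> y) + r\<^sup>2 * (y \<bullet> y)"
      unfolding power2_norm_eq_inner
      by (simp add: inner_diff_left inner_diff_right inner_add_left inner_add_right
          inner_commute power2_eq_square algebra_simps)
    moreover have "(norm (x - z))\<^sup>2 = x \<bullet> x - 2 * (x \<bullet> z) + z \<bullet> z" "(norm (z - y))\<^sup>2 = z \<bullet> z - 2 * (y \<bullet> z) + y \<bullet> y"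
      "(norm (x - y))\<^sup>2 = x \<bullet> x - 2 * (x \<bullet> y) + y \<bullet> y"
      by (simp_all add: power2_norm_eq_inner inner_diff_left inner_diff_right inner_commute)
    moreover have "(A - 2 * Q + C) / (4 * r) + (C - 2 * R + B) / (4 * s) = (A - 2 * P + B) / (4 * (r + s))
        + ((r + s)\<^sup>2 * C - 2 * (r + s) * (s * Q + r * R) + s\<^sup>2 * A + 2 * r * s * P + r\<^sup>2 * B) / (r + s)\<^sup>2 / (4 * \<rho>)"
      for A B C P Q R :: real
    proof -
      have nz: "r + s \<noteq> 0" "r \<noteq> 0" "s \<noteq> 0" using r s by auto
      define L where "L = (r + s) * (s * (A - 2 * Q + C) + r * (C - 2 * R + B)) - r * s * (A - 2 * P + B)
        - ((r + s)\<^sup>2 * C - 2 * (r + s) * (s * Q + r * R) + s\<^sup>2 * A + 2 * r * s * P + r\<^sup>2 * B)"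
      have "L = 0" unfolding L_def by algebra
      moreover have "(A - 2 * Q + C) / (4 * r) + (C - 2 * R + B) / (4 * s) - ((A - 2 * P + B) / (4 * (r + s))
        + ((r + s)\<^sup>2 * C - 2 * (r + s) * (s * Q + r * R) + s\<^sup>2 * A + 2 * r * s * P + r\<^sup>2 * B) / (r + s)\<^sup>2 / (4 * \<rho>))
        = L / (4 * r * s * (r + s))"
      proof -
        have "D / (r + s)\<^sup>2 / (4 * \<rho>) = D / (4 * r * s * (r + s))" for D
          unfolding \<rho>_def using nz by (simp add: power2_eq_square)
        moreover have "U / (4 * r) + V / (4 * s) - (W / (4 * (r + s)) + D / (4 * r * s * (r + s)))
          = ((r + s) * (s * U + r * V) - r * s * W - D) / (4 * r * s * (r + s))" for U V W D
        proof -
          define T where "T = r + s"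
          have "U / (4 * r) = T * (s * U) / (4 * r * s * T)" "V / (4 * s) = T * (r * V) / (4 * r * s * T)"
            "W / (4 * T) = r * s * W / (4 * r * s * T)"
            using nz by (simp_all add: T_def [symmetric])
          then show ?thesis
            unfolding T_def [symmetric] by (simp only: diff_divide_distrib add_divide_distrib distrib_left)
        qed
        ultimately show ?thesis unfolding L_def by (simp only:)
      qed
      ultimately show ?thesis by simp
    qed
    ultimately show ?thesis by (simp only:)
  qed
  then have "exp (- (norm (x - z))\<^sup>2 / (4 * r)) * exp (- (norm (z - y))\<^sup>2 / (4 * s))
    = exp (- (norm (x - y))\<^sup>2 / (4 * (r + s))) * exp (- (norm (z - m))\<^sup>2 / (4 * \<rho>))"
    by (simp add: exp_add [symmetric])
  moreover have "(4 * pi * r) powr (- 3 / 2) * (4 * pi * s) powr (- 3 / 2) = (4 * pi * (r + s)) powr (- 3 / 2) * (4 * pi * \<rho>) powr (- 3 / 2)"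
  proof -
    have "\<rho> * (r + s) = r * s" using r s by (simp add: \<rho>_def)
    then have "(4 * pi * r) * (4 * pi * s) = (4 * pi * (r + s)) * (4 * pi * \<rho>)"
      by algebra
    then show ?thesis using r s \<rho> by (simp only: powr_mult [symmetric])
  qed
  moreover have "(a * e) * (b * f) = (c * g) * (d * h)" if "e * f = g * h" "a * b = c * d"
    for a b c d e f g h :: real
    using that by algebra
  ultimately show ?thesis
    unfolding heat_kernel_def \<rho>_def [symmetric] by blast
qed

lemma heat_kernel_semigroup:
  assumes r: "0 < r" and s: "0 < s"
  shows "integrable lborel (\<lambda>z. heat_kernel r (x - z) * heat_kernel s (z - y))"
    and "(LINT z|lborel. heat_kernel r (x - z) * heat_kernel s (z - y)) = heat_kernel (r + s) (x - y)"
proof -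
  define \<rho> where "\<rho> = r * s / (r + s)"
  have \<rho>: "\<rho> > 0" using r s by (simp add: \<rho>_def)
  define m where "m = (1 / (r + s)) *\<^sub>R (s *\<^sub>R x + r *\<^sub>R y)"
  note eq = heat_kernel_mult [OF r s, of x _ y, folded \<rho>_def m_def]
  show "integrable lborel (\<lambda>z. heat_kernel r (x - z) * heat_kernel s (z - y))"
    unfolding eq using lborel_integrable_translate [OF heat_kernel_integrable [OF \<rho>], of "- m"] by simp
  show "(LINT z|lborel. heat_kernel r (x - z) * heat_kernel s (z - y)) = heat_kernel (r + s) (x - y)"
    unfolding eq using lborel_integral_translate [of "heat_kernel \<rho>" "- m"] integral_heat_kernel [OF \<rho>] by simp
qed

text \<open>The first moment vanishes by reflection; the second is the value at \<open>\<xi> = 0\<close> of the Fourier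
  transform of \<^term>\<open>\<lambda>x. (norm x)\<^sup>2 * gauss c x\<close>.\<close>
lemma heat_kernel_moments:
  assumes t: "0 < t"
  shows "integrable lborel (\<lambda>x. (x \<bullet> a) * heat_kernel t x)" "(LINT x|lborel. (x \<bullet> a) * heat_kernel t x) = 0"
    "integrable lborel (\<lambda>x. (norm x)\<^sup>2 * heat_kernel t x)" "(LINT x|lborel. (norm x)\<^sup>2 * heat_kernel t x) = 6 * t"
proof -
  define c where "c = 1 / (4 * t)"
  have c: "c > 0" using t by (simp add: c_def)
  have eq: "q * heat_kernel t x = (q * gauss c x) / sqrt (4 * pi * t) ^ 3" for q x
    using heat_kernel_gauss [OF t] by (simp add: c_def)
  show "integrable lborel (\<lambda>x. (x \<bullet> a) * heat_kernel t x)"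
    unfolding eq by (intro integrable_divide polynomial_gauss_integrable real_polynomial_function_inner c)
  have "(LINT x|lborel. (x \<bullet> a) * heat_kernel t x) = (LINT x|lborel. ((0 - x) \<bullet> a) * heat_kernel t (0 - x))"
    by (rule lborel_integral_reflect [symmetric]) simp
  also have "\<dots> = - (LINT x|lborel. (x \<bullet> a) * heat_kernel t x)" by simp
  finally show "(LINT x|lborel. (x \<bullet> a) * heat_kernel t x) = 0" by simp
  have int: "integrable lborel (\<lambda>x. (norm x)\<^sup>2 * gauss c x)"
    by (intro polynomial_gauss_integrable real_polynomial_function_norm_sq c)
  then show "integrable lborel (\<lambda>x. (norm x)\<^sup>2 * heat_kernel t x)"
    unfolding eq by (rule integrable_divide)
  have "complex_of_real (LINT x|lborel. (norm x)\<^sup>2 * gauss c x) = complex_of_real (3 / (2 * c) * (LINT x|lborel. gauss c x))"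
    using fourier_gauss_norm_sq [OF c, of 0]
    unfolding fourier_def by (simp only: inner_zero_right minus_zero cis_zero mult_1 integral_complex_of_real) simp
  then have "(LINT x|lborel. (norm x)\<^sup>2 * gauss c x) = 3 / (2 * c) * (LINT x|lborel. gauss c x)"
    by (simp only: of_real_eq_iff)
  also have "\<dots> = 6 * t * sqrt (4 * pi * t) ^ 3"
    using t by (simp add: integral_gauss [OF c]) (simp add: c_def mult_ac)
  finally show "(LINT x|lborel. (norm x)\<^sup>2 * heat_kernel t x) = 6 * t"
    unfolding eq using t by simp
qed

text \<open>\<open>S(r) \<Delta>p\<^sub>s = \<Delta>p\<^bsub>r+s\<^esub>\<close>.  After completing the square, \<open>|z - y|\<^sup>2\<close> is expanded around the centre \<open>m\<close>
  and only the moments of order \<open>0\<close>, \<open>1\<close> and \<open>2\<close> of a heat kernel remain.\<close>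
lemma heat_kernel_lap_heat_conv:
  assumes r: "0 < r" and s: "0 < s"
  shows "integrable lborel (\<lambda>z. heat_kernel r (x - z) * lap_heat s (z - y))"
    and "(LINT z|lborel. heat_kernel r (x - z) * lap_heat s (z - y)) = lap_heat (r + s) (x - y)"
proof -
  define \<rho> where "\<rho> = r * s / (r + s)"
  have \<rho>: "\<rho> > 0" using r s by (simp add: \<rho>_def)
  define m where "m = (1 / (r + s)) *\<^sub>R (s *\<^sub>R x + r *\<^sub>R y)"
  define a where "a = m - y"
  have a: "a = (s / (r + s)) *\<^sub>R (x - y)"
  proof -
    have "y = (1 / (r + s)) *\<^sub>R ((r + s) *\<^sub>R y)" using r s by simp
    then have "a = (1 / (r + s)) *\<^sub>R (s *\<^sub>R x + r *\<^sub>R y - (r + s) *\<^sub>R y)"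
      unfolding a_def m_def by (metis scaleR_diff_right)
    also have "s *\<^sub>R x + r *\<^sub>R y - (r + s) *\<^sub>R y = s *\<^sub>R (x - y)" by (simp add: algebra_simps)
    finally show ?thesis by simp
  qed
  define K where "K = heat_kernel (r + s) (x - y)"
  define G where "G w = 1 / (4 * s\<^sup>2) * ((norm w)\<^sup>2 * heat_kernel \<rho> w) + 1 / (2 * s\<^sup>2) * ((w \<bullet> a) * heat_kernel \<rho> w)
      + ((norm a)\<^sup>2 / (4 * s\<^sup>2) - 3 / (2 * s)) * heat_kernel \<rho> w" for w
  have eq: "heat_kernel r (x - z) * lap_heat s (z - y) = K * G (z + - m)" for z
  proof -
    have "(norm (z - y))\<^sup>2 = (norm (z - m))\<^sup>2 + 2 * ((z - m) \<bullet> a) + (norm a)\<^sup>2"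
    proof -
      have "z - y = (z - m) + a" by (simp add: a_def)
      show ?thesis
        unfolding \<open>z - y = (z - m) + a\<close> power2_norm_eq_inner
        by (simp add: inner_add_left inner_add_right inner_commute)
    qed
    moreover have "1 / (4 * s\<^sup>2) * (A * H) + 1 / (2 * s\<^sup>2) * (B * H) + (C / (4 * s\<^sup>2) - 3 / (2 * s)) * H
        = ((A + 2 * B + C) / (4 * s\<^sup>2) - 3 / (2 * s)) * H" for A B C H :: real
      using s by (simp add: divide_simps) (simp add: algebra_simps)
    ultimately have "((norm (z - y))\<^sup>2 / (4 * s\<^sup>2) - 3 / (2 * s)) * heat_kernel \<rho> (z - m) = G (z + - m)"
      by (simp only: G_def diff_conv_add_uminus [symmetric])
    moreover have "heat_kernel r (x - z) * lap_heat s (z - y)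
       = ((norm (z - y))\<^sup>2 / (4 * s\<^sup>2) - 3 / (2 * s)) * (K * heat_kernel \<rho> (z - m))"
      using heat_kernel_mult [OF r s, of x z y] by (simp add: lap_heat_def K_def m_def \<rho>_def mult_ac)
    ultimately show ?thesis by (simp add: mult_ac)
  qed
  have G: "integrable lborel G"
    unfolding G_def
    by (intro Bochner_Integration.integrable_add integrable_mult_right heat_kernel_moments heat_kernel_integrable \<rho>)
  have "(LINT w|lborel. G w) = 1 / (4 * s\<^sup>2) * (6 * \<rho>) + 1 / (2 * s\<^sup>2) * 0 + ((norm a)\<^sup>2 / (4 * s\<^sup>2) - 3 / (2 * s)) * 1"
    unfolding G_def
    by (simp add: heat_kernel_moments [OF \<rho>] heat_kernel_integrable [OF \<rho>] integral_heat_kernel [OF \<rho>])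
  also have "\<dots> = (norm (x - y))\<^sup>2 / (4 * (r + s)\<^sup>2) - 3 / (2 * (r + s))"
  proof -
    have "(norm a)\<^sup>2 = s\<^sup>2 * (norm (x - y))\<^sup>2 / (r + s)\<^sup>2"
      unfolding a using r s by (simp add: power_mult_distrib power_divide)
    then have 1: "(norm a)\<^sup>2 / (4 * s\<^sup>2) = (norm (x - y))\<^sup>2 / (4 * (r + s)\<^sup>2)"
      using s by simp
    have 2: "1 / (4 * s\<^sup>2) * (6 * \<rho>) - 3 / (2 * s) = - 3 / (2 * (r + s))"
      using r s by (simp add: \<rho>_def divide_simps power2_eq_square)
    show ?thesis unfolding 1 using 2 by simp
  qed
  finally have IG: "(LINT w|lborel. G w) = (norm (x - y))\<^sup>2 / (4 * (r + s)\<^sup>2) - 3 / (2 * (r + s))" .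
  have [measurable]: "G \<in> borel_measurable borel" using G by auto
  show "integrable lborel (\<lambda>z. heat_kernel r (x - z) * lap_heat s (z - y))"
    unfolding eq by (intro integrable_mult_right lborel_integrable_translate G)
  show "(LINT z|lborel. heat_kernel r (x - z) * lap_heat s (z - y)) = lap_heat (r + s) (x - y)"
    unfolding eq using lborel_integral_translate [of G "- m"] IG by (simp add: lap_heat_def K_def mult.commute)
qed

section \<open>Riesz transforms of derivatives of the heat kernel\<close>

lemma gauss_add: "gauss (s + t) x = gauss s x * gauss t x"
  by (simp add: gauss_def exp_add [symmetric] algebra_simps)

text \<open>\<open>1 / |\<xi>|\<close> as a superposition of Gaussians.  In this way the non-smooth symbol of the Riesz
  transform is handled by averaging explicit Gaussian formulas over \<open>q\<close>.\<close>
lemma subordination: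
  shows "integrable lborel (\<lambda>q. norm \<xi> * gauss (q\<^sup>2) \<xi>)"
    and "\<xi> \<noteq> 0 \<Longrightarrow> (LINT q|lborel. norm \<xi> * gauss (q\<^sup>2) \<xi>) = sqrt pi"
proof -
  have *: "integrable lborel (\<lambda>q. norm \<xi> * gauss (q\<^sup>2) \<xi>) \<and> (LINT q|lborel. norm \<xi> * gauss (q\<^sup>2) \<xi>) = sqrt pi"
    if "\<xi> \<noteq> 0"
  proof -
    have c: "(norm \<xi>)\<^sup>2 > 0" using that by simp
    have eq: "norm \<xi> * gauss (q\<^sup>2) \<xi> = norm \<xi> * exp (- (norm \<xi>)\<^sup>2 * q\<^sup>2)" for q
      by (simp add: gauss_def mult.commute)
    have int: "integrable lborel (\<lambda>q::real. complex_of_real (exp (- (norm \<xi>)\<^sup>2 * q\<^sup>2)))"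
      using gaussian_char_1d(1) [OF c, of 0] by simp
    then have int': "integrable lborel (\<lambda>q::real. exp (- (norm \<xi>)\<^sup>2 * q\<^sup>2))"
      using complex_of_real_integrable_eq by blast
    have "complex_of_real (LINT q|lborel. exp (- (norm \<xi>)\<^sup>2 * q\<^sup>2)) = complex_of_real (sqrt (pi / (norm \<xi>)\<^sup>2))"
      using gaussian_char_1d(2) [OF c, of 0]
      by (simp only: mult_zero_right cis_zero mult_1 integral_complex_of_real) simp
    then have "(LINT q|lborel. exp (- (norm \<xi>)\<^sup>2 * q\<^sup>2)) = sqrt pi / norm \<xi>"
      by (simp only: of_real_eq_iff) (simp add: real_sqrt_divide)
    then show ?thesis unfolding eq using int' that by simp
  qed
  show "integrable lborel (\<lambda>q. norm \<xi> * gauss (q\<^sup>2) \<xi>)" by (cases "\<xi> = 0") (use * in auto)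
  show "\<xi> \<noteq> 0 \<Longrightarrow> (LINT q|lborel. norm \<xi> * gauss (q\<^sup>2) \<xi>) = sqrt pi" using * by blast
qed

lemma gauss_subordination:
  shows "integrable lborel (\<lambda>q. \<xi> $ i * (norm \<xi>)\<^sup>2 * gauss (s + q\<^sup>2) \<xi>)"
    and "(LINT q|lborel. \<xi> $ i * (norm \<xi>)\<^sup>2 * gauss (s + q\<^sup>2) \<xi>) = sqrt pi * (\<xi> $ i * norm \<xi> * gauss s \<xi>)"
proof -
  have eq: "\<xi> $ i * (norm \<xi>)\<^sup>2 * gauss (s + q\<^sup>2) \<xi> = (\<xi> $ i * norm \<xi> * gauss s \<xi>) * (norm \<xi> * gauss (q\<^sup>2) \<xi>)" for q
    by (simp add: gauss_add power2_eq_square)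
  show "integrable lborel (\<lambda>q. \<xi> $ i * (norm \<xi>)\<^sup>2 * gauss (s + q\<^sup>2) \<xi>)"
    unfolding eq by (intro integrable_mult_right subordination)
  show "(LINT q|lborel. \<xi> $ i * (norm \<xi>)\<^sup>2 * gauss (s + q\<^sup>2) \<xi>) = sqrt pi * (\<xi> $ i * norm \<xi> * gauss s \<xi>)"
    unfolding eq using subordination(2) [of \<xi>] by (cases "\<xi> = 0") auto
qed

lemma gauss_measurable' [measurable (raw)]:
  assumes [measurable]: "f \<in> borel_measurable M" "g \<in> borel_measurable M"
  shows "(\<lambda>x. gauss (f x) (g x)) \<in> borel_measurable M"
  unfolding gauss_def by measurable

lemma cis_measurable' [measurable (raw)]:
  assumes "f \<in> borel_measurable M"
  shows "(\<lambda>x. cis (f x)) \<in> borel_measurable M"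
  using assms by (rule measurable_compose) (intro borel_measurable_continuous_onI continuous_intros)

text \<open>Up to the constant \<open>-\<i> \<surd>\<pi>\<close>, the function with Fourier transform \<open>\<xi>\<^sub>i |\<xi>| e\<^bsup>-s|\<xi>|\<^sup>2\<^esup>\<close>, that is a multiple
  of the Riesz transform of \<open>\<Delta>p\<^sub>s\<close>, by subordination of \<open>\<xi>\<^sub>i |\<xi>|\<^sup>2 / |\<xi>|\<close>.\<close>
definition riesz_lap_heat :: "3 \<Rightarrow> real \<Rightarrow> real^3 \<Rightarrow> real" where
  "riesz_lap_heat i s x = (LINT q|lborel. grad_lap_heat i (s + q\<^sup>2) x)"

lemma inverse_quadratic_integrable: "integrable lborel (\<lambda>q::real. 1 / (1 + q\<^sup>2))"
  using integrable_inverse_1_plus_square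
  by (simp add: set_integrable_def einterval_eq_UNIV divide_inverse)

text \<open>The \<open>L\<^sup>1\<close> norm of \<open>\<partial>\<^sub>i\<Delta>p\<^bsub>s+q\<^sup>2\<^esub>\<close> is \<open>O((s + q\<^sup>2)\<^bsup>-3/2\<^esup>)\<close>, which is integrable in \<open>q\<close>.\<close>
lemma grad_lap_heat_pair_integrable:
  assumes s: "0 < s"
  shows "integrable (lborel \<Otimes>\<^sub>M lborel) (\<lambda>(x, q). grad_lap_heat i (s + q\<^sup>2) x)"
proof -
  \<comment> \<open>chosen such that \<open>C / (1 + q\<^sup>2)\<close> dominates the bound at time \<open>s + q\<^sup>2\<close>\<close>
  define C where "C = 600 / (sqrt s * min s 1)"
  have "C \<ge> 0" using s by (simp add: C_def)
  have bound: "600 / ((s + q\<^sup>2) * sqrt (s + q\<^sup>2)) \<le> C * (1 / (1 + q\<^sup>2))" for q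
  proof -
    have "min s 1 * (1 + q\<^sup>2) \<le> s + q\<^sup>2"
    proof -
      have "min s 1 * q\<^sup>2 \<le> 1 * q\<^sup>2" by (rule mult_right_mono) auto
      then show ?thesis by (simp add: algebra_simps min_le_iff_disj)
    qed
    moreover have "sqrt s \<le> sqrt (s + q\<^sup>2)" by simp
    ultimately have "min s 1 * (1 + q\<^sup>2) * sqrt s \<le> (s + q\<^sup>2) * sqrt (s + q\<^sup>2)"
      using s by (intro mult_mono) auto
    moreover have "0 < min s 1 * (1 + q\<^sup>2) * sqrt s"
      using s by (intro mult_pos_pos) (auto simp: add_pos_nonneg)
    ultimately have "600 / ((s + q\<^sup>2) * sqrt (s + q\<^sup>2)) \<le> 600 / (min s 1 * (1 + q\<^sup>2) * sqrt s)"
      by (intro divide_left_mono) (auto intro: mult_pos_pos)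
    then show ?thesis by (simp add: C_def mult_ac)
  qed
  have "(\<integral>\<^sup>+z. ennreal (norm (grad_lap_heat i (s + (snd z)\<^sup>2) (fst z))) \<partial>(lborel \<Otimes>\<^sub>M lborel))
     = (\<integral>\<^sup>+q. \<integral>\<^sup>+x. ennreal \<bar>grad_lap_heat i (s + q\<^sup>2) x\<bar> \<partial>lborel \<partial>lborel)"
    by (subst lborel_pair.nn_integral_snd [symmetric]) auto
  also have "\<dots> \<le> (\<integral>\<^sup>+q. ennreal (C * (1 / (1 + q\<^sup>2))) \<partial>lborel)"
  proof (rule nn_integral_mono)
    fix q :: real
    have t: "0 < s + q\<^sup>2" using s by (simp add: add_pos_nonneg)
    have "(\<integral>\<^sup>+x. ennreal \<bar>grad_lap_heat i (s + q\<^sup>2) x\<bar> \<partial>lborel)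
        \<le> (\<integral>\<^sup>+x. ennreal (C * (1 / (1 + q\<^sup>2))) * ennreal (heat_kernel (2 * (s + q\<^sup>2)) x) \<partial>lborel)"
    proof (rule nn_integral_mono)
      fix x :: "real^3"
      have "\<bar>grad_lap_heat i (s + q\<^sup>2) x\<bar> \<le> C * (1 / (1 + q\<^sup>2)) * heat_kernel (2 * (s + q\<^sup>2)) x"
        by (rule order_trans [OF grad_lap_heat_le [OF t]]) (intro mult_right_mono bound heat_kernel_nonneg)
      then show "ennreal \<bar>grad_lap_heat i (s + q\<^sup>2) x\<bar> \<le> ennreal (C * (1 / (1 + q\<^sup>2))) * ennreal (heat_kernel (2 * (s + q\<^sup>2)) x)"
        using \<open>C \<ge> 0\<close> by (subst ennreal_mult [symmetric]) (auto intro!: ennreal_leI)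
    qed
    also have "\<dots> = ennreal (C * (1 / (1 + q\<^sup>2)))"
      using t by (subst nn_integral_cmult) (auto simp: nn_integral_heat_kernel)
    finally show "(\<integral>\<^sup>+x. ennreal \<bar>grad_lap_heat i (s + q\<^sup>2) x\<bar> \<partial>lborel) \<le> ennreal (C * (1 / (1 + q\<^sup>2)))" .
  qed
  also have "\<dots> < \<infinity>"
  proof -
    have "integrable lborel (\<lambda>q::real. C * (1 / (1 + q\<^sup>2)))"
      by (intro integrable_mult_right inverse_quadratic_integrable)
    then show ?thesis using \<open>C \<ge> 0\<close> by (auto simp: integrable_iff_bounded)
  qed
  finally show ?thesis by (simp add: integrable_iff_bounded case_prod_beta)
qed

lemma riesz_lap_heat_integrable:
  assumes s: "0 < s" shows "integrable lborel (riesz_lap_heat i s)"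
  using lborel_pair.integrable_fst' [OF grad_lap_heat_pair_integrable [OF s]]
  by (simp add: riesz_lap_heat_def [abs_def])

lemma fourier_riesz_lap_heat:
  assumes s: "0 < s"
  shows "rfourier (riesz_lap_heat i s) \<xi> = - \<i> * complex_of_real (sqrt pi * (\<xi> $ i * norm \<xi> * gauss s \<xi>))"
proof -
  have int: "integrable (lborel \<Otimes>\<^sub>M lborel) (\<lambda>(x, q). cis (- (x \<bullet> \<xi>)) * complex_of_real (grad_lap_heat i (s + q\<^sup>2) x))"
    by (rule Bochner_Integration.integrable_bound [OF grad_lap_heat_pair_integrable [OF s, of i]])
       (auto simp: norm_mult case_prod_beta)
  have "rfourier (riesz_lap_heat i s) \<xi> = (LINT x|lborel. LINT q|lborel. cis (- (x \<bullet> \<xi>)) * complex_of_real (grad_lap_heat i (s + q\<^sup>2) x))"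
    unfolding fourier_def riesz_lap_heat_def integral_complex_of_real [symmetric] by simp
  also have "\<dots> = (LINT q|lborel. rfourier (grad_lap_heat i (s + q\<^sup>2)) \<xi>)"
    unfolding fourier_def by (rule lborel_pair.Fubini_integral [symmetric, OF int])
  also have "\<dots> = (LINT q|lborel. - \<i> * complex_of_real (\<xi> $ i * (norm \<xi>)\<^sup>2 * gauss (s + q\<^sup>2) \<xi>))"
    using s by (intro Bochner_Integration.integral_cong refl fourier_grad_lap_heat) (simp add: add_pos_nonneg)
  also have "\<dots> = - \<i> * complex_of_real (LINT q|lborel. \<xi> $ i * (norm \<xi>)\<^sup>2 * gauss (s + q\<^sup>2) \<xi>)"
    unfolding integral_complex_of_real [symmetric] by (simp only: integral_mult_right_zero)
  finally show ?thesis unfolding gauss_subordination .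
qed

text \<open>Fourier inversion for this one function: exchange the integral in \<open>q\<close> with the inverse Fourier
  transform, which is known for each Gaussian.\<close>
lemma inv_fourier_riesz_lap_heat:
  assumes s: "0 < s"
  shows "inv_fourier (\<lambda>\<xi>. complex_of_real (\<xi> $ i * norm \<xi> * gauss s \<xi>)) x
     = \<i> * complex_of_real (riesz_lap_heat i s x / sqrt pi)"
proof -
  define f where "f \<xi> q = cis (x \<bullet> \<xi>) * complex_of_real (\<xi> $ i * (norm \<xi>)\<^sup>2 * gauss (s + q\<^sup>2) \<xi>)" for \<xi> q
  have meas: "(\<lambda>(\<xi>, q). f \<xi> q) \<in> borel_measurable (lborel \<Otimes>\<^sub>M lborel)"
    unfolding f_def by measurable
  have norm_f: "norm (f \<xi> q) = (\<bar>\<xi> $ i\<bar> * norm \<xi> * gauss s \<xi>) * (norm \<xi> * gauss (q\<^sup>2) \<xi>)" for \<xi> q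
    by (simp add: f_def norm_mult gauss_add power2_eq_square abs_mult del: of_real_mult)
  have int: "integrable (lborel \<Otimes>\<^sub>M lborel) (\<lambda>(\<xi>, q). f \<xi> q)"
  proof (rule lborel_pair.Fubini_integrable [OF meas])
    have "(LINT q|lborel. norm (f \<xi> q)) = sqrt pi * (\<bar>\<xi> $ i\<bar> * norm \<xi> * gauss s \<xi>)" for \<xi>
      unfolding norm_f using subordination(2) [of \<xi>] by (cases "\<xi> = 0") auto
    moreover have "integrable lborel (\<lambda>\<xi>. sqrt pi * (\<bar>\<xi> $ i\<bar> * norm \<xi> * gauss s \<xi>))"
    proof (rule Bochner_Integration.integrable_bound)
      show "integrable lborel (\<lambda>\<xi>. sqrt pi * ((norm \<xi>)\<^sup>2 * gauss s \<xi>))"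
        by (intro integrable_mult_right polynomial_gauss_integrable real_polynomial_function_norm_sq s)
      show "(\<lambda>\<xi>. sqrt pi * (\<bar>\<xi> $ i\<bar> * norm \<xi> * gauss s \<xi>)) \<in> borel_measurable lborel" by measurable
      have "norm (sqrt pi * (\<bar>\<xi> $ i\<bar> * norm \<xi> * gauss s \<xi>)) \<le> norm (sqrt pi * ((norm \<xi>)\<^sup>2 * gauss s \<xi>))" for \<xi>
        by (auto simp: abs_mult power2_eq_square intro!: mult_mono component_le_norm_cart)
      then show "AE \<xi> in lborel. norm (sqrt pi * (\<bar>\<xi> $ i\<bar> * norm \<xi> * gauss s \<xi>)) \<le> norm (sqrt pi * ((norm \<xi>)\<^sup>2 * gauss s \<xi>))"
        by simp
    qed
    ultimately show "integrable lborel (\<lambda>\<xi>. LINT q|lborel. norm (case (\<xi>, q) of (\<xi>, q) \<Rightarrow> f \<xi> q))"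
      by simp
    have "integrable lborel (\<lambda>q. f \<xi> q)" for \<xi>
      unfolding f_def by (intro integrable_mult_right integrable_of_real gauss_subordination)
    then show "AE \<xi> in lborel. integrable lborel (\<lambda>q. case (\<xi>, q) of (\<xi>, q) \<Rightarrow> f \<xi> q)" by simp
  qed
  have "(LINT \<xi>|lborel. LINT q|lborel. f \<xi> q) = (LINT q|lborel. LINT \<xi>|lborel. f \<xi> q)"
    by (rule lborel_pair.Fubini_integral [symmetric, OF int])
  moreover have "(LINT q|lborel. f \<xi> q) = complex_of_real (sqrt pi) * (cis (x \<bullet> \<xi>) * complex_of_real (\<xi> $ i * norm \<xi> * gauss s \<xi>))" for \<xi>
  proof -
    have "(LINT q|lborel. f \<xi> q) = cis (x \<bullet> \<xi>) * complex_of_real (LINT q|lborel. \<xi> $ i * (norm \<xi>)\<^sup>2 * gauss (s + q\<^sup>2) \<xi>)"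
      unfolding f_def integral_complex_of_real [symmetric] by (simp only: integral_mult_right_zero)
    then show ?thesis unfolding gauss_subordination by simp
  qed
  ultimately have "complex_of_real (sqrt pi) * (LINT \<xi>|lborel. cis (x \<bullet> \<xi>) * complex_of_real (\<xi> $ i * norm \<xi> * gauss s \<xi>))
      = (LINT q|lborel. LINT \<xi>|lborel. f \<xi> q)"
    by (simp only: integral_mult_right_zero)
  then have "complex_of_real (sqrt pi) * inv_fourier (\<lambda>\<xi>. complex_of_real (\<xi> $ i * norm \<xi> * gauss s \<xi>)) x
      = (LINT q|lborel. inv_fourier (\<lambda>\<xi>. complex_of_real (\<xi> $ i * (norm \<xi>)\<^sup>2 * gauss (s + q\<^sup>2) \<xi>)) x)"
    unfolding inv_fourier_def f_def by (simp only: integral_mult_right_zero mult.left_commute [of "complex_of_real (sqrt pi)"])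
  also have "\<dots> = (LINT q|lborel. \<i> * complex_of_real (grad_lap_heat i (s + q\<^sup>2) x))"
    using s by (intro Bochner_Integration.integral_cong refl inv_fourier_coord_norm_sq) (simp add: add_pos_nonneg)
  also have "\<dots> = \<i> * complex_of_real (riesz_lap_heat i s x)"
    unfolding riesz_lap_heat_def integral_complex_of_real [symmetric] by (simp only: integral_mult_right_zero)
  finally show ?thesis by (simp add: field_simps)
qed

section \<open>The test fields\<close>

text \<open>The Laplacian of a heat kernel in the \<open>i\<close>-th component.  A heat kernel itself would not do:
  its Leray projection is not a Schwartz field, since the symbol of the projection is
  discontinuous at the origin.\<close>
definition test_field :: "real^3 \<Rightarrow> real \<Rightarrow> 3 \<Rightarrow> real^3 \<Rightarrow> complex^3" where
  "test_field y s i x = lap_heat s (x - y) *\<^sub>R axis i 1"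

text \<open>Its \<open>j\<close>-th component is \<open>\<delta>\<^sub>i\<^sub>j \<Delta>p\<^sub>s - \<partial>\<^sub>i\<partial>\<^sub>jp\<^sub>s\<close>, as the symbol \<open>\<delta>\<^sub>i\<^sub>j - \<xi>\<^sub>i\<xi>\<^sub>j / |\<xi>|\<^sup>2\<close> applied to
  \<open>- |\<xi>|\<^sup>2 e\<^bsup>-s|\<xi>|\<^sup>2\<^esup>\<close> predicts.\<close>
definition leray_test_field :: "real^3 \<Rightarrow> real \<Rightarrow> 3 \<Rightarrow> real^3 \<Rightarrow> complex^3" where
  "leray_test_field y s i x = (\<Sum>j\<in>UNIV. ((if j = i then lap_heat s (x - y) else 0) - hess_heat j i s (x - y)) *\<^sub>R axis j 1)"

lemma test_field_nth: "test_field y s i x $ j = complex_of_real (if j = i then lap_heat s (x - y) else 0)"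
  by (simp add: test_field_def axis_def of_real_def)

lemma leray_test_field_nth:
  "leray_test_field y s i x $ j = complex_of_real ((if j = i then lap_heat s (x - y) else 0) - hess_heat j i s (x - y))"
proof -
  have "(\<Sum>k\<in>UNIV. f k *\<^sub>R axis k (1::complex)) $ j = complex_of_real (f j)" for f :: "3 \<Rightarrow> real"
    by (simp add: sum_component axis_def of_real_def if_distrib [of "\<lambda>z. _ *\<^sub>R z"] cong: if_cong)
  then show ?thesis unfolding leray_test_field_def .
qed

lemma riesz_zero: "riesz j (\<lambda>y. 0) x = 0"
  by (simp add: riesz_def fourier_def inv_fourier_def)

lemma riesz_sum_test_field:
  assumes s: "0 < s"
  shows "riesz_sum (test_field y s i) x = - \<i> / complex_of_real (sqrt pi) * complex_of_real (riesz_lap_heat i s (x - y))"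
proof -
  have "riesz_sum (test_field y s i) x = (\<Sum>j\<in>UNIV. if j = i then riesz i (\<lambda>x. complex_of_real (lap_heat s (x - y))) x else 0)"
    unfolding riesz_sum_def test_field_nth by (intro sum.cong refl) (simp add: riesz_zero)
  also have "\<dots> = riesz i (\<lambda>x. complex_of_real (lap_heat s (x - y))) x" by simp
  also have "\<dots> = inv_fourier (\<lambda>\<xi>. cis (- (y \<bullet> \<xi>)) * (- complex_of_real (\<xi> $ i * norm \<xi> * gauss s \<xi>))) x"
    unfolding riesz_def
  proof (intro arg_cong [of _ _ "\<lambda>f. inv_fourier f x"] ext)
    fix \<xi>
    have "fourier (\<lambda>x. complex_of_real (lap_heat s (x - y))) \<xi> = cis (- (y \<bullet> \<xi>)) * (- complex_of_real ((norm \<xi>)\<^sup>2 * gauss s \<xi>))"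
      using fourier_translate [of "\<lambda>x. complex_of_real (lap_heat s x)" y \<xi>] fourier_lap_heat [OF s] by simp
    then show "complex_of_real (\<xi> $ i / norm \<xi>) * fourier (\<lambda>x. complex_of_real (lap_heat s (x - y))) \<xi>
        = cis (- (y \<bullet> \<xi>)) * - complex_of_real (\<xi> $ i * norm \<xi> * gauss s \<xi>)"
      by (cases "\<xi> = 0") (simp_all add: power2_eq_square)
  qed
  also have "\<dots> = inv_fourier (\<lambda>\<xi>. - complex_of_real (\<xi> $ i * norm \<xi> * gauss s \<xi>)) (x - y)"
    by (rule inv_fourier_translate)
  also have "\<dots> = - inv_fourier (\<lambda>\<xi>. complex_of_real (\<xi> $ i * norm \<xi> * gauss s \<xi>)) (x - y)"
    by (simp add: inv_fourier_def)
  finally show ?thesis unfolding inv_fourier_riesz_lap_heat [OF s] by simp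
qed

lemma leray_test_field:
  assumes s: "0 < s"
  shows "leray (test_field y s i) = leray_test_field y s i"
proof (intro ext, subst vec_eq_iff, intro allI)
  fix x j
  have meas: "(\<lambda>x. complex_of_real (riesz_lap_heat i s x)) \<in> borel_measurable borel"
    using riesz_lap_heat_integrable [OF s, of i] by auto
  have "riesz j (riesz_sum (test_field y s i)) x = inv_fourier (\<lambda>\<xi>. cis (- (y \<bullet> \<xi>)) * (- complex_of_real (\<xi> $ j * \<xi> $ i * gauss s \<xi>))) x"
    unfolding riesz_def
  proof (intro arg_cong [of _ _ "\<lambda>f. inv_fourier f x"] ext)
    fix \<xi>
    have "fourier (riesz_sum (test_field y s i)) \<xi>
        = - \<i> / complex_of_real (sqrt pi) * (cis (- (y \<bullet> \<xi>)) * (- \<i> * complex_of_real (sqrt pi * (\<xi> $ i * norm \<xi> * gauss s \<xi>))))"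
      unfolding riesz_sum_test_field [OF s] fourier_cmult
      using fourier_translate [OF meas, of y \<xi>] fourier_riesz_lap_heat [OF s] by simp
    also have "\<dots> = - (cis (- (y \<bullet> \<xi>)) * complex_of_real (\<xi> $ i * norm \<xi> * gauss s \<xi>))"
      by (simp add: field_simps)
    finally show "complex_of_real (\<xi> $ j / norm \<xi>) * fourier (riesz_sum (test_field y s i)) \<xi>
        = cis (- (y \<bullet> \<xi>)) * - complex_of_real (\<xi> $ j * \<xi> $ i * gauss s \<xi>)"
      by (cases "\<xi> = 0") simp_all
  qed
  also have "\<dots> = inv_fourier (\<lambda>\<xi>. - complex_of_real (\<xi> $ j * \<xi> $ i * gauss s \<xi>)) (x - y)"
    by (rule inv_fourier_translate)
  also have "\<dots> = - inv_fourier (\<lambda>\<xi>. complex_of_real (\<xi> $ j * \<xi> $ i * gauss s \<xi>)) (x - y)"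
    by (simp add: inv_fourier_def)
  finally have "riesz j (riesz_sum (test_field y s i)) x = complex_of_real (hess_heat j i s (x - y))"
    unfolding inv_fourier_coord2 [OF s] by simp
  then show "leray (test_field y s i) x $ j = leray_test_field y s i x $ j"
    unfolding leray_def leray_test_field_nth test_field_nth by simp
qed

section \<open>Schwartz functions\<close>

lemma poly_gauss_has_derivative:
  assumes "real_polynomial_function q"
  obtains D where "\<And>x. ((\<lambda>x. q (x - y) * gauss c (x - y)) has_derivative (\<lambda>v. D (x - y) v * gauss c (x - y))) (at x)"
    "\<And>v. real_polynomial_function (\<lambda>x. D x v)"
proof -
  obtain D where D: "\<And>x. (q has_derivative D x) (at x)" "\<And>v. real_polynomial_function (\<lambda>x. D x v)"
    using real_polynomial_function_derivative [OF assms] by blast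
  define E where "E x v = D x v - 2 * c * (x \<bullet> v) * q x" for x v
  have "real_polynomial_function (\<lambda>x. E x v)" for v
    unfolding E_def by (intro real_polynomial_function_diff real_polynomial_function.intros(2,4) D assms real_polynomial_function_inner)
  moreover have "((\<lambda>x. q (x - y) * gauss c (x - y)) has_derivative (\<lambda>v. E (x - y) v * gauss c (x - y))) (at x)" for x
  proof -
    have "((\<lambda>x. q x * gauss c x) has_derivative (\<lambda>v. E (x - y) v * gauss c (x - y))) (at (x - y))"
      by (rule has_derivative_eq_rhs [OF has_derivative_mult [OF D(1) gauss_has_derivative]])
         (auto simp: E_def algebra_simps)
    moreover have "((\<lambda>x. x - y) has_derivative (\<lambda>v. v)) (at x)"
      by (auto intro!: derivative_eq_intros)
    ultimately show ?thesis
      using has_derivative_compose [of "\<lambda>x. x - y" "\<lambda>v. v" x UNIV "\<lambda>x. q x * gauss c x"] by simp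
  qed
  ultimately show ?thesis using that [of E] by blast
qed

text \<open>Vector valued polynomials times a fixed Gaussian are closed under partial derivatives.\<close>
lemma partial_poly_gauss:
  fixes e :: "3 \<Rightarrow> 'b::real_normed_vector"
  assumes "\<And>j. real_polynomial_function (q j)"
  shows "(\<lambda>x. \<Sum>j\<in>UNIV. (q j (x - y) * gauss c (x - y)) *\<^sub>R e j) differentiable_on UNIV"
    and "\<exists>q'. (\<forall>j. real_polynomial_function (q' j)) \<and>
      partial k (\<lambda>x. \<Sum>j\<in>UNIV. (q j (x - y) * gauss c (x - y)) *\<^sub>R e j)
        = (\<lambda>x. \<Sum>j\<in>UNIV. (q' j (x - y) * gauss c (x - y)) *\<^sub>R e j)"
proof -
  have "\<exists>D. (\<forall>x. ((\<lambda>x. q j (x - y) * gauss c (x - y)) has_derivative (\<lambda>v. D (x - y) v * gauss c (x - y))) (at x)) \<and>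
      (\<forall>v. real_polynomial_function (\<lambda>x. D x v))" for j
  proof -
    obtain D where "\<And>x. ((\<lambda>x. q j (x - y) * gauss c (x - y)) has_derivative (\<lambda>v. D (x - y) v * gauss c (x - y))) (at x)"
      "\<And>v. real_polynomial_function (\<lambda>x. D x v)"
      using poly_gauss_has_derivative [OF assms [of j], where y = y and c = c] by blast
    then show ?thesis by blast
  qed
  then have "\<exists>D. \<forall>j. (\<forall>x. ((\<lambda>x. q j (x - y) * gauss c (x - y)) has_derivative (\<lambda>v. D j (x - y) v * gauss c (x - y))) (at x)) \<and>
      (\<forall>v. real_polynomial_function (\<lambda>x. D j x v))"
    by (intro choice allI)
  then obtain D where "\<forall>j. (\<forall>x. ((\<lambda>x. q j (x - y) * gauss c (x - y)) has_derivative (\<lambda>v. D j (x - y) v * gauss c (x - y))) (at x)) \<and>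
      (\<forall>v. real_polynomial_function (\<lambda>x. D j x v))" ..
  then have D: "\<And>j x. ((\<lambda>x. q j (x - y) * gauss c (x - y)) has_derivative (\<lambda>v. D j (x - y) v * gauss c (x - y))) (at x)"
    "\<And>j v. real_polynomial_function (\<lambda>x. D j x v)"
    by (auto simp only:)
  have der: "((\<lambda>x. \<Sum>j\<in>UNIV. (q j (x - y) * gauss c (x - y)) *\<^sub>R e j)
      has_derivative (\<lambda>v. \<Sum>j\<in>UNIV. (D j (x - y) v * gauss c (x - y)) *\<^sub>R e j)) (at x)" for x
    by (intro has_derivative_sum has_derivative_scaleR_left D)
  then show "(\<lambda>x. \<Sum>j\<in>UNIV. (q j (x - y) * gauss c (x - y)) *\<^sub>R e j) differentiable_on UNIV"
    by (intro differentiable_at_imp_differentiable_on) (auto simp only: differentiable_def)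
  have "partial k (\<lambda>x. \<Sum>j\<in>UNIV. (q j (x - y) * gauss c (x - y)) *\<^sub>R e j)
        = (\<lambda>x. \<Sum>j\<in>UNIV. (D j (x - y) (axis k 1) * gauss c (x - y)) *\<^sub>R e j)"
    by (intro ext) (simp only: partial_def frechet_derivative_at [OF der, symmetric])
  then show "\<exists>q'. (\<forall>j. real_polynomial_function (q' j)) \<and>
      partial k (\<lambda>x. \<Sum>j\<in>UNIV. (q j (x - y) * gauss c (x - y)) *\<^sub>R e j)
        = (\<lambda>x. \<Sum>j\<in>UNIV. (q' j (x - y) * gauss c (x - y)) *\<^sub>R e j)"
    using D(2) by (intro exI [of _ "\<lambda>j x. D j x (axis k 1)"]) simp
qed

lemma poly_gauss_weighted_bounded:
  assumes q: "real_polynomial_function q" and c: "0 < c"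
  shows "\<exists>B. \<forall>x. (1 + norm x) ^ k * \<bar>q (x - y) * gauss c (x - y)\<bar> \<le> B"
proof -
  obtain B where B: "0 \<le> B" "\<And>x. \<bar>q x * gauss c x\<bar> \<le> B * gauss (c/2) x"
    using polynomial_gauss_le [OF q c] by blast
  have "(1 + norm x) ^ k * \<bar>q (x - y) * gauss c (x - y)\<bar> \<le> (1 + norm y) ^ k * (B * exp ((real k)\<^sup>2 / (4 * (c/2))))" for x
  proof -
    have "1 + norm x \<le> 1 + (norm y + norm (x - y))"
      using norm_triangle_ineq [of y "x - y"] by simp
    also have "\<dots> \<le> (1 + norm y) * (1 + norm (x - y))"
      by (simp add: algebra_simps)
    finally have "(1 + norm x) ^ k \<le> ((1 + norm y) * (1 + norm (x - y))) ^ k"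
      by (rule power_mono) simp
    then have "(1 + norm x) ^ k * \<bar>q (x - y) * gauss c (x - y)\<bar>
        \<le> ((1 + norm y) * (1 + norm (x - y))) ^ k * (B * gauss (c/2) (x - y))"
      by (intro mult_mono B) auto
    also have "\<dots> = (1 + norm y) ^ k * (B * ((1 + norm (x - y)) ^ k * gauss (c/2) (x - y)))"
      by (simp add: power_mult_distrib mult_ac)
    also have "\<dots> \<le> (1 + norm y) ^ k * (B * exp ((real k)\<^sup>2 / (4 * (c/2))))"
      using B(1) c by (intro mult_left_mono power_times_gauss_bounded) auto
    finally show ?thesis .
  qed
  then show ?thesis by blast
qed

text \<open>All iterated derivatives have the same form, so it is enough to bound functions of this form
  with polynomial weights.\<close>
lemma schwartz_poly_gauss:
  fixes e :: "3 \<Rightarrow> 'b::real_normed_vector"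
  assumes q: "\<And>j. real_polynomial_function (q j)" and c: "0 < c"
  shows "(\<lambda>x. \<Sum>j\<in>UNIV. (q j (x - y) * gauss c (x - y)) *\<^sub>R e j) \<in> schwartz"
proof -
  let ?F = "\<lambda>q x. \<Sum>j\<in>UNIV. (q j (x - y) * gauss c (x - y)) *\<^sub>R e j"
  have form: "\<exists>q'. (\<forall>j. real_polynomial_function (q' j)) \<and> partials js (?F q) = ?F q'" for js
  proof (induction js)
    case Nil
    show ?case using q by (intro exI [of _ q]) (simp add: partials_def)
  next
    case (Cons k js)
    then obtain q1 where "\<forall>j. real_polynomial_function (q1 j)" "partials js (?F q) = ?F q1" by blast
    moreover from this obtain q2 where "\<forall>j. real_polynomial_function (q2 j)" "partial k (?F q1) = ?F q2"
      using partial_poly_gauss(2) [where q = q1 and k = k and y = y and c = c and e = e] by blast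
    ultimately show ?case by (intro exI [of _ q2]) (simp add: partials_def)
  qed
  show ?thesis
    unfolding schwartz_def
  proof (intro CollectI allI conjI)
    fix js
    obtain q' where q': "\<And>j. real_polynomial_function (q' j)" "partials js (?F q) = ?F q'"
      using form by blast
    show "partials js (?F q) differentiable_on UNIV"
      unfolding q'(2) by (rule partial_poly_gauss(1) [OF q'(1)])
    fix k
    have "\<exists>B. \<forall>j x. (1 + norm x) ^ k * \<bar>q' j (x - y) * gauss c (x - y)\<bar> \<le> B j"
      using poly_gauss_weighted_bounded [OF q'(1) c, where k = k and y = y] by (intro choice allI)
    then obtain B where "\<forall>j x. (1 + norm x) ^ k * \<bar>q' j (x - y) * gauss c (x - y)\<bar> \<le> B j" ..
    then have B: "\<And>j x. (1 + norm x) ^ k * \<bar>q' j (x - y) * gauss c (x - y)\<bar> \<le> B j" by simp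
    have "norm ((1 + norm x) ^ k *\<^sub>R ?F q' x) \<le> (\<Sum>j\<in>UNIV. B j * norm (e j))" for x
    proof -
      have "norm ((1 + norm x) ^ k *\<^sub>R ?F q' x) \<le> (\<Sum>j\<in>UNIV. norm ((1 + norm x) ^ k *\<^sub>R (q' j (x - y) * gauss c (x - y)) *\<^sub>R e j))"
        unfolding scaleR_sum_right by (rule norm_sum)
      also have "\<dots> \<le> (\<Sum>j\<in>UNIV. B j * norm (e j))"
      proof (rule sum_mono)
        fix j
        have "norm ((1 + norm x) ^ k *\<^sub>R (q' j (x - y) * gauss c (x - y)) *\<^sub>R e j)
            = (1 + norm x) ^ k * \<bar>q' j (x - y) * gauss c (x - y)\<bar> * norm (e j)"
          by (simp add: abs_mult)
        also have "\<dots> \<le> B j * norm (e j)" by (intro mult_right_mono B) simp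
        finally show "norm ((1 + norm x) ^ k *\<^sub>R (q' j (x - y) * gauss c (x - y)) *\<^sub>R e j) \<le> B j * norm (e j)" .
      qed
      finally show ?thesis .
    qed
    then show "bounded (range (\<lambda>x. (1 + norm x) ^ k *\<^sub>R partials js (?F q) x))"
      unfolding q'(2) by (intro boundedI [where B = "\<Sum>j\<in>UNIV. B j * norm (e j)"], elim imageE, simp only:)
  qed
qed

text \<open>\<open>(1 + |x|)\<^sup>6\<close> dominates the product of the \<open>1 + x\<^sub>b\<^sup>2\<close> over the three coordinates.\<close>
lemma inverse_power_norm_integrable: "integrable lborel (\<lambda>x::real^3. 1 / (1 + norm x) ^ 6)"
proof -
  have "(\<integral>\<^sup>+x. ennreal (1 / (1 + norm (x::real^3)) ^ 6) \<partial>lborel) \<le> (\<integral>\<^sup>+x. (\<Prod>b\<in>(Basis :: (real^3) set). ennreal (1 / (1 + (x \<bullet> b)\<^sup>2))) \<partial>lborel)"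
  proof (rule nn_integral_mono)
    fix x :: "real^3"
    have "(\<Prod>b\<in>(Basis :: (real^3) set). 1 + (x \<bullet> b)\<^sup>2) \<le> (\<Prod>b\<in>(Basis :: (real^3) set). (1 + norm x)\<^sup>2)"
    proof (rule prod_mono)
      fix b :: "real^3" assume "b \<in> Basis"
      then have "\<bar>x \<bullet> b\<bar> \<le> norm x" by (rule Basis_le_norm)
      then have "(x \<bullet> b)\<^sup>2 \<le> (norm x)\<^sup>2" by (metis abs_ge_zero power2_abs power_mono)
      then show "0 \<le> 1 + (x \<bullet> b)\<^sup>2 \<and> 1 + (x \<bullet> b)\<^sup>2 \<le> (1 + norm x)\<^sup>2"
        by (simp add: power2_sum) (use norm_ge_zero [of x] in linarith)
    qed
    also have "\<dots> = (1 + norm x) ^ 6" by (simp flip: power_mult)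
    finally have "1 / (1 + norm x) ^ 6 \<le> 1 / (\<Prod>b\<in>(Basis :: (real^3) set). 1 + (x \<bullet> b)\<^sup>2)"
    proof (intro divide_left_mono mult_pos_pos)
      show "0 < (1 + norm x) ^ 6" by (rule zero_less_power) (simp add: add_pos_nonneg)
      show "0 < (\<Prod>b\<in>(Basis :: (real^3) set). 1 + (x \<bullet> b)\<^sup>2)"
        by (rule prod_pos) (simp add: add_pos_nonneg)
    qed auto
    also have "\<dots> = (\<Prod>b\<in>(Basis :: (real^3) set). 1 / (1 + (x \<bullet> b)\<^sup>2))"
      by (simp add: prod_dividef)
    finally show "ennreal (1 / (1 + norm x) ^ 6) \<le> (\<Prod>b\<in>Basis. ennreal (1 / (1 + (x \<bullet> b)\<^sup>2)))"
      by (subst prod_ennreal) (auto intro!: ennreal_leI)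
  qed
  also have "\<dots> = (\<Prod>b\<in>(Basis :: (real^3) set). \<integral>\<^sup>+r. ennreal (1 / (1 + r\<^sup>2)) \<partial>lborel)"
    by (rule nn_integral_lborel_prod) auto
  also have "\<dots> < \<infinity>"
    using inverse_quadratic_integrable by (auto simp: integrable_iff_bounded power_less_top_ennreal)
  finally show ?thesis by (simp add: integrable_iff_bounded)
qed

lemma schwartz_bounded_integrable:
  fixes \<phi> :: "real^3 \<Rightarrow> 'b::euclidean_space"
  assumes "\<phi> \<in> schwartz"
  shows "integrable lborel \<phi>" and "\<exists>B. \<forall>x. norm (\<phi> x) \<le> B"
proof -
  have diff: "\<phi> differentiable_on UNIV" and bd: "\<And>k. bounded (range (\<lambda>x. (1 + norm x) ^ k *\<^sub>R \<phi> x))"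
    using assms by (auto simp: schwartz_def partials_def dest!: spec [of _ "[]"])
  have meas: "\<phi> \<in> borel_measurable lborel"
    using differentiable_imp_continuous_on [OF diff] by (simp add: borel_measurable_continuous_onI)
  obtain B where B: "\<And>x. norm ((1 + norm x) ^ 6 *\<^sub>R \<phi> x) \<le> B"
    using bd [of 6] by (auto simp: bounded_iff)
  show "integrable lborel \<phi>"
  proof (rule Bochner_Integration.integrable_bound [OF _ meas])
    show "integrable lborel (\<lambda>x::real^3. B * (1 / (1 + norm x) ^ 6))"
      by (intro integrable_mult_right inverse_power_norm_integrable)
    have "norm (\<phi> x) \<le> norm (B * (1 / (1 + norm x) ^ 6))" for x
    proof -
      have pos: "0 < (1 + norm x) ^ 6" by (rule zero_less_power) (simp add: add_pos_nonneg)
      have "(1 + norm x) ^ 6 * norm (\<phi> x) = norm ((1 + norm x) ^ 6 *\<^sub>R \<phi> x)"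
        using pos by (simp only: norm_scaleR abs_of_pos)
      also have "\<dots> \<le> B" by (rule B)
      finally have "norm (\<phi> x) \<le> B * (1 / (1 + norm x) ^ 6)"
        by (simp only: times_divide_eq_right mult_1_right pos_le_divide_eq [OF pos] mult.commute [of "norm (\<phi> x)"])
      then show ?thesis using abs_ge_self order_trans unfolding real_norm_def by blast
    qed
    then show "AE x in lborel. norm (\<phi> x) \<le> norm (B * (1 / (1 + norm x) ^ 6))" by simp
  qed
  show "\<exists>B. \<forall>x. norm (\<phi> x) \<le> B"
    using bd [of 0] by (auto simp: bounded_iff)
qed

lemma hess_heat_poly:
  assumes "0 < t"
  obtains q where "real_polynomial_function q" "\<And>x. hess_heat i j t x = q x * gauss (1 / (4 * t)) x"
proof
  show "real_polynomial_function (\<lambda>x::real^3. (x $ i * x $ j / (4 * t\<^sup>2) - (if i = j then 1 / (2 * t) else 0)) / sqrt (4 * pi * t) ^ 3)"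
    by (intro real_polynomial_function_divide real_polynomial_function_diff real_polynomial_function.intros(2,4) real_polynomial_function_nth)
qed (use assms in \<open>auto simp: heat_kernel_gauss\<close>)

lemma leray_test_field_form:
  assumes "0 < s"
  obtains q where "\<And>j. real_polynomial_function (q j)"
    "\<And>j x. (if j = i then lap_heat s x else 0) - hess_heat j i s x = q j x * gauss (1 / (4 * s)) x"
proof -
  obtain p where p: "real_polynomial_function p" "lap_heat s = (\<lambda>x. p x * gauss (1 / (4 * s)) x)"
    using lap_heat_poly [OF assms] by blast
  have "\<exists>h. real_polynomial_function h \<and> (\<forall>x. hess_heat j i s x = h x * gauss (1 / (4 * s)) x)" for j
  proof -
    obtain h where "real_polynomial_function h" "\<And>x. hess_heat j i s x = h x * gauss (1 / (4 * s)) x"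
      using hess_heat_poly [OF assms, where i = j and j = i] by blast
    then show ?thesis by blast
  qed
  then have "\<exists>h. \<forall>j. real_polynomial_function (h j) \<and> (\<forall>x. hess_heat j i s x = h j x * gauss (1 / (4 * s)) x)"
    by (intro choice allI)
  then obtain h where h: "\<And>j. real_polynomial_function (h j)" "\<And>j x. hess_heat j i s x = h j x * gauss (1 / (4 * s)) x"
    by (auto simp only:)
  show ?thesis
  proof (rule that)
    show "real_polynomial_function (\<lambda>x. (if j = i then p x else 0) - h j x)" for j
      using p(1) h(1) by (cases "j = i") (auto intro: real_polynomial_function_diff real_polynomial_function.intros(2) simp: real_polynomial_function_minus)
    show "(if j = i then lap_heat s x else 0) - hess_heat j i s x = ((if j = i then p x else 0) - h j x) * gauss (1 / (4 * s)) x" for j x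
      using h(2) p(2) by (simp add: left_diff_distrib)
  qed
qed

lemma test_field_in_test_fields:
  assumes s: "0 < s"
  shows "test_field y s i \<in> test_fields"
proof -
  have c: "0 < 1 / (4 * s)" using s by simp
  obtain p where p: "real_polynomial_function p" "lap_heat s = (\<lambda>x. p x * gauss (1 / (4 * s)) x)"
    using lap_heat_poly [OF s] by blast
  have "test_field y s i = (\<lambda>x. \<Sum>j\<in>UNIV. (p (x - y) * gauss (1 / (4 * s)) (x - y)) *\<^sub>R (if j = i then axis i 1 else 0))"
    by (intro ext) (simp add: test_field_def p(2) if_distrib [of "\<lambda>z. _ *\<^sub>R z"] cong: if_cong)
  also have "\<dots> \<in> schwartz" by (rule schwartz_poly_gauss [OF p(1) c])
  finally have 1: "test_field y s i \<in> schwartz" .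
  obtain q where q: "\<And>j. real_polynomial_function (q j)"
    "\<And>j x. (if j = i then lap_heat s x else 0) - hess_heat j i s x = q j x * gauss (1 / (4 * s)) x"
    using leray_test_field_form [OF s, where i = i] by blast
  have "leray_test_field y s i = (\<lambda>x. \<Sum>j\<in>UNIV. (q j (x - y) * gauss (1 / (4 * s)) (x - y)) *\<^sub>R axis j 1)"
    unfolding leray_test_field_def [abs_def] q(2) ..
  also have "\<dots> \<in> schwartz" by (rule schwartz_poly_gauss [OF q(1) c])
  finally have 2: "leray (test_field y s i) \<in> schwartz" unfolding leray_test_field [OF s] .
  have "integrable lborel (\<lambda>x. riesz_lap_heat i s (x - y))"
    using lborel_integrable_translate [OF riesz_lap_heat_integrable [OF s], of i "- y"] by simp
  then have 3: "integrable lborel (riesz_sum (test_field y s i))"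
    unfolding riesz_sum_test_field [OF s, abs_def] by (intro integrable_mult_right integrable_of_real)
  from 1 2 3 show ?thesis by (simp add: test_fields_def)
qed

lemma partial_leray_test_field:
  assumes s: "0 < s"
  shows "integrable lborel (partial k (\<lambda>x. leray_test_field y s i x $ j))"
    and "\<exists>B. \<forall>x. norm (partial k (\<lambda>x. leray_test_field y s i x $ j) x) \<le> B"
proof -
  have c: "0 < 1 / (4 * s)" using s by simp
  obtain q where q: "\<And>j. real_polynomial_function (q j)"
    "\<And>j x. (if j = i then lap_heat s x else 0) - hess_heat j i s x = q j x * gauss (1 / (4 * s)) x"
    using leray_test_field_form [OF s, where i = i] by blast
  define e where "e l = (if l = j then 1 else 0 :: complex)" for l
  have "(\<lambda>x. leray_test_field y s i x $ j) = (\<lambda>x. \<Sum>l\<in>UNIV. (q l (x - y) * gauss (1 / (4 * s)) (x - y)) *\<^sub>R e l)"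
    unfolding leray_test_field_nth q(2)
    by (intro ext) (simp add: e_def of_real_def if_distrib [of "\<lambda>z. _ *\<^sub>R z"] cong: if_cong)
  moreover obtain q' where q': "\<And>j. real_polynomial_function (q' j)"
    "partial k (\<lambda>x. \<Sum>l\<in>UNIV. (q l (x - y) * gauss (1 / (4 * s)) (x - y)) *\<^sub>R e l)
      = (\<lambda>x. \<Sum>l\<in>UNIV. (q' l (x - y) * gauss (1 / (4 * s)) (x - y)) *\<^sub>R e l)"
    using partial_poly_gauss(2) [where q = q and k = k and y = y and c = "1 / (4 * s)" and e = e, OF q(1)] by blast
  ultimately have "partial k (\<lambda>x. leray_test_field y s i x $ j) \<in> schwartz"
    using schwartz_poly_gauss [OF q'(1) c, where y = y and e = e] by simp
  then show "integrable lborel (partial k (\<lambda>x. leray_test_field y s i x $ j))"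
    "\<exists>B. \<forall>x. norm (partial k (\<lambda>x. leray_test_field y s i x $ j) x) \<le> B"
    by (rule schwartz_bounded_integrable)+
qed

text \<open>The semigroup moves the test fields along their parameter \<open>s\<close>, so in a Duhamel integral the
  time variable appears only as \<open>t + s - \<tau>\<close>.\<close>
lemma heat_test_field:
  assumes r: "0 < r" and s: "0 < s"
  shows "heat r (test_field y s i) = test_field y (r + s) i"
proof
  fix x
  have "heat r (test_field y s i) x = (LINT z|lborel. (heat_kernel r (x - z) * lap_heat s (z - y)) *\<^sub>R axis i 1)"
    using r by (simp add: heat_def test_field_def)
  also have "\<dots> = (LINT z|lborel. heat_kernel r (x - z) * lap_heat s (z - y)) *\<^sub>R axis i 1"
    by (rule integral_scaleR_left) (rule heat_kernel_lap_heat_conv [OF r s])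
  finally show "heat r (test_field y s i) x = test_field y (r + s) i x"
    by (simp add: heat_kernel_lap_heat_conv [OF r s] test_field_def)
qed

lemma heat_dist_leray_dist_test_field:
  assumes "0 < r" "0 < s"
  shows "heat_dist r (leray_dist T) (test_field y s i) = act T (leray_test_field y (r + s) i)"
  using assms by (simp add: heat_dist_def leray_dist_def heat_test_field leray_test_field)

section \<open>The heat semigroup on weak \<open>L\<^sup>3\<close>\<close>

text \<open>Scalar weak \<open>L\<^sup>3\<close> functions; components of \<^term>\<open>weak_L 3\<close> fields.\<close>
definition weak_fun :: "(real^3 \<Rightarrow> real) set" where
  "weak_fun = {f \<in> borel_measurable lborel. weak_norm 3 f < \<infinity>}"

lemma weak_funD [measurable_dest]: "f \<in> weak_fun \<Longrightarrow> f \<in> borel_measurable lborel"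
  by (simp add: weak_fun_def)

lemma weak_fun_norm: "f \<in> weak_fun \<Longrightarrow> weak_norm 3 f < \<infinity>"
  by (simp add: weak_fun_def)

lemma weak_L_component: "v \<in> weak_L 3 \<Longrightarrow> (\<lambda>x. v x $ i) \<in> weak_fun"
  using weak_LD(3,4) by (simp add: weak_fun_def)

lemma weak_fun_add: "f \<in> weak_fun \<Longrightarrow> g \<in> weak_fun \<Longrightarrow> (\<lambda>x. f x + g x) \<in> weak_fun"
  using weak_norm_add_le [of f g] by (auto simp: weak_fun_def intro: le_less_trans)

lemma weak_fun_diff: "f \<in> weak_fun \<Longrightarrow> g \<in> weak_fun \<Longrightarrow> (\<lambda>x. f x - g x) \<in> weak_fun"
  using weak_fun_add [of f "\<lambda>x. - g x"] by (simp add: weak_fun_def)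

lemma emeasure_lborel_translate:
  fixes E :: "(real^3) set"
  assumes "E \<in> sets borel"
  shows "emeasure lborel {x. x + z \<in> E} = emeasure lborel E"
proof -
  have "emeasure lborel E = emeasure (distr lborel borel ((+) z)) E" by (simp add: lborel_distr_plus)
  also have "\<dots> = emeasure lborel ((+) z -` E)" using assms by (subst emeasure_distr) auto
  also have "(+) z -` E = {x. x + z \<in> E}" by (auto simp: add.commute)
  finally show ?thesis by simp
qed

text \<open>Young's inequality: by translation invariance every translate of \<open>f\<close> has the same weak norm, and
  a convolution is an average of translates.\<close>
lemma weak_norm_convolution_le:
  assumes k [measurable]: "k \<in> borel_measurable lborel" and f [measurable]: "f \<in> borel_measurable lborel"
  shows "weak_norm 3 (\<lambda>x. LINT y|lborel. k (x - y) * f y) \<le> (\<integral>\<^sup>+z. ennreal \<bar>k z\<bar> \<partial>lborel) * weak_norm 3 f"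
proof (rule weak_norm_le)
  fix E :: "(real^3) set" assume E [measurable]: "E \<in> sets borel" and fin: "emeasure lborel E < \<infinity>"
  let ?m = "ennreal (measure lborel E powr (2/3))"
  have inner: "(\<integral>\<^sup>+x. ennreal \<bar>f (x - z)\<bar> * indicator E x \<partial>lborel) \<le> ?m * weak_norm 3 f" for z
  proof -
    define E' where "E' = {x. x + z \<in> E}"
    have E' [measurable]: "E' \<in> sets borel" unfolding E'_def by measurable
    have em: "emeasure lborel E' = emeasure lborel E"
      unfolding E'_def by (rule emeasure_lborel_translate [OF E])
    have "(\<integral>\<^sup>+x. ennreal \<bar>f (x - z)\<bar> * indicator E x \<partial>lborel) = (\<integral>\<^sup>+x. ennreal \<bar>f (x + z - z)\<bar> * indicator E (x + z) \<partial>lborel)"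
      by (rule lborel_nn_integral_translate [symmetric]) measurable
    also have "\<dots> = (\<integral>\<^sup>+x\<in>E'. ennreal \<bar>f x\<bar> \<partial>lborel)"
      by (intro nn_integral_cong) (auto simp: E'_def indicator_def)
    also have "\<dots> \<le> ennreal (measure lborel E' powr (2/3)) * weak_norm 3 f"
      using fin by (intro set_integral_le_weak_norm E') (simp add: em)
    finally show ?thesis by (simp add: measure_def em)
  qed
  have "(\<integral>\<^sup>+x\<in>E. ennreal \<bar>LINT y|lborel. k (x - y) * f y\<bar> \<partial>lborel)
      \<le> (\<integral>\<^sup>+x. (\<integral>\<^sup>+z. ennreal \<bar>k z\<bar> * (ennreal \<bar>f (x - z)\<bar> * indicator E x) \<partial>lborel) \<partial>lborel)"
  proof (rule nn_integral_mono)
    fix x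
    have "ennreal \<bar>LINT y|lborel. k (x - y) * f y\<bar> \<le> (\<integral>\<^sup>+y. ennreal \<bar>k (x - y) * f y\<bar> \<partial>lborel)"
    proof (cases "integrable lborel (\<lambda>y. k (x - y) * f y)")
      case True
      then show ?thesis using integral_norm_bound_ennreal [OF True] by simp
    qed (simp add: not_integrable_integral_eq)
    also have "\<dots> = (\<integral>\<^sup>+z. ennreal \<bar>k (x - (x - z)) * f (x - z)\<bar> \<partial>lborel)"
      by (rule lborel_nn_integral_reflect [symmetric]) measurable
    also have "\<dots> = (\<integral>\<^sup>+z. ennreal \<bar>k z\<bar> * ennreal \<bar>f (x - z)\<bar> \<partial>lborel)"
      by (simp add: abs_mult ennreal_mult)
    finally have "ennreal \<bar>LINT y|lborel. k (x - y) * f y\<bar> * indicator E x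
        \<le> (\<integral>\<^sup>+z. ennreal \<bar>k z\<bar> * ennreal \<bar>f (x - z)\<bar> \<partial>lborel) * indicator E x"
      by (rule mult_right_mono) simp
    also have "\<dots> = (\<integral>\<^sup>+z. ennreal \<bar>k z\<bar> * (ennreal \<bar>f (x - z)\<bar> * indicator E x) \<partial>lborel)"
      by (subst nn_integral_multc [symmetric]) (auto simp: mult.assoc)
    finally show "ennreal \<bar>LINT y|lborel. k (x - y) * f y\<bar> * indicator E x
        \<le> (\<integral>\<^sup>+z. ennreal \<bar>k z\<bar> * (ennreal \<bar>f (x - z)\<bar> * indicator E x) \<partial>lborel)" .
  qed
  also have "\<dots> = (\<integral>\<^sup>+z. (\<integral>\<^sup>+x. ennreal \<bar>k z\<bar> * (ennreal \<bar>f (x - z)\<bar> * indicator E x) \<partial>lborel) \<partial>lborel)"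
    by (rule lborel_pair.Fubini') measurable
  also have "\<dots> = (\<integral>\<^sup>+z. ennreal \<bar>k z\<bar> * (\<integral>\<^sup>+x. ennreal \<bar>f (x - z)\<bar> * indicator E x \<partial>lborel) \<partial>lborel)"
    by (intro nn_integral_cong nn_integral_cmult) measurable
  also have "\<dots> \<le> (\<integral>\<^sup>+z. ennreal \<bar>k z\<bar> * (?m * weak_norm 3 f) \<partial>lborel)"
    by (intro nn_integral_mono mult_left_mono inner) simp
  also have "\<dots> = ?m * ((\<integral>\<^sup>+z. ennreal \<bar>k z\<bar> \<partial>lborel) * weak_norm 3 f)"
    by (subst nn_integral_multc) (auto simp: mult_ac)
  finally show "(\<integral>\<^sup>+x\<in>E. ennreal \<bar>LINT y|lborel. k (x - y) * f y\<bar> \<partial>lborel)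
      \<le> ?m * ((\<integral>\<^sup>+z. ennreal \<bar>k z\<bar> \<partial>lborel) * weak_norm 3 f)" .
qed

lemma heat_kernel_mult_integrable:
  assumes t: "0 < t" and f: "f \<in> weak_fun"
  shows "integrable lborel (\<lambda>y. heat_kernel t (x - y) * f y)"
proof -
  have "integrable lborel (\<lambda>y. f y *\<^sub>R heat_kernel t (x - y))"
    by (rule weak_integrable_mult [where K = "1 / sqrt (4 * pi * t) ^ 3"])
       (use f t heat_kernel_le [OF t] in \<open>auto simp: weak_fun_def intro!: lborel_integrable_reflect heat_kernel_integrable\<close>)
  then show ?thesis by (simp add: mult.commute)
qed

lemma heat_real: "0 < t \<Longrightarrow> heat t f x = (LINT y|lborel. heat_kernel t (x - y) * f y)" for f :: "real^3 \<Rightarrow> real"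
  by (simp add: heat_def)

lemma heat_measurable:
  fixes f :: "real^3 \<Rightarrow> real"
  assumes t: "0 < t" and f [measurable]: "f \<in> borel_measurable lborel"
  shows "heat t f \<in> borel_measurable lborel"
proof -
  have "(\<lambda>x. LINT y|lborel. heat_kernel t (x - y) * f y) \<in> borel_measurable lborel"
    by (rule sigma_finite_measure.borel_measurable_lebesgue_integral) (auto simp: sigma_finite_lborel)
  then show ?thesis using t by (simp add: heat_def [abs_def])
qed

lemma weak_norm_heat_le:
  assumes t: "0 < t" and f: "f \<in> borel_measurable lborel"
  shows "weak_norm 3 (heat t f) \<le> weak_norm 3 f"
proof -
  have "weak_norm 3 (\<lambda>x. LINT y|lborel. heat_kernel t (x - y) * f y)
      \<le> (\<integral>\<^sup>+z. ennreal \<bar>heat_kernel t z\<bar> \<partial>lborel) * weak_norm 3 f"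
    by (rule weak_norm_convolution_le) (use f in auto)
  then show ?thesis using t by (simp add: heat_def [abs_def] nn_integral_heat_kernel)
qed

lemma heat_weak_fun: "0 < t \<Longrightarrow> f \<in> weak_fun \<Longrightarrow> heat t f \<in> weak_fun"
  using heat_measurable [of t f] weak_norm_heat_le [of t f] by (auto simp: weak_fun_def intro: le_less_trans)

lemma heat_diff:
  assumes "0 < t" "f \<in> weak_fun" "g \<in> weak_fun"
  shows "heat t (\<lambda>x. f x - g x) x = heat t f x - heat t g x"
  using assms heat_kernel_mult_integrable [OF assms(1,2)] heat_kernel_mult_integrable [OF assms(1,3)]
  by (simp add: heat_real right_diff_distrib)

lemma heat_add:
  assumes "0 < t" "f \<in> weak_fun" "g \<in> weak_fun"
  shows "heat t (\<lambda>x. f x + g x) x = heat t f x + heat t g x"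
  using assms heat_kernel_mult_integrable [OF assms(1,2)] heat_kernel_mult_integrable [OF assms(1,3)]
  by (simp add: heat_real distrib_left)

text \<open>Split \<open>f\<close> at height \<open>l\<close>; the kernel has mass \<open>1\<close> and maximum \<open>(4 \<pi> t)\<^bsup>-3/2\<^esup>\<close>.\<close>
lemma heat_abs_le:
  assumes t: "0 < t" and f: "f \<in> weak_fun" and A: "weak_norm 3 f \<le> ennreal A" "0 \<le> A" and l: "0 < l"
  shows "\<bar>heat t f x\<bar> \<le> l + A ^ 3 / (sqrt (4 * pi * t) ^ 3 * l\<^sup>2)"
proof -
  note [measurable] = weak_funD [OF f]
  define K where "K = 1 / sqrt (4 * pi * t) ^ 3"
  have "K \<ge> 0" using t by (simp add: K_def)
  have int1: "(\<integral>\<^sup>+y. ennreal \<bar>heat_kernel t (x - y)\<bar> \<partial>lborel) = 1"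
    using lborel_nn_integral_reflect [of "\<lambda>y. ennreal (heat_kernel t y)" x] nn_integral_heat_kernel [OF t] by simp
  have "ennreal \<bar>heat t f x\<bar> \<le> (\<integral>\<^sup>+y. ennreal (norm (heat_kernel t (x - y) * f y)) \<partial>lborel)"
    using integral_norm_bound_ennreal [OF heat_kernel_mult_integrable [OF t f, of x]] by (simp add: heat_real t)
  also have "\<dots> = (\<integral>\<^sup>+y. ennreal \<bar>f y * heat_kernel t (x - y)\<bar> \<partial>lborel)"
    by (simp add: mult.commute)
  also have "\<dots> \<le> ennreal l * (\<integral>\<^sup>+y. ennreal \<bar>heat_kernel t (x - y)\<bar> \<partial>lborel) + ennreal (K * A ^ 3 / l\<^sup>2)"
    by (rule nn_integral_weak_mult_le) (use A l heat_kernel_le [OF t] in \<open>auto simp: K_def\<close>)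
  also have "\<dots> = ennreal (l + K * A ^ 3 / l\<^sup>2)"
    unfolding int1 using l A \<open>K \<ge> 0\<close> by simp
  finally have "\<bar>heat t f x\<bar> \<le> l + K * A ^ 3 / l\<^sup>2"
    using l A \<open>K \<ge> 0\<close> by (subst (asm) ennreal_le_iff) auto
  then show ?thesis by (simp add: K_def field_simps)
qed

text \<open>Take \<open>l = e / 2\<close> and then \<open>t\<close> large.  The threshold depends on \<open>f\<close> only through its norm, so
  bounded sequences in weak \<open>L\<^sup>3\<close> decay uniformly.\<close>
lemma heat_tendsto_0_uniform:
  assumes e: "0 < e" and A: "0 \<le> A"
  obtains T where "0 < T" "\<And>t f x. T \<le> t \<Longrightarrow> f \<in> weak_fun \<Longrightarrow> weak_norm 3 f \<le> ennreal A \<Longrightarrow> \<bar>heat t f x\<bar> \<le> e"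
proof -
  define l where "l = e / 2"
  have l: "l > 0" using e by (simp add: l_def)
  define c where "c = A ^ 3 / l ^ 3"
  have "c \<ge> 0" using A l by (simp add: c_def)
  \<comment> \<open>large enough for \<open>c \<le> sqrt (4 * pi * t) ^ 3\<close> when \<open>t \<ge> T\<close>\<close>
  define T where "T = (1 + c)\<^sup>2"
  have T: "T > 0" using \<open>c \<ge> 0\<close> by (simp add: T_def)
  show ?thesis
  proof (rule that [OF T])
    fix t f x assume t: "T \<le> t" and f: "f \<in> weak_fun" "weak_norm 3 f \<le> ennreal A"
    have t0: "0 < t" using T t by simp
    have "T \<le> 4 * pi * t"
    proof -
      have "1 * t \<le> (4 * pi) * t" using pi_gt3 t0 by (intro mult_right_mono) auto
      then show ?thesis using t by simp
    qed
    then have "sqrt T \<le> sqrt (4 * pi * t)" by simp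
    then have s: "1 + c \<le> sqrt (4 * pi * t)" using \<open>c \<ge> 0\<close> by (simp add: T_def)
    then have s1: "1 \<le> sqrt (4 * pi * t)" using \<open>c \<ge> 0\<close> by linarith
    have "c \<le> sqrt (4 * pi * t) ^ 3"
      using s s1 self_le_power [OF s1, of 3] by simp
    then have "A ^ 3 \<le> sqrt (4 * pi * t) ^ 3 * l ^ 3"
      using l by (simp add: c_def divide_le_eq)
    then have "A ^ 3 / (sqrt (4 * pi * t) ^ 3 * l\<^sup>2) \<le> l"
      using l t0 by (simp add: divide_le_eq power2_eq_square power3_eq_cube mult_ac)
    then show "\<bar>heat t f x\<bar> \<le> e"
      using heat_abs_le [OF t0 f(1) f(2) A l, of x] l_def by linarith
  qed
qed

lemma heat_semigroup:
  assumes s: "0 < s" and r: "0 < r" and f: "f \<in> weak_fun"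
  shows "heat s (heat r f) x = heat (s + r) f x"
proof -
  note [measurable] = weak_funD [OF f]
  define F where "F z y = heat_kernel s (x - z) * heat_kernel r (z - y) * f y" for z y
  have int: "integrable (lborel \<Otimes>\<^sub>M lborel) (\<lambda>(z, y). F z y)"
  proof -
    have "(\<integral>\<^sup>+p. ennreal (norm (F (fst p) (snd p))) \<partial>(lborel \<Otimes>\<^sub>M lborel)) = (\<integral>\<^sup>+y. \<integral>\<^sup>+z. ennreal (norm (F z y)) \<partial>lborel \<partial>lborel)"
      unfolding F_def by (subst lborel_pair.nn_integral_snd [symmetric]) auto
    also have "\<dots> = (\<integral>\<^sup>+y. ennreal (norm (heat_kernel (s + r) (x - y) * f y)) \<partial>lborel)"
    proof (rule nn_integral_cong)
      fix y
      have "(\<integral>\<^sup>+z. ennreal (norm (F z y)) \<partial>lborel)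
          = (\<integral>\<^sup>+z. ennreal (heat_kernel s (x - z) * heat_kernel r (z - y)) * ennreal \<bar>f y\<bar> \<partial>lborel)"
        by (simp add: F_def abs_mult ennreal_mult)
      also have "\<dots> = (\<integral>\<^sup>+z. ennreal (heat_kernel s (x - z) * heat_kernel r (z - y)) \<partial>lborel) * ennreal \<bar>f y\<bar>"
        by (rule nn_integral_multc) measurable
      also have "(\<integral>\<^sup>+z. ennreal (heat_kernel s (x - z) * heat_kernel r (z - y)) \<partial>lborel) = ennreal (heat_kernel (s + r) (x - y))"
        using heat_kernel_semigroup [OF s r, of x y] by (simp add: nn_integral_eq_integral)
      finally show "(\<integral>\<^sup>+z. ennreal (norm (F z y)) \<partial>lborel) = ennreal (norm (heat_kernel (s + r) (x - y) * f y))"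
        by (simp add: abs_mult ennreal_mult)
    qed
    also have "\<dots> < \<infinity>"
      using heat_kernel_mult_integrable [of "s + r" f x] s r f by (simp add: integrable_iff_bounded)
    finally show ?thesis unfolding F_def by (simp add: integrable_iff_bounded case_prod_beta)
  qed
  have "heat s (heat r f) x = (LINT z|lborel. LINT y|lborel. F z y)"
    by (simp add: heat_real s r F_def mult.assoc)
  also have "\<dots> = (LINT y|lborel. LINT z|lborel. F z y)"
    by (rule lborel_pair.Fubini_integral [symmetric, OF int])
  also have "\<dots> = (LINT y|lborel. heat_kernel (s + r) (x - y) * f y)"
    unfolding F_def using heat_kernel_semigroup [OF s r] by simp
  finally show ?thesis using s r by (simp add: heat_real)
qed

section \<open>A weak \<open>L\<^sup>3\<close> function is determined by its heat extension\<close>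

lemma box_frontier_null: "AE x in lborel. x \<in> box a b \<or> x \<notin> cbox a b" for a b :: "real^3"
proof -
  have "cbox a b - box a b \<in> null_sets (completion lborel)"
    using negligible_frontier_interval [of a b] by (simp add: negligible_iff_null_sets)
  then have "cbox a b - box a b \<in> null_sets lborel"
    by (subst (asm) null_sets_completion_iff) auto
  then show ?thesis by (auto dest: AE_not_in)
qed

lemma weak_fun_set_integrable:
  assumes f: "f \<in> weak_fun" and E: "E \<in> sets borel" "emeasure lborel E < \<infinity>"
  shows "integrable lborel (\<lambda>x. f x * indicator E x)"
proof -
  have "integrable lborel (\<lambda>x. f x *\<^sub>R (indicator E x :: real))"
    by (rule weak_integrable_mult [where K = 1])
       (use f E in \<open>auto simp: weak_fun_def intro!: integrable_real_indicator split: split_indicator\<close>)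
  then show ?thesis by simp
qed

text \<open>The translated indicators converge off the boundary of the box, which is a null set, and live in
  a common ball, on which \<open>f\<close> is integrable.\<close>
lemma box_integral_continuous:
  fixes a b :: "real^3"
  assumes f: "f \<in> weak_fun"
  defines "g \<equiv> \<lambda>h. LINT x|lborel. f x * indicator (box a b) (x + h)"
  shows "(g \<longlongrightarrow> g 0) (at 0)"
  unfolding tendsto_at_iff_sequentially comp_def
proof (intro allI impI)
  fix X :: "nat \<Rightarrow> real^3" assume X: "X \<longlonglongrightarrow> 0"
  note [measurable] = weak_funD [OF f]
  have "Bseq X" using X by (intro convergent_imp_Bseq convergentI)
  then obtain R where R: "\<And>n. norm (X n) \<le> R" unfolding Bseq_def by auto
  obtain S where S: "box a b \<subseteq> ball 0 S" using bounded_subset_ballD [OF bounded_box [of a b], of 0] by auto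
  show "(\<lambda>n. g (X n)) \<longlonglongrightarrow> g 0"
    unfolding g_def
  proof (rule integral_dominated_convergence [where w = "\<lambda>x. \<bar>f x * indicator (ball 0 (S + R)) x\<bar>"])
    have "integrable lborel (\<lambda>x. f x * indicator (ball 0 (S + R)) x)"
      using f emeasure_lborel_ball_finite by (intro weak_fun_set_integrable) (auto simp: less_top)
    then show "integrable lborel (\<lambda>x. \<bar>f x * indicator (ball 0 (S + R)) x\<bar>)" by (rule integrable_abs)
    show "AE x in lborel. (\<lambda>n. f x * indicator (box a b) (x + X n)) \<longlonglongrightarrow> f x * indicator (box a b) (x + 0)"
      using box_frontier_null [of a b]
    proof eventually_elim
      case (elim x)
      have lim: "(\<lambda>n. x + X n) \<longlonglongrightarrow> x" using tendsto_add [OF tendsto_const X, of x] by simp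
      have "\<forall>\<^sub>F n in sequentially. (indicator (box a b) (x + X n) :: real) = indicator (box a b) x"
      proof (cases "x \<in> box a b")
        case True
        then have "\<forall>\<^sub>F n in sequentially. x + X n \<in> box a b" by (rule topological_tendstoD [OF lim open_box])
        then show ?thesis using True by (auto elim!: eventually_mono)
      next
        case False
        then have "x \<in> - cbox a b" using elim by blast
        then have "\<forall>\<^sub>F n in sequentially. x + X n \<in> - cbox a b"
          by (intro topological_tendstoD [OF lim] open_Compl closed_cbox)
        then show ?thesis
        proof eventually_elim
          case (elim n)
          then have "x + X n \<notin> box a b" using box_subset_cbox [of a b] by blast
          then show ?case using False by simp
        qed
      qed
      then have "(\<lambda>n. indicator (box a b) (x + X n) :: real) \<longlonglongrightarrow> indicator (box a b) x"
        by (rule tendsto_eventually)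
      then show ?case by (intro tendsto_intros) simp
    qed
    show "AE x in lborel. norm (f x * indicator (box a b) (x + X n)) \<le> \<bar>f x * indicator (ball 0 (S + R)) x\<bar>" for n
    proof (rule AE_I2)
      fix x
      have "x \<in> ball 0 (S + R)" if "x + X n \<in> box a b"
      proof -
        have "norm (x + X n) < S" using that S by auto
        moreover have "norm x \<le> norm (x + X n) + norm (X n)" using norm_triangle_ineq4 [of "x + X n" "X n"] by simp
        ultimately show ?thesis using R [of n] by simp
      qed
      then show "norm (f x * indicator (box a b) (x + X n)) \<le> \<bar>f x * indicator (ball 0 (S + R)) x\<bar>"
        by (cases "x + X n \<in> box a b") simp_all
    qed
  qed measurable
qed

text \<open>The positive and the negative part of \<open>f\<close> are densities of measures that agree on boxes, an
  intersection-stable generator of the Borel sets.\<close>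
lemma box_integrals_0_imp_AE_0:
  assumes f: "f \<in> weak_fun" and z: "\<And>a b. (LINT x|lborel. f x * indicator (box a b) x) = 0"
  shows "AE x in lborel. f x = 0"
proof -
  note [measurable] = weak_funD [OF f]
  have box: "(\<integral>\<^sup>+x. ennreal (f x) * indicator (box a b) x \<partial>lborel) = (\<integral>\<^sup>+x. ennreal (- f x) * indicator (box a b) x \<partial>lborel)
      \<and> (\<integral>\<^sup>+x. ennreal (f x) * indicator (box a b) x \<partial>lborel) \<noteq> \<infinity>" for a b
  proof -
    have int: "integrable lborel (\<lambda>x. f x * indicator (box a b) x)"
      using f emeasure_lborel_box_finite [of a b] by (intro weak_fun_set_integrable) auto
    have e: "ennreal (f x) * indicator (box a b) x = ennreal (f x * indicator (box a b) x)"
      "ennreal (- f x) * indicator (box a b) x = ennreal (- (f x * indicator (box a b) x))" for x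
      by (auto simp: indicator_def)
    have fin: "(\<integral>\<^sup>+x. ennreal (f x * indicator (box a b) x) \<partial>lborel) \<noteq> \<infinity>"
        "(\<integral>\<^sup>+x. ennreal (- (f x * indicator (box a b) x)) \<partial>lborel) \<noteq> \<infinity>"
      using int by (auto simp: real_integrable_def)
    have "enn2real (\<integral>\<^sup>+x. ennreal (f x * indicator (box a b) x) \<partial>lborel)
        = enn2real (\<integral>\<^sup>+x. ennreal (- (f x * indicator (box a b) x)) \<partial>lborel)"
      using real_lebesgue_integral_def [OF int] z by simp
    then have "ennreal (enn2real (\<integral>\<^sup>+x. ennreal (f x * indicator (box a b) x) \<partial>lborel))
        = ennreal (enn2real (\<integral>\<^sup>+x. ennreal (- (f x * indicator (box a b) x)) \<partial>lborel))"
      by (rule arg_cong)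
    then show ?thesis unfolding e using fin by (simp only: ennreal_enn2real less_top infinity_ennreal_def)
  qed
  have sets_box: "box a b \<in> sets lborel" for a b :: "real^3" by simp
  have "density lborel (\<lambda>x. ennreal (f x)) = density lborel (\<lambda>x. ennreal (- f x))"
  proof (rule measure_eqI_generator_eq)
    let ?E = "range (\<lambda>(a, b). box a b :: (real^3) set)"
    show "Int_stable ?E" by (auto simp: Int_stable_def box_Int_box)
    show "?E \<subseteq> Pow UNIV" "sets (density lborel (\<lambda>x. ennreal (f x))) = sigma_sets UNIV ?E"
      "sets (density lborel (\<lambda>x. ennreal (- f x))) = sigma_sets UNIV ?E"
      by (simp_all add: borel_eq_box)
    let ?A = "\<lambda>n::nat. box (- (real n *\<^sub>R One)) (real n *\<^sub>R One) :: (real^3) set"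
    show "range ?A \<subseteq> ?E" "(\<Union>i. ?A i) = UNIV" unfolding UN_box_eq_UNIV by auto
    show "emeasure (density lborel (\<lambda>x. ennreal (f x))) (?A i) \<noteq> \<infinity>" for i
      unfolding emeasure_density [OF measurable_compose [OF weak_funD [OF f] measurable_ennreal] sets_box]
      using box [of "- (real i *\<^sub>R One)" "real i *\<^sub>R One"] by blast
    show "emeasure (density lborel (\<lambda>x. ennreal (f x))) X = emeasure (density lborel (\<lambda>x. ennreal (- f x))) X" if "X \<in> ?E" for X
      using that box by (auto simp: emeasure_density)
  qed
  then have "AE x in lborel. ennreal (f x) = ennreal (- f x)"
    by (intro sigma_finite_measure.density_unique [OF sigma_finite_lborel]) auto
  then show ?thesis
  proof eventually_elim
    case (elim x)
    show ?case
    proof (cases "f x \<le> 0")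
      case True
      then have "ennreal (- f x) = 0" using elim by (simp add: ennreal_neg)
      then show ?thesis using True by (simp add: ennreal_eq_0_iff)
    next
      case False
      then have "ennreal (f x) = 0" using elim by (simp add: ennreal_neg)
      then show ?thesis using False by (simp add: ennreal_eq_0_iff)
    qed
  qed
qed

text \<open>The integrals \<open>g h\<close> of \<open>f\<close> over the translates of a box form a bounded function that is
  continuous at \<open>0\<close>.  Its mean with respect to \<open>p\<^sub>s\<close> is the integral of \<open>S(s)f = 0\<close> over the box,
  and as \<open>s \<rightarrow> 0\<close> it tends to \<open>g 0\<close>.\<close>
lemma heat_injective:
  assumes f: "f \<in> weak_fun" and zero: "\<And>s x. 0 < s \<Longrightarrow> heat s f x = 0"
  shows "AE x in lborel. f x = 0"
proof (rule box_integrals_0_imp_AE_0 [OF f])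
  fix a b :: "real^3"
  note [measurable] = weak_funD [OF f]
  define O1 where "O1 = box a b"
  have [measurable]: "O1 \<in> sets borel" by (simp add: O1_def)
  have O1fin: "emeasure lborel O1 < \<infinity>" using emeasure_lborel_box_finite [of a b] by (simp add: O1_def)
  define g where "g h = (LINT x|lborel. f x * indicator O1 (x + h))" for h
  define M where "M = enn2real (ennreal (measure lborel O1 powr (2/3)) * weak_norm 3 f)"
  have Mfin: "ennreal (measure lborel O1 powr (2/3)) * weak_norm 3 f = ennreal M"
    unfolding M_def using weak_fun_norm [OF f] by (intro ennreal_enn2real [symmetric]) (simp add: ennreal_mult_less_top)
  have M0: "M \<ge> 0" by (simp add: M_def)
  have nn: "(\<integral>\<^sup>+x. ennreal \<bar>f x\<bar> * indicator O1 (x + h) \<partial>lborel) \<le> ennreal M" for h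
  proof -
    define E' where "E' = {x. x + h \<in> O1}"
    have E' [measurable]: "E' \<in> sets borel" unfolding E'_def by measurable
    have em: "emeasure lborel E' = emeasure lborel O1"
      unfolding E'_def by (rule emeasure_lborel_translate) simp
    have "(\<integral>\<^sup>+x. ennreal \<bar>f x\<bar> * indicator O1 (x + h) \<partial>lborel) = (\<integral>\<^sup>+x\<in>E'. ennreal \<bar>f x\<bar> \<partial>lborel)"
      by (intro nn_integral_cong) (auto simp: E'_def indicator_def)
    also have "\<dots> \<le> ennreal (measure lborel E' powr (2/3)) * weak_norm 3 f"
      using O1fin by (intro set_integral_le_weak_norm E') (simp add: em)
    also have "\<dots> = ennreal M" using Mfin by (simp add: measure_def em)
    finally show ?thesis .
  qed
  have gM: "\<bar>g h\<bar> \<le> M" for h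
  proof -
    have "ennreal \<bar>g h\<bar> \<le> (\<integral>\<^sup>+x. ennreal \<bar>f x * indicator O1 (x + h)\<bar> \<partial>lborel)"
    proof (cases "integrable lborel (\<lambda>x. f x * indicator O1 (x + h))")
      case True
      then show ?thesis using integral_norm_bound_ennreal [OF True] by (simp add: g_def)
    qed (simp add: not_integrable_integral_eq g_def)
    also have "\<dots> = (\<integral>\<^sup>+x. ennreal \<bar>f x\<bar> * indicator O1 (x + h) \<partial>lborel)"
      by (intro nn_integral_cong) (auto simp: indicator_def)
    also have "\<dots> \<le> ennreal M" by (rule nn)
    finally show ?thesis using M0 by (simp add: ennreal_le_iff)
  qed
  have [measurable]: "g \<in> borel_measurable lborel"
    unfolding g_def by (rule sigma_finite_measure.borel_measurable_lebesgue_integral) (auto simp: sigma_finite_lborel)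
  \<comment> \<open>Fubini turns the mean of \<open>g\<close> into an integral of the heat extension over the box\<close>
  have avg: "(LINT z|lborel. heat_kernel s z * g z) = 0" if s: "0 < s" for s
  proof -
    define F where "F z x = heat_kernel s z * (f x * indicator O1 (x + z))" for z x
    have int: "integrable (lborel \<Otimes>\<^sub>M lborel) (\<lambda>(z, x). F z x)"
    proof -
      have "(\<integral>\<^sup>+p. ennreal (norm (F (fst p) (snd p))) \<partial>(lborel \<Otimes>\<^sub>M lborel)) = (\<integral>\<^sup>+z. \<integral>\<^sup>+x. ennreal (norm (F z x)) \<partial>lborel \<partial>lborel)"
        unfolding F_def by (subst lborel.nn_integral_fst [symmetric]) auto
      also have "\<dots> \<le> (\<integral>\<^sup>+z. ennreal (heat_kernel s z) * ennreal M \<partial>lborel)"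
      proof (rule nn_integral_mono)
        fix z
        have "(\<integral>\<^sup>+x. ennreal (norm (F z x)) \<partial>lborel) = (\<integral>\<^sup>+x. ennreal (heat_kernel s z) * (ennreal \<bar>f x\<bar> * indicator O1 (x + z)) \<partial>lborel)"
          by (intro nn_integral_cong) (auto simp: F_def abs_mult ennreal_mult indicator_def)
        also have "\<dots> = ennreal (heat_kernel s z) * (\<integral>\<^sup>+x. ennreal \<bar>f x\<bar> * indicator O1 (x + z) \<partial>lborel)"
          by (rule nn_integral_cmult) measurable
        also have "\<dots> \<le> ennreal (heat_kernel s z) * ennreal M" by (intro mult_left_mono nn) simp
        finally show "(\<integral>\<^sup>+x. ennreal (norm (F z x)) \<partial>lborel) \<le> ennreal (heat_kernel s z) * ennreal M" .
      qed
      also have "\<dots> < \<infinity>" using s by (subst nn_integral_multc) (auto simp: nn_integral_heat_kernel)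
      finally show ?thesis unfolding F_def by (simp add: integrable_iff_bounded case_prod_beta)
    qed
    have "(LINT z|lborel. heat_kernel s z * g z) = (LINT z|lborel. LINT x|lborel. F z x)"
      by (simp add: g_def F_def)
    also have "\<dots> = (LINT z|lborel. LINT x|lborel. heat_kernel s z * (f (x - z) * indicator O1 x))"
    proof (rule Bochner_Integration.integral_cong [OF refl])
      fix z
      show "(LINT x|lborel. F z x) = (LINT x|lborel. heat_kernel s z * (f (x - z) * indicator O1 x))"
        using lborel_integral_translate [of "\<lambda>x. heat_kernel s z * (f (x - z) * indicator O1 x)" z] by (simp add: F_def)
    qed
    also have "\<dots> = (LINT x|lborel. LINT z|lborel. heat_kernel s z * (f (x - z) * indicator O1 x))"
    proof (rule lborel_pair.Fubini_integral [symmetric])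
      have "(\<integral>\<^sup>+p. ennreal (norm (heat_kernel s (fst p) * (f (snd p - fst p) * indicator O1 (snd p)))) \<partial>(lborel \<Otimes>\<^sub>M lborel))
          = (\<integral>\<^sup>+z. \<integral>\<^sup>+x. ennreal (norm (heat_kernel s z * (f (x - z) * indicator O1 x))) \<partial>lborel \<partial>lborel)"
        by (subst lborel.nn_integral_fst [symmetric]) auto
      also have "\<dots> = (\<integral>\<^sup>+z. \<integral>\<^sup>+x. ennreal (norm (F z x)) \<partial>lborel \<partial>lborel)"
      proof (rule nn_integral_cong)
        fix z
        show "(\<integral>\<^sup>+x. ennreal (norm (heat_kernel s z * (f (x - z) * indicator O1 x))) \<partial>lborel) = (\<integral>\<^sup>+x. ennreal (norm (F z x)) \<partial>lborel)"
          using lborel_nn_integral_translate [of "\<lambda>x. ennreal (norm (heat_kernel s z * (f (x - z) * indicator O1 x)))" z]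
          by (simp add: F_def)
      qed
      also have "\<dots> = (\<integral>\<^sup>+p. ennreal (norm (F (fst p) (snd p))) \<partial>(lborel \<Otimes>\<^sub>M lborel))"
        unfolding F_def by (subst lborel.nn_integral_fst [symmetric]) auto
      also have "\<dots> < \<infinity>" using int by (simp add: integrable_iff_bounded case_prod_beta)
      finally show "integrable (lborel \<Otimes>\<^sub>M lborel) (\<lambda>(z, x). heat_kernel s z * (f (x - z) * indicator O1 x))"
        by (simp add: integrable_iff_bounded case_prod_beta)
    qed
    also have "\<dots> = (LINT x|lborel. indicator O1 x * heat s f x)"
    proof (rule Bochner_Integration.integral_cong [OF refl])
      fix x
      have "(LINT z|lborel. heat_kernel s z * (f (x - z) * indicator O1 x)) = indicator O1 x * (LINT z|lborel. heat_kernel s (x - (x - z)) * f (x - z))"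
        by (subst integral_mult_right_zero [symmetric]) (simp add: mult_ac)
      also have "(LINT z|lborel. heat_kernel s (x - (x - z)) * f (x - z)) = heat s f x"
        using lborel_integral_reflect [of "\<lambda>y. heat_kernel s (x - y) * f y" x] s by (simp add: heat_real)
      finally show "(LINT z|lborel. heat_kernel s z * (f (x - z) * indicator O1 x)) = indicator O1 x * heat s f x" .
    qed
    finally show ?thesis using zero [OF s] by simp
  qed
  have lim: "(g \<longlongrightarrow> g 0) (at 0)" unfolding g_def O1_def by (rule box_integral_continuous [OF f])
  have "\<bar>g 0\<bar> \<le> e" if e: "0 < e" for e
  proof -
    obtain d where d: "d > 0" "\<And>z. norm z < d \<Longrightarrow> \<bar>g z - g 0\<bar> \<le> e / 2"
    proof -
      have "\<forall>\<^sub>F z in at 0. dist (g z) (g 0) < e / 2" using tendstoD [OF lim, of "e / 2"] e by simp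
      then have "\<exists>d>0. \<forall>z\<in>UNIV. z \<noteq> 0 \<and> dist z 0 < d \<longrightarrow> dist (g z) (g 0) < e / 2"
        by (simp only: eventually_at)
      then obtain d where d: "d > 0" "\<forall>z\<in>UNIV. z \<noteq> 0 \<and> dist z 0 < d \<longrightarrow> dist (g z) (g 0) < e / 2" by blast
      have "\<bar>g z - g 0\<bar> \<le> e / 2" if "norm z < d" for z
      proof (cases "z = 0")
        case False
        then have "dist (g z) (g 0) < e / 2" using d(2) that by simp
        then show ?thesis by (simp add: dist_real_def)
      qed (use e in simp)
      with d(1) show ?thesis by (rule that)
    qed
    \<comment> \<open>away from the ball of radius \<open>d\<close> the trivial bound \<open>2 * M\<close> is below \<open>C * (norm z)\<^sup>2\<close>\<close>
    define C where "C = 2 * M / d\<^sup>2"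
    have C: "C \<ge> 0" using M0 by (simp add: C_def)
    have pt: "\<bar>g z - g 0\<bar> \<le> e / 2 + C * (norm z)\<^sup>2" for z
    proof (cases "norm z < d")
      case False
      have "\<bar>g z - g 0\<bar> \<le> 2 * M" using gM [of z] gM [of 0] by linarith
      also have "\<dots> = C * d\<^sup>2" using d(1) by (simp add: C_def)
      also have "\<dots> \<le> C * (norm z)\<^sup>2" using False d(1) C by (intro mult_left_mono power_mono) auto
      finally show ?thesis using e by simp
    next
      case True
      then have "\<bar>g z - g 0\<bar> \<le> e / 2" by (rule d(2))
      moreover have "0 \<le> C * (norm z)\<^sup>2" using C by simp
      ultimately show ?thesis by linarith
    qed
    \<comment> \<open>the second moment of \<open>p\<^sub>s\<close> is \<open>6 * s\<close>, so the quadratic term contributes at most \<open>e / 2\<close>\<close>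
    define s where "s = e / (12 * (C + 1))"
    have s: "s > 0" using e C by (simp add: s_def)
    have int1: "integrable lborel (\<lambda>z. heat_kernel s z * g z)"
    proof (rule Bochner_Integration.integrable_bound [of _ "\<lambda>z. M * heat_kernel s z"])
      show "integrable lborel (\<lambda>z. M * heat_kernel s z)" by (intro integrable_mult_right heat_kernel_integrable s)
      show "AE z in lborel. norm (heat_kernel s z * g z) \<le> norm (M * heat_kernel s z)"
      proof (rule AE_I2)
        fix z
        have "\<bar>g z\<bar> * heat_kernel s z \<le> M * heat_kernel s z" by (intro mult_right_mono gM) simp
        then show "norm (heat_kernel s z * g z) \<le> norm (M * heat_kernel s z)"
          using M0 by (simp add: abs_mult mult.commute)
      qed
    qed measurable
    have "(LINT z|lborel. heat_kernel s z * g z - heat_kernel s z * g 0)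
        = (LINT z|lborel. heat_kernel s z * g z) - (LINT z|lborel. heat_kernel s z * g 0)"
      by (intro Bochner_Integration.integral_diff int1 integrable_mult_left heat_kernel_integrable s)
    then have "g 0 = - (LINT z|lborel. heat_kernel s z * g z - heat_kernel s z * g 0)"
      unfolding avg [OF s] by (simp add: integral_heat_kernel [OF s])
    then have "\<bar>g 0\<bar> = norm (LINT z|lborel. heat_kernel s z * g z - heat_kernel s z * g 0)" by simp
    also have "\<dots> \<le> (LINT z|lborel. e / 2 * heat_kernel s z + C * ((norm z)\<^sup>2 * heat_kernel s z))"
    proof (rule Bochner_Integration.integral_norm_bound_integral)
      show "integrable lborel (\<lambda>z. e / 2 * heat_kernel s z + C * ((norm z)\<^sup>2 * heat_kernel s z))"
        by (intro Bochner_Integration.integrable_add integrable_mult_right heat_kernel_integrable heat_kernel_moments s)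
      show "integrable lborel (\<lambda>z. heat_kernel s z * g z - heat_kernel s z * g 0)"
        by (intro Bochner_Integration.integrable_diff int1 integrable_mult_left heat_kernel_integrable s)
      fix z
      have "\<bar>heat_kernel s z * g z - heat_kernel s z * g 0\<bar> = heat_kernel s z * \<bar>g z - g 0\<bar>"
        by (simp only: right_diff_distrib [symmetric] abs_mult abs_of_nonneg [OF heat_kernel_nonneg])
      also have "\<dots> \<le> heat_kernel s z * (e / 2 + C * (norm z)\<^sup>2)" by (intro mult_left_mono pt) simp
      finally show "norm (heat_kernel s z * g z - heat_kernel s z * g 0) \<le> e / 2 * heat_kernel s z + C * ((norm z)\<^sup>2 * heat_kernel s z)"
        by (simp add: algebra_simps)
    qed
    also have "\<dots> = e / 2 + C * (6 * s)"
      using heat_kernel_integrable [OF s] heat_kernel_moments(3,4) [OF s] integral_heat_kernel [OF s] by simp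
    also have "\<dots> \<le> e"
    proof -
      have "C * (6 * s) = (C / (C + 1)) * (e / 2)" using C by (simp add: s_def divide_simps)
      also have "\<dots> \<le> 1 * (e / 2)" using C e by (intro mult_right_mono) auto
      finally show ?thesis by simp
    qed
    finally show ?thesis .
  qed
  then have "\<bar>g 0\<bar> \<le> 0" by (rule field_le_epsilon) simp
  then show "(LINT x|lborel. f x * indicator (box a b) x) = 0" by (simp add: g_def O1_def)
qed

section \<open>Pairings with the test fields\<close>

definition lap_pairing :: "(real^3 \<Rightarrow> real) \<Rightarrow> real \<Rightarrow> real^3 \<Rightarrow> real" where
  "lap_pairing f s y = (LINT x|lborel. f x * lap_heat s (x - y))"

text \<open>A common bound for the pairings at all \<open>s \<ge> a\<close>, obtained by splitting \<open>f\<close> at height \<open>1\<close>: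
  \<open>12 / a\<close> bounds the \<open>L\<^sup>1\<close> norm of \<open>\<Delta>p\<^sub>s\<close>, and \<open>12 / a\<close> times the maximum of \<open>p\<^bsub>2a\<^esub>\<close>
  bounds \<open>|\<Delta>p\<^sub>s|\<close> itself.\<close>
definition lap_pairing_bound :: "real \<Rightarrow> real \<Rightarrow> real" where
  "lap_pairing_bound A a = 12 / a + 12 / a * (1 / sqrt (4 * pi * (2 * a)) ^ 3) * A ^ 3"

lemma nn_integral_lap_heat_le:
  assumes s: "0 < s"
  shows "(\<integral>\<^sup>+x. ennreal \<bar>lap_heat s (x - y)\<bar> \<partial>lborel) \<le> ennreal (12 / s)"
proof -
  have "(\<integral>\<^sup>+x. ennreal \<bar>lap_heat s (x - y)\<bar> \<partial>lborel) = (\<integral>\<^sup>+x. ennreal \<bar>lap_heat s x\<bar> \<partial>lborel)"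
    using lborel_nn_integral_translate [of "\<lambda>x. ennreal \<bar>lap_heat s x\<bar>" "- y"] by simp
  also have "\<dots> \<le> (\<integral>\<^sup>+x. ennreal (12 / s) * ennreal (heat_kernel (2 * s) x) \<partial>lborel)"
    using s lap_heat_le [OF s] by (intro nn_integral_mono) (simp add: ennreal_mult [symmetric] ennreal_leI)
  also have "\<dots> = ennreal (12 / s)"
    using s by (subst nn_integral_cmult) (auto simp: nn_integral_heat_kernel)
  finally show ?thesis .
qed

lemma lap_pairing_nn_bound:
  assumes f: "f \<in> weak_fun" and A: "weak_norm 3 f \<le> ennreal A" "0 \<le> A" and a: "0 < a" "a \<le> s"
  shows "(\<integral>\<^sup>+x. ennreal \<bar>f x * lap_heat s (x - y)\<bar> \<partial>lborel) \<le> ennreal (lap_pairing_bound A a)"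
proof -
  note [measurable] = weak_funD [OF f]
  have s: "0 < s" using a by simp
  define K where "K = 12 / a * (1 / sqrt (4 * pi * (2 * a)) ^ 3)"
  have "K \<ge> 0" using a by (simp add: K_def)
  have K: "\<bar>lap_heat s (x - y)\<bar> \<le> K" for x
  proof -
    have "\<bar>lap_heat s (x - y)\<bar> \<le> 12 / s * (1 / sqrt (4 * pi * (2 * s)) ^ 3)" by (rule lap_heat_bounded [OF s])
    also have "\<dots> \<le> K"
      unfolding K_def using a s
      by (intro mult_mono divide_left_mono power_mono mult_pos_pos zero_less_power) auto
    finally show ?thesis .
  qed
  have "(\<integral>\<^sup>+x. ennreal \<bar>f x * lap_heat s (x - y)\<bar> \<partial>lborel)
      \<le> ennreal 1 * (\<integral>\<^sup>+x. ennreal \<bar>lap_heat s (x - y)\<bar> \<partial>lborel) + ennreal (K * A ^ 3 / 1\<^sup>2)"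
    by (rule nn_integral_weak_mult_le) (use A K in auto)
  also have "\<dots> \<le> ennreal 1 * ennreal (12 / a) + ennreal (K * A ^ 3 / 1\<^sup>2)"
  proof (intro add_right_mono mult_left_mono order_trans [OF nn_integral_lap_heat_le [OF s]] ennreal_leI)
    show "12 / s \<le> 12 / a" using a by (intro divide_left_mono) auto
  qed simp
  also have "\<dots> = ennreal (12 / a + K * A ^ 3)"
    using a A \<open>K \<ge> 0\<close> by (subst ennreal_plus) auto
  finally show ?thesis by (simp add: K_def lap_pairing_bound_def)
qed

lemma lap_pairing_integrable:
  assumes f: "f \<in> weak_fun" and s: "0 < s"
  shows "integrable lborel (\<lambda>x. f x * lap_heat s (x - y))"
proof -
  note [measurable] = weak_funD [OF f]
  obtain A where A: "A \<ge> 0" "weak_norm 3 f \<le> ennreal A" using weak_norm_realE [OF weak_fun_norm [OF f]] .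
  show ?thesis
    using lap_pairing_nn_bound [OF f A(2,1) s order_refl, of y]
    by (simp add: integrable_iff_bounded) (meson ennreal_less_top le_less_trans)
qed

lemma lap_pairing_le:
  assumes f: "f \<in> weak_fun" and A: "weak_norm 3 f \<le> ennreal A" "0 \<le> A" and a: "0 < a" "a \<le> s"
  shows "\<bar>lap_pairing f s y\<bar> \<le> lap_pairing_bound A a"
proof -
  have s: "0 < s" using a by simp
  have "ennreal \<bar>lap_pairing f s y\<bar> \<le> (\<integral>\<^sup>+x. ennreal \<bar>f x * lap_heat s (x - y)\<bar> \<partial>lborel)"
    using integral_norm_bound_ennreal [OF lap_pairing_integrable [OF f s, of y]] by (simp add: lap_pairing_def)
  also have "\<dots> \<le> ennreal (lap_pairing_bound A a)" by (rule lap_pairing_nn_bound [OF assms])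
  finally show ?thesis
    by (subst (asm) ennreal_le_iff) (use A a in \<open>auto simp: lap_pairing_bound_def\<close>)
qed

lemma lap_pairing_measurable:
  assumes f: "f \<in> weak_fun"
  shows "(\<lambda>s. lap_pairing f s y) \<in> borel_measurable lborel"
proof -
  note [measurable] = weak_funD [OF f]
  show ?thesis unfolding lap_pairing_def
    by (rule sigma_finite_measure.borel_measurable_lebesgue_integral) (auto simp: sigma_finite_lborel)
qed

lemma lap_pairing_diff:
  assumes "f \<in> weak_fun" "g \<in> weak_fun" "0 < s"
  shows "lap_pairing (\<lambda>x. f x - g x) s y = lap_pairing f s y - lap_pairing g s y"
  using lap_pairing_integrable [OF assms(1,3), of y] lap_pairing_integrable [OF assms(2,3), of y]
  by (simp add: lap_pairing_def left_diff_distrib)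

lemma lap_pairing_add:
  assumes "f \<in> weak_fun" "g \<in> weak_fun" "0 < s"
  shows "lap_pairing (\<lambda>x. f x + g x) s y = lap_pairing f s y + lap_pairing g s y"
  using lap_pairing_integrable [OF assms(1,3), of y] lap_pairing_integrable [OF assms(2,3), of y]
  by (simp add: lap_pairing_def distrib_right)

lemma integral_lap_heat:
  assumes a: "0 < a" "a \<le> b"
  shows "(LINT s|lborel. indicator {a..b} s *\<^sub>R lap_heat s x) = heat_kernel b x - heat_kernel a x"
proof (rule integral_FTC_Icc [OF a(2)])
  fix s assume s: "a \<le> s" "s \<le> b"
  then have "((\<lambda>s. heat_kernel s x) has_real_derivative lap_heat s x) (at s)"
    using a by (intro heat_kernel_time_derivative) simp
  then show "((\<lambda>s. heat_kernel s x) has_vector_derivative lap_heat s x) (at s within {a..b})"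
    unfolding has_real_derivative_iff_has_vector_derivative by (rule has_vector_derivative_at_within)
next
  show "continuous_on {a..b} (\<lambda>s. lap_heat s x)"
    unfolding lap_heat_def heat_kernel_def using a by (intro continuous_intros) auto
qed

text \<open>\<open>\<partial>\<^sub>sp\<^sub>s = \<Delta>p\<^sub>s\<close>, so the pairings with the test fields are the time derivative of the heat extension.\<close>
lemma heat_diff_eq_integral:
  assumes f: "f \<in> weak_fun" and a: "0 < a" "a \<le> b"
  shows "heat b f y - heat a f y = (LINT s|lborel. indicator {a..b} s *\<^sub>R lap_pairing f s y)"
proof -
  note [measurable] = weak_funD [OF f]
  obtain A where A: "A \<ge> 0" "weak_norm 3 f \<le> ennreal A" using weak_norm_realE [OF weak_fun_norm [OF f]] .
  have b: "0 < b" using a by simp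
  define F where "F x s = indicator {a..b} s * (f x * lap_heat s (x - y))" for x s
  have int: "integrable (lborel \<Otimes>\<^sub>M lborel) (\<lambda>(x, s). F x s)"
  proof -
    have "(\<integral>\<^sup>+p. ennreal (norm (F (fst p) (snd p))) \<partial>(lborel \<Otimes>\<^sub>M lborel)) = (\<integral>\<^sup>+s. \<integral>\<^sup>+x. ennreal (norm (F x s)) \<partial>lborel \<partial>lborel)"
      unfolding F_def by (subst lborel_pair.nn_integral_snd [symmetric]) auto
    also have "\<dots> \<le> (\<integral>\<^sup>+s. ennreal (lap_pairing_bound A a) * indicator {a..b} s \<partial>lborel)"
    proof (rule nn_integral_mono)
      fix s
      show "(\<integral>\<^sup>+x. ennreal (norm (F x s)) \<partial>lborel) \<le> ennreal (lap_pairing_bound A a) * indicator {a..b} s"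
        using lap_pairing_nn_bound [OF f A(2,1) a(1), of s y] by (cases "s \<in> {a..b}") (auto simp: F_def)
    qed
    also have "\<dots> < \<infinity>" by (subst nn_integral_cmult) (use a in \<open>auto simp: ennreal_mult_less_top\<close>)
    finally show ?thesis unfolding F_def by (simp add: integrable_iff_bounded case_prod_beta)
  qed
  have "heat b f y - heat a f y = (LINT x|lborel. heat_kernel b (y - x) * f x - heat_kernel a (y - x) * f x)"
    using heat_kernel_mult_integrable [OF b f, of y] heat_kernel_mult_integrable [OF a(1) f, of y]
    by (simp add: heat_real a b)
  also have "\<dots> = (LINT x|lborel. LINT s|lborel. F x s)"
  proof (rule Bochner_Integration.integral_cong [OF refl])
    fix x
    have "(LINT s|lborel. F x s) = (LINT s|lborel. f x * (indicator {a..b} s *\<^sub>R lap_heat s (x - y)))"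
      by (simp add: F_def mult_ac)
    also have "\<dots> = f x * (LINT s|lborel. indicator {a..b} s *\<^sub>R lap_heat s (x - y))"
      by (rule integral_mult_right_zero)
    also have "\<dots> = f x * (heat_kernel b (x - y) - heat_kernel a (x - y))"
      by (simp only: integral_lap_heat [OF a])
    finally show "heat_kernel b (y - x) * f x - heat_kernel a (y - x) * f x = (LINT s|lborel. F x s)"
      by (simp add: heat_kernel_commute [of _ y x] algebra_simps)
  qed
  also have "\<dots> = (LINT s|lborel. LINT x|lborel. F x s)"
    by (rule lborel_pair.Fubini_integral [symmetric, OF int])
  also have "\<dots> = (LINT s|lborel. indicator {a..b} s *\<^sub>R lap_pairing f s y)"
    by (simp add: F_def lap_pairing_def)
  finally show ?thesis .
qed

text \<open>\<open>S(a)f = S(b)f -\<close> the integral of the pairings over \<open>[a, b]\<close>.  The integrals converge by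
  dominated convergence, and for large \<open>b\<close> the term \<open>S(b)f\<close> is small uniformly along the sequence.\<close>
lemma heat_tendsto_of_lap_pairing:
  assumes fn: "\<And>n. fn n \<in> weak_fun" "\<And>n. weak_norm 3 (fn n) \<le> ennreal A"
    and f: "f \<in> weak_fun" "weak_norm 3 f \<le> ennreal A" and A: "0 \<le> A"
    and lim: "\<And>s. 0 < s \<Longrightarrow> (\<lambda>n. lap_pairing (fn n) s y) \<longlonglongrightarrow> lap_pairing f s y" and a: "0 < a"
  shows "(\<lambda>n. heat a (fn n) y) \<longlonglongrightarrow> heat a f y"
proof (rule LIMSEQ_I)
  fix e :: real assume e: "0 < e"
  then obtain T where T: "0 < T" "\<And>t f x. T \<le> t \<Longrightarrow> f \<in> weak_fun \<Longrightarrow> weak_norm 3 f \<le> ennreal A \<Longrightarrow> \<bar>heat t f x\<bar> \<le> e / 4"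
    using heat_tendsto_0_uniform [of "e / 4" A] A by auto
  define b where "b = max a T"
  have b: "a \<le> b" "T \<le> b" by (auto simp: b_def)
  have "(\<lambda>n. LINT s|lborel. indicator {a..b} s *\<^sub>R lap_pairing (fn n) s y) \<longlonglongrightarrow> (LINT s|lborel. indicator {a..b} s *\<^sub>R lap_pairing f s y)"
  proof (rule integral_dominated_convergence [where w = "\<lambda>s. indicator {a..b} s *\<^sub>R lap_pairing_bound A a"])
    show "integrable lborel (\<lambda>s. indicator {a..b} s *\<^sub>R lap_pairing_bound A a)" by (rule integrable_indicator) (auto simp: b)
    show "(\<lambda>s. indicator {a..b} s *\<^sub>R lap_pairing f s y) \<in> borel_measurable lborel"
      using lap_pairing_measurable [OF f(1)] by measurable
    show "(\<lambda>s. indicator {a..b} s *\<^sub>R lap_pairing (fn n) s y) \<in> borel_measurable lborel" for n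
      using lap_pairing_measurable [OF fn(1)] by measurable
    show "AE s in lborel. (\<lambda>n. indicator {a..b} s *\<^sub>R lap_pairing (fn n) s y) \<longlonglongrightarrow> indicator {a..b} s *\<^sub>R lap_pairing f s y"
    proof (rule AE_I2)
      fix s
      show "(\<lambda>n. indicator {a..b} s *\<^sub>R lap_pairing (fn n) s y) \<longlonglongrightarrow> indicator {a..b} s *\<^sub>R lap_pairing f s y"
      proof (cases "s \<in> {a..b}")
        case True
        then have "0 < s" using a by simp
        from lim [OF this] True show ?thesis by simp
      qed simp
    qed
    show "AE s in lborel. norm (indicator {a..b} s *\<^sub>R lap_pairing (fn n) s y) \<le> indicator {a..b} s *\<^sub>R lap_pairing_bound A a" for n
      using lap_pairing_le [OF fn A a] by (intro AE_I2) (auto simp: indicator_def)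
  qed
  from LIMSEQ_D [OF this, of "e / 4"] e
  have "\<exists>n0. \<forall>n\<ge>n0. norm ((LINT s|lborel. indicator {a..b} s *\<^sub>R lap_pairing (fn n) s y) - (LINT s|lborel. indicator {a..b} s *\<^sub>R lap_pairing f s y)) < e / 4"
    by simp
  then obtain n0 where n0: "\<forall>n\<ge>n0. norm ((LINT s|lborel. indicator {a..b} s *\<^sub>R lap_pairing (fn n) s y) - (LINT s|lborel. indicator {a..b} s *\<^sub>R lap_pairing f s y)) < e / 4" ..
  show "\<exists>n0. \<forall>n\<ge>n0. norm (heat a (fn n) y - heat a f y) < e"
  proof (intro exI allI impI)
    fix n assume "n0 \<le> n"
    with n0 have "norm ((heat b (fn n) y - heat a (fn n) y) - (heat b f y - heat a f y)) < e / 4"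
      by (simp only: heat_diff_eq_integral [OF fn(1) a b(1)] heat_diff_eq_integral [OF f(1) a b(1)])
    moreover have "\<bar>heat b (fn n) y\<bar> \<le> e / 4" by (intro T(2) b fn)
    moreover have "\<bar>heat b f y\<bar> \<le> e / 4" by (intro T(2) b f)
    ultimately show "norm (heat a (fn n) y - heat a f y) < e" using e unfolding real_norm_def by linarith
  qed
qed

text \<open>Convergence of heat extensions applied to a constant sequence: if all pairings of \<open>h = f - g\<close> vanish, so does
  its heat extension, hence \<open>h\<close>.\<close>
lemma lap_pairing_injective:
  assumes f: "f \<in> weak_fun" and g: "g \<in> weak_fun"
    and eq: "\<And>s y. 0 < s \<Longrightarrow> lap_pairing f s y = lap_pairing g s y"
  shows "AE x in lborel. f x = g x"
proof -
  define h where "h x = f x - g x" for x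
  have h: "h \<in> weak_fun" unfolding h_def by (rule weak_fun_diff [OF f g])
  obtain A where A: "A \<ge> 0" "weak_norm 3 h \<le> ennreal A" using weak_norm_realE [OF weak_fun_norm [OF h]] .
  have z: "(\<lambda>x. 0) \<in> weak_fun" by (simp add: weak_fun_def)
  have "heat s h x = 0" if s: "0 < s" for s x
  proof -
    have "(\<lambda>n. heat s h x) \<longlonglongrightarrow> heat s (\<lambda>x. 0) x"
      by (rule heat_tendsto_of_lap_pairing [OF h A(2) z _ A(1) _ s])
         (use lap_pairing_diff [OF f g] eq in \<open>simp_all add: h_def [abs_def] lap_pairing_def [of "\<lambda>x. 0"]\<close>)
    then show ?thesis by (simp add: LIMSEQ_const_iff heat_def)
  qed
  from heat_injective [OF h this] show ?thesis by (simp add: h_def)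
qed

text \<open>The heat semigroup is symmetric and moves \<open>\<Delta>p\<^sub>s\<close> to \<open>\<Delta>p\<^bsub>r+s\<^esub>\<close>.\<close>
lemma lap_pairing_heat:
  assumes f: "f \<in> weak_fun" and r: "0 < r" and s: "0 < s"
  shows "lap_pairing (heat r f) s y = lap_pairing f (r + s) y"
proof -
  note [measurable] = weak_funD [OF f]
  obtain A where A: "A \<ge> 0" "weak_norm 3 f \<le> ennreal A" using weak_norm_realE [OF weak_fun_norm [OF f]] .
  define C where "C = 1 + 1 / sqrt (4 * pi * r) ^ 3 * A ^ 3"
  define F where "F x z = heat_kernel r (x - z) * f z * lap_heat s (x - y)" for x z
  have hk: "(\<integral>\<^sup>+z. ennreal \<bar>f z * heat_kernel r (x - z)\<bar> \<partial>lborel) \<le> ennreal C" for x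
  proof -
    have int1: "(\<integral>\<^sup>+z. ennreal \<bar>heat_kernel r (x - z)\<bar> \<partial>lborel) = 1"
      using lborel_nn_integral_reflect [of "\<lambda>y. ennreal (heat_kernel r y)" x] nn_integral_heat_kernel [OF r] by simp
    have "(\<integral>\<^sup>+z. ennreal \<bar>f z * heat_kernel r (x - z)\<bar> \<partial>lborel)
        \<le> ennreal 1 * (\<integral>\<^sup>+z. ennreal \<bar>heat_kernel r (x - z)\<bar> \<partial>lborel) + ennreal (1 / sqrt (4 * pi * r) ^ 3 * A ^ 3 / 1\<^sup>2)"
      by (rule nn_integral_weak_mult_le) (use A heat_kernel_le [OF r] in auto)
    also have "\<dots> = ennreal C"
      unfolding int1 C_def using r A by (subst ennreal_plus) auto
    finally show ?thesis .
  qed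
  have int: "integrable (lborel \<Otimes>\<^sub>M lborel) (\<lambda>(x, z). F x z)"
  proof -
    have "(\<integral>\<^sup>+p. ennreal (norm (F (fst p) (snd p))) \<partial>(lborel \<Otimes>\<^sub>M lborel)) = (\<integral>\<^sup>+x. \<integral>\<^sup>+z. ennreal (norm (F x z)) \<partial>lborel \<partial>lborel)"
      unfolding F_def by (subst lborel.nn_integral_fst [symmetric]) auto
    also have "\<dots> \<le> (\<integral>\<^sup>+x. ennreal \<bar>lap_heat s (x - y)\<bar> * ennreal C \<partial>lborel)"
    proof (rule nn_integral_mono)
      fix x
      have "(\<integral>\<^sup>+z. ennreal (norm (F x z)) \<partial>lborel) = (\<integral>\<^sup>+z. ennreal \<bar>lap_heat s (x - y)\<bar> * ennreal \<bar>f z * heat_kernel r (x - z)\<bar> \<partial>lborel)"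
        by (intro nn_integral_cong) (simp add: F_def abs_mult ennreal_mult mult_ac)
      also have "\<dots> = ennreal \<bar>lap_heat s (x - y)\<bar> * (\<integral>\<^sup>+z. ennreal \<bar>f z * heat_kernel r (x - z)\<bar> \<partial>lborel)"
        by (rule nn_integral_cmult) measurable
      also have "\<dots> \<le> ennreal \<bar>lap_heat s (x - y)\<bar> * ennreal C" by (intro mult_left_mono hk) simp
      finally show "(\<integral>\<^sup>+z. ennreal (norm (F x z)) \<partial>lborel) \<le> ennreal \<bar>lap_heat s (x - y)\<bar> * ennreal C" .
    qed
    also have "\<dots> = (\<integral>\<^sup>+x. ennreal \<bar>lap_heat s (x - y)\<bar> \<partial>lborel) * ennreal C"
      by (rule nn_integral_multc) measurable
    also have "\<dots> \<le> ennreal (12 / s) * ennreal C" by (intro mult_right_mono nn_integral_lap_heat_le s) simp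
    also have "\<dots> < \<infinity>" by (simp add: ennreal_mult_less_top)
    finally show ?thesis unfolding F_def by (simp add: integrable_iff_bounded case_prod_beta)
  qed
  have "lap_pairing (heat r f) s y = (LINT x|lborel. LINT z|lborel. F x z)"
    by (simp add: lap_pairing_def heat_real r F_def)
  also have "\<dots> = (LINT z|lborel. LINT x|lborel. F x z)"
    by (rule lborel_pair.Fubini_integral [symmetric, OF int])
  also have "\<dots> = (LINT z|lborel. f z * lap_heat (r + s) (z - y))"
  proof (rule Bochner_Integration.integral_cong [OF refl])
    fix z
    have "(LINT x|lborel. F x z) = (LINT x|lborel. f z * (heat_kernel r (z - x) * lap_heat s (x - y)))"
      by (simp add: F_def heat_kernel_commute [of r z] mult_ac)
    then show "(LINT x|lborel. F x z) = f z * lap_heat (r + s) (z - y)"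
      by (simp add: heat_kernel_lap_heat_conv [OF r s])
  qed
  finally show ?thesis by (simp add: lap_pairing_def)
qed

section \<open>Vector fields\<close>

lemma act_fun_test_field: "act_fun w (test_field y s i) = complex_of_real (lap_pairing (\<lambda>x. w x $ i) s y)"
proof -
  have "act_fun w (test_field y s i) = (\<Sum>j\<in>UNIV. if j = i then complex_of_real (lap_pairing (\<lambda>x. w x $ i) s y) else 0)"
    unfolding act_fun_def test_field_nth
  proof (rule sum.cong [OF refl])
    fix j :: 3
    show "(LINT x|lborel. complex_of_real (w x $ j) * complex_of_real (if j = i then lap_heat s (x - y) else 0))
        = (if j = i then complex_of_real (lap_pairing (\<lambda>x. w x $ i) s y) else 0)"
    proof (cases "j = i")
      case True
      then show ?thesis unfolding lap_pairing_def by (simp only: of_real_mult [symmetric] integral_complex_of_real if_True simp_thms)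
    qed simp
  qed
  then show ?thesis by simp
qed

lemma weak_L_eqI:
  assumes v: "v \<in> weak_L 3" and w: "w \<in> weak_L 3"
    and eq: "\<And>i s y. 0 < s \<Longrightarrow> act_fun v (test_field y s i) = act_fun w (test_field y s i)"
  shows "AE x in lborel. v x = w x"
proof -
  have "AE x in lborel. v x $ i = w x $ i" for i
    using eq by (intro lap_pairing_injective weak_L_component v w) (simp add: act_fun_test_field)
  then have "AE x in lborel. \<forall>i\<in>UNIV. v x $ i = w x $ i" by (intro AE_finite_allI) auto
  then show ?thesis by (simp add: vec_eq_iff)
qed

lemma vec_expansion: "v = (\<Sum>i\<in>UNIV. (v $ i) *\<^sub>R axis i 1)" for v :: "real^3"
  by (simp add: vec_eq_iff sum_component axis_def if_distrib [of "\<lambda>z. _ * z"] cong: if_cong)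

lemma measurable_vecI:
  fixes v :: "'a \<Rightarrow> real^3"
  assumes [measurable]: "\<And>i. (\<lambda>x. v x $ i) \<in> borel_measurable M"
  shows "v \<in> borel_measurable M"
proof -
  have "(\<lambda>x. \<Sum>i\<in>UNIV. (v x $ i) *\<^sub>R axis i 1 :: real^3) \<in> borel_measurable M" by measurable
  then show ?thesis unfolding vec_expansion [symmetric] .
qed

lemma weak_LI:
  assumes "\<And>i. (\<lambda>x. v x $ i) \<in> weak_fun"
  shows "v \<in> weak_L 3"
proof -
  have "v \<in> borel_measurable lborel" using assms by (intro measurable_vecI weak_funD)
  moreover have "vweak_norm 3 v < \<infinity>"
    unfolding vweak_norm_def using assms by (subst Max_less_iff) (auto simp: weak_fun_def)
  ultimately show ?thesis by (simp add: weak_L_def)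
qed

lemma heat_vec_nth:
  assumes v: "v \<in> weak_L 3"
  shows "heat t v x $ i = heat t (\<lambda>x. v x $ i) x"
proof (cases "0 < t")
  case True
  have int: "integrable lborel (\<lambda>y. (heat_kernel t (x - y) * v y $ j) *\<^sub>R (axis j 1 :: real^3))" for j
    by (intro integrable_scaleR_left heat_kernel_mult_integrable True weak_L_component v)
  have "heat_kernel t (x - y) *\<^sub>R v y = (\<Sum>j\<in>UNIV. (heat_kernel t (x - y) * v y $ j) *\<^sub>R axis j 1)" for y
    by (subst vec_expansion [of "v y"]) (simp add: scaleR_sum_right)
  then have "heat t v x = (LINT y|lborel. (\<Sum>j\<in>UNIV. (heat_kernel t (x - y) * v y $ j) *\<^sub>R axis j 1))"
    using True by (simp add: heat_def)
  also have "\<dots> = (\<Sum>j\<in>UNIV. (LINT y|lborel. (heat_kernel t (x - y) * v y $ j) *\<^sub>R axis j 1))"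
    by (rule Bochner_Integration.integral_sum) (rule int)
  also have "\<dots> = (\<Sum>j\<in>UNIV. heat t (\<lambda>x. v x $ j) x *\<^sub>R axis j 1)"
    using heat_kernel_mult_integrable [OF True weak_L_component [OF v]] True by (simp add: heat_real)
  finally show ?thesis
    by (simp add: sum_component axis_def if_distrib [of "\<lambda>z. _ * z"] cong: if_cong)
qed (simp add: heat_def)

lemma heat_weak_L:
  assumes v: "v \<in> weak_L 3" and t: "0 < t"
  shows "heat t v \<in> weak_L 3"
  by (rule weak_LI) (unfold heat_vec_nth [OF v], intro heat_weak_fun weak_L_component v t)

lemma heat_vec_diff:
  assumes v: "v \<in> weak_L 3" and w: "w \<in> weak_L 3"
  shows "heat t (\<lambda>x. v x - w x) x = heat t v x - heat t w x"
proof (cases "0 < t")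
  case True
  show ?thesis
    using heat_diff [OF True weak_L_component [OF v] weak_L_component [OF w]]
    by (simp add: vec_eq_iff heat_vec_nth v w weak_L_diff)
qed (simp add: heat_def)

section \<open>The Duhamel integral\<close>

lemma duhamel_spec:
  assumes "duhamel_exists G t"
  shows "duhamel G t \<in> weak_L 3" "is_duhamel G t (duhamel G t)"
  using assms someI_ex [of "\<lambda>w. w \<in> weak_L 3 \<and> is_duhamel G t w"]
  unfolding duhamel_exists_def duhamel_def by blast+

text \<open>The semigroup and the projection act explicitly on the test fields, so the integrand is a single
  function of \<open>\<tau>\<close> and \<open>t + s\<close>.  This is why Duhamel integrals at different times can be compared.\<close>
lemma is_duhamel_test_field:
  assumes w: "is_duhamel G t w" and s: "0 < s"
  shows "set_integrable lborel {0<..<t} (\<lambda>\<tau>. act (G \<tau>) (leray_test_field y (t + s - \<tau>) i))"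
    and "complex_of_real (lap_pairing (\<lambda>x. w x $ i) s y)
      = (LINT \<tau>:{0<..<t}|lborel. act (G \<tau>) (leray_test_field y (t + s - \<tau>) i))"
proof -
  have eq: "heat_dist (t - \<tau>) (leray_dist (G \<tau>)) (test_field y s i) = act (G \<tau>) (leray_test_field y (t + s - \<tau>) i)"
    if "\<tau> \<in> {0<..<t}" for \<tau>
  proof -
    have "t - \<tau> + s = t + s - \<tau>" by simp
    moreover have "heat_dist (t - \<tau>) (leray_dist (G \<tau>)) (test_field y s i) = act (G \<tau>) (leray_test_field y (t - \<tau> + s) i)"
      using that s by (intro heat_dist_leray_dist_test_field) auto
    ultimately show ?thesis by (simp only:)
  qed
  have "test_field y s i \<in> test_fields" using s by (rule test_field_in_test_fields)
  then have *: "set_integrable lborel {0<..<t} (\<lambda>\<tau>. heat_dist (t - \<tau>) (leray_dist (G \<tau>)) (test_field y s i))"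
    "act_fun w (test_field y s i) = (LINT \<tau>:{0<..<t}|lborel. heat_dist (t - \<tau>) (leray_dist (G \<tau>)) (test_field y s i))"
    using w by (auto simp: is_duhamel_def)
  show "set_integrable lborel {0<..<t} (\<lambda>\<tau>. act (G \<tau>) (leray_test_field y (t + s - \<tau>) i))"
    using *(1) by (simp only: set_integrable_cong [OF refl refl eq])
  show "complex_of_real (lap_pairing (\<lambda>x. w x $ i) s y)
      = (LINT \<tau>:{0<..<t}|lborel. act (G \<tau>) (leray_test_field y (t + s - \<tau>) i))"
  proof -
    have "(LINT \<tau>:{0<..<t}|lborel. heat_dist (t - \<tau>) (leray_dist (G \<tau>)) (test_field y s i))
        = (LINT \<tau>:{0<..<t}|lborel. act (G \<tau>) (leray_test_field y (t + s - \<tau>) i))"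
      by (rule set_lebesgue_integral_cong) (use eq in auto)
    with *(2) show ?thesis by (simp only: act_fun_test_field)
  qed
qed

lemma duhamel_eqI:
  assumes G: "duhamel_exists G t" and w: "w \<in> weak_L 3"
    and eq: "\<And>i s y. 0 < s \<Longrightarrow> complex_of_real (lap_pairing (\<lambda>x. w x $ i) s y)
      = (LINT \<tau>:{0<..<t}|lborel. act (G \<tau>) (leray_test_field y (t + s - \<tau>) i))"
  shows "AE x in lborel. duhamel G t x = w x"
  using eq is_duhamel_test_field(2) [OF duhamel_spec(2) [OF G]]
  by (intro weak_L_eqI duhamel_spec(1) G w) (simp add: act_fun_test_field)

text \<open>Paired with the test field of parameter \<open>s\<close>, the integral up to \<open>a + r\<close> has the integrand
  \<open>act (G \<tau>) \<Phi>\<^bsub>a+r+s-\<tau>\<^esub>\<close>.  Over \<open>(0, a)\<close> this is the pairing of \<open>D(a)\<close> at parameter \<open>r + s\<close>, that is of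
  \<open>S(r)D(a)\<close> at \<open>s\<close>; over \<open>(a, a + r)\<close> it is the pairing of the shifted integral.\<close>
lemma duhamel_split:
  assumes ex: "duhamel_exists G a" "duhamel_exists G (a + r)" "duhamel_exists (\<lambda>\<tau>. G (a + \<tau>)) r"
    and a: "0 < a" and r: "0 < r"
  shows "AE x in lborel. duhamel G (a + r) x = heat r (duhamel G a) x + duhamel (\<lambda>\<tau>. G (a + \<tau>)) r x"
proof (rule duhamel_eqI [OF ex(2)])
  note D1 = duhamel_spec(1) [OF ex(1)] and D3 = duhamel_spec(1) [OF ex(3)]
  note T1 = is_duhamel_test_field [OF duhamel_spec(2) [OF ex(1)]]
    and T2 = is_duhamel_test_field [OF duhamel_spec(2) [OF ex(2)]]
    and T3 = is_duhamel_test_field [OF duhamel_spec(2) [OF ex(3)]]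
  show "(\<lambda>x. heat r (duhamel G a) x + duhamel (\<lambda>\<tau>. G (a + \<tau>)) r x) \<in> weak_L 3"
    by (intro weak_L_add heat_weak_L D1 D3 r)
  fix i s y assume s: "0 < (s::real)"
  define K where "K \<tau> = act (G \<tau>) (leray_test_field y (a + r + s - \<tau>) i)" for \<tau>
  have int: "set_integrable lborel {0<..<a+r} K" unfolding K_def by (rule T2(1) [OF s])
  have i1: "set_integrable lborel {0<..<a} K" and i2: "set_integrable lborel {a<..<a+r} K"
    by (rule set_integrable_subset [OF int]; use a r in auto)+
  have "complex_of_real (lap_pairing (\<lambda>x. (heat r (duhamel G a) x + duhamel (\<lambda>\<tau>. G (a + \<tau>)) r x) $ i) s y)
      = complex_of_real (lap_pairing (\<lambda>x. duhamel G a x $ i) (r + s) y)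
      + complex_of_real (lap_pairing (\<lambda>x. duhamel (\<lambda>\<tau>. G (a + \<tau>)) r x $ i) s y)"
    using lap_pairing_add [OF heat_weak_fun [OF r weak_L_component [OF D1]] weak_L_component [OF D3] s]
    by (simp add: heat_vec_nth [OF D1] lap_pairing_heat [OF weak_L_component [OF D1] r s])
  also have "complex_of_real (lap_pairing (\<lambda>x. duhamel G a x $ i) (r + s) y) = (LINT \<tau>:{0<..<a}|lborel. K \<tau>)"
    unfolding K_def by (subst T1(2)) (use r s in \<open>simp_all add: add.assoc\<close>)
  also have "complex_of_real (lap_pairing (\<lambda>x. duhamel (\<lambda>\<tau>. G (a + \<tau>)) r x $ i) s y) = (LINT \<tau>:{0<..<r}|lborel. K (a + \<tau>))"
    unfolding K_def by (subst T3(2) [OF s]) (simp add: algebra_simps)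
  also have "\<dots> = (LINT \<tau>:{a<..<a+r}|lborel. K \<tau>)"
    unfolding set_lebesgue_integral_def
    by (subst (2) lborel_integral_real_affine [where c = 1 and t = a]) (auto simp: indicator_def intro!: Bochner_Integration.integral_cong)
  also have "(LINT \<tau>:{0<..<a}|lborel. K \<tau>) + (LINT \<tau>:{a<..<a+r}|lborel. K \<tau>) = (LINT \<tau>:{0<..<a} \<union> {a<..<a+r}|lborel. K \<tau>)"
    by (rule set_integral_Un [symmetric, OF _ i1 i2]) auto
  also have "\<dots> = (LINT \<tau>:{0<..<a+r}|lborel. K \<tau>)"
  proof (rule set_integral_cong_set)
    show "AE \<tau> in lborel. (\<tau> \<in> {0<..<a + r}) = (\<tau> \<in> {0<..<a} \<union> {a<..<a + r})"
      using AE_lborel_singleton [of a] by eventually_elim (use a r in auto)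
    have "set_integrable lborel ({0<..<a} \<union> {a<..<a+r}) K"
      by (rule set_integrable_subset [OF int]) (use a r in auto)
    then show "set_borel_measurable lborel ({0<..<a} \<union> {a<..<a + r}) K"
      by (simp add: set_integrable_def set_borel_measurable_def)
    show "set_borel_measurable lborel {0<..<a + r} K"
      using int by (simp add: set_integrable_def set_borel_measurable_def)
  qed
  finally show "complex_of_real (lap_pairing (\<lambda>x. (heat r (duhamel G a) x + duhamel (\<lambda>\<tau>. G (a + \<tau>)) r x) $ i) s y)
      = (LINT \<tau>:{0<..<a+r}|lborel. act (G \<tau>) (leray_test_field y (a + r + s - \<tau>) i))"
    by (simp only: K_def)
qed

section \<open>The space \<open>X\<^sub>3\<close>\<close>

lemma X3D:
  assumes "u \<in> X3"
  shows "0 \<le> t \<Longrightarrow> u t \<in> weak_L 3"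
    and "0 < t \<Longrightarrow> ((\<lambda>s. vweak_norm 3 (\<lambda>x. u s x - u t x)) \<longlongrightarrow> 0) (at t)"
    and "g \<in> lorentz_one (3 / (3 - 1)) \<Longrightarrow>
      ((\<lambda>t. LINT x|lborel. u t x $ i * g x) \<longlongrightarrow> (LINT x|lborel. u 0 x $ i * g x)) (at_right 0)"
  using assms by (auto simp: X3_def C_w_def)

lemma vweak_norm_le_norm_X3: "0 \<le> t \<Longrightarrow> vweak_norm 3 (u t) \<le> norm_X3 u"
  unfolding norm_X3_def by (rule SUP_upper) simp

lemma norm_X3_le: "(\<And>t. 0 \<le> t \<Longrightarrow> vweak_norm 3 (u t) \<le> K) \<Longrightarrow> norm_X3 u \<le> K"
  unfolding norm_X3_def by (rule SUP_least) simp

lemma norm_X3_finite: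
  assumes "u \<in> X3" shows "norm_X3 u < \<infinity>"
proof -
  define S where "S = (SUP t\<in>{0<..}. vweak_norm 3 (u t))"
  have "S < \<infinity>" using assms by (auto simp: X3_def C_w_def S_def)
  have "norm_X3 u \<le> vweak_norm 3 (u 0) + S"
  proof (rule norm_X3_le)
    fix t :: real assume "0 \<le> t"
    show "vweak_norm 3 (u t) \<le> vweak_norm 3 (u 0) + S"
    proof (cases "t = 0")
      case False
      then have "vweak_norm 3 (u t) \<le> S" unfolding S_def using \<open>0 \<le> t\<close> by (intro SUP_upper) auto
      then show ?thesis by (simp add: add_increasing)
    qed (simp add: add_increasing2)
  qed
  also have "\<dots> < \<infinity>" using \<open>S < \<infinity>\<close> weak_LD(2) [OF X3D(1) [OF assms, of 0]] by simp
  finally show ?thesis .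
qed

lemma weak_LD_diff_measurable:
  assumes "v \<in> weak_L 3" "w \<in> weak_L 3"
  shows "(\<lambda>x. v x - w x) \<in> borel_measurable lborel"
  using weak_LD(1) [OF weak_L_diff [OF assms]] .

text \<open>Continuity in norm at \<open>t = 0\<close>, measured by \<open>L\<^bsup>3/2,1\<^esup>\<close> duality, implies the weak continuity
  required there.  The fields constructed below vanish near \<open>0\<close> or are shifts of an \<open>X\<^sub>3\<close> field to a
  positive time, where it is norm continuous.\<close>
lemma X3I:
  assumes L: "\<And>t. 0 \<le> t \<Longrightarrow> v t \<in> weak_L 3"
    and bd: "\<And>t. 0 < t \<Longrightarrow> vweak_norm 3 (v t) \<le> C" "C < \<infinity>"
    and cont: "\<And>t. 0 < t \<Longrightarrow> ((\<lambda>s. vweak_norm 3 (\<lambda>x. v s x - v t x)) \<longlongrightarrow> 0) (at t)"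
    and cont0: "((\<lambda>s. vweak_norm 3 (\<lambda>x. v s x - v 0 x)) \<longlongrightarrow> 0) (at_right 0)"
  shows "v \<in> X3"
proof -
  have "((\<lambda>t. LINT x|lborel. v t x $ i * g x) \<longlongrightarrow> (LINT x|lborel. v 0 x $ i * g x)) (at_right 0)"
    if g: "g \<in> lorentz_one (3 / (3 - 1))" for i g
  proof -
    have int: "integrable lborel (\<lambda>x. v t x $ i * g x)" if "0 \<le> t" for t
      by (rule lorentz_integrable [OF weak_LD(3,4) [OF L [OF that]] g])
    have le: "ennreal \<bar>(LINT x|lborel. v t x $ i * g x) - (LINT x|lborel. v 0 x $ i * g x)\<bar>
        \<le> lorentz_norm g * vweak_norm 3 (\<lambda>x. v t x - v 0 x)" if t: "0 \<le> t" for t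
    proof -
      have d: "(\<lambda>x. v t x - v 0 x) \<in> weak_L 3" using L t by (intro weak_L_diff) auto
      have "(LINT x|lborel. v t x $ i * g x) - (LINT x|lborel. v 0 x $ i * g x) = (LINT x|lborel. (v t x - v 0 x) $ i * g x)"
        using int [OF t] int [of 0] by (simp add: left_diff_distrib)
      then have "ennreal \<bar>(LINT x|lborel. v t x $ i * g x) - (LINT x|lborel. v 0 x $ i * g x)\<bar>
          \<le> (\<integral>\<^sup>+x. ennreal (norm ((v t x - v 0 x) $ i * g x)) \<partial>lborel)"
        using integral_norm_bound_ennreal [OF lorentz_integrable [OF weak_LD(3,4) [OF d] g, of i]] by (simp only: real_norm_def)
      also have "\<dots> = (\<integral>\<^sup>+x. ennreal \<bar>(v t x - v 0 x) $ i * g x\<bar> \<partial>lborel)" by simp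
      also have "\<dots> \<le> weak_norm 3 (\<lambda>x. (v t x - v 0 x) $ i) * lorentz_norm g"
        by (rule lorentz_duality [OF weak_LD(3) [OF d] g])
      also have "\<dots> \<le> vweak_norm 3 (\<lambda>x. v t x - v 0 x) * lorentz_norm g"
        by (intro mult_right_mono weak_norm_component_le) simp
      finally show ?thesis by (simp only: mult.commute)
    qed
    have "((\<lambda>t. lorentz_norm g * vweak_norm 3 (\<lambda>x. v t x - v 0 x)) \<longlongrightarrow> lorentz_norm g * 0) (at_right 0)"
      using lorentz_oneD(2) [OF g] by (intro ennreal_tendsto_cmult cont0) simp
    then have z: "((\<lambda>t. lorentz_norm g * vweak_norm 3 (\<lambda>x. v t x - v 0 x)) \<longlongrightarrow> 0) (at_right 0)" by simp
    have "((\<lambda>t. ennreal \<bar>(LINT x|lborel. v t x $ i * g x) - (LINT x|lborel. v 0 x $ i * g x)\<bar>) \<longlongrightarrow> ennreal 0) (at_right 0)"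
      unfolding ennreal_0
    proof (rule tendsto_sandwich [OF _ _ tendsto_const z])
      show "\<forall>\<^sub>F t in at_right 0. ennreal \<bar>(LINT x|lborel. v t x $ i * g x) - (LINT x|lborel. v 0 x $ i * g x)\<bar>
          \<le> lorentz_norm g * vweak_norm 3 (\<lambda>x. v t x - v 0 x)"
        by (intro eventually_mono [OF eventually_at_right_less [of "0::real"]] le) simp
    qed simp
    then have "((\<lambda>t. \<bar>(LINT x|lborel. v t x $ i * g x) - (LINT x|lborel. v 0 x $ i * g x)\<bar>) \<longlongrightarrow> 0) (at_right 0)"
      by (rule tendsto_ennrealD) auto
    then have "((\<lambda>t. (LINT x|lborel. v t x $ i * g x) - (LINT x|lborel. v 0 x $ i * g x)) \<longlongrightarrow> 0) (at_right 0)"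
      by (rule tendsto_rabs_zero_cancel)
    then show ?thesis by (rule Lim_null [THEN iffD2])
  qed
  moreover have "(SUP t\<in>{0<..}. vweak_norm 3 (v t)) < \<infinity>"
    using bd by (intro le_less_trans [OF SUP_least bd(2)]) auto
  ultimately show ?thesis using L cont by (auto simp: X3_def C_w_def)
qed

lemma X3_diff:
  assumes u: "u \<in> X3" and v: "v \<in> X3"
  shows "(\<lambda>t x. u t x - v t x) \<in> X3"
proof -
  have 1: "(\<lambda>x. u t x - v t x) \<in> weak_L 3" if "0 \<le> t" for t
    using that by (intro weak_L_diff X3D u v)
  have "(SUP t\<in>{0<..}. vweak_norm 3 (\<lambda>x. u t x - v t x)) \<le> norm_X3 u + norm_X3 v"
  proof (rule SUP_least)
    fix t :: real assume "t \<in> {0<..}"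
    then have t: "0 \<le> t" by simp
    have "vweak_norm 3 (\<lambda>x. u t x - v t x) \<le> vweak_norm 3 (u t) + vweak_norm 3 (v t)"
      by (intro vweak_norm_diff_le weak_LD X3D u v t)
    also have "\<dots> \<le> norm_X3 u + norm_X3 v" by (intro add_mono vweak_norm_le_norm_X3 t)
    finally show "vweak_norm 3 (\<lambda>x. u t x - v t x) \<le> norm_X3 u + norm_X3 v" .
  qed
  also have "\<dots> < \<infinity>" using norm_X3_finite [OF u] norm_X3_finite [OF v] by simp
  finally have 2: "(SUP t\<in>{0<..}. vweak_norm 3 (\<lambda>x. u t x - v t x)) < \<infinity>" .
  have 3: "((\<lambda>s. vweak_norm 3 (\<lambda>x. (u s x - v s x) - (u t x - v t x))) \<longlongrightarrow> 0) (at t)" if t: "0 < t" for t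
  proof -
    have z: "((\<lambda>s. vweak_norm 3 (\<lambda>x. u s x - u t x) + vweak_norm 3 (\<lambda>x. v s x - v t x)) \<longlongrightarrow> 0) (at t)"
      using tendsto_add [OF X3D(2) [OF u t] X3D(2) [OF v t]] by simp
    show ?thesis
    proof (rule tendsto_sandwich [OF _ _ tendsto_const z])
      have "\<forall>\<^sub>F s in at t. 0 < s" using t by (intro order_tendstoD(1) [OF tendsto_ident_at])
      then show "\<forall>\<^sub>F s in at t. vweak_norm 3 (\<lambda>x. (u s x - v s x) - (u t x - v t x))
          \<le> vweak_norm 3 (\<lambda>x. u s x - u t x) + vweak_norm 3 (\<lambda>x. v s x - v t x)"
      proof eventually_elim
        case (elim s)
        have "vweak_norm 3 (\<lambda>x. (u s x - u t x) - (v s x - v t x)) \<le> vweak_norm 3 (\<lambda>x. u s x - u t x) + vweak_norm 3 (\<lambda>x. v s x - v t x)"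
          using elim t by (intro vweak_norm_diff_le weak_LD_diff_measurable X3D(1) u v) auto
        then show ?case by (simp add: algebra_simps)
      qed
    qed simp
  qed
  have 4: "((\<lambda>t. LINT x|lborel. (u t x - v t x) $ i * g x) \<longlongrightarrow> (LINT x|lborel. (u 0 x - v 0 x) $ i * g x)) (at_right 0)"
    if g: "g \<in> lorentz_one (3 / (3 - 1))" for i g
  proof -
    have eq: "(LINT x|lborel. (u t x - v t x) $ i * g x) = (LINT x|lborel. u t x $ i * g x) - (LINT x|lborel. v t x $ i * g x)" if t: "0 \<le> t" for t
      using lorentz_integrable [OF weak_LD(3,4) [OF X3D(1) [OF u t]] g, of i] lorentz_integrable [OF weak_LD(3,4) [OF X3D(1) [OF v t]] g, of i]
      by (simp add: left_diff_distrib)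
    have "((\<lambda>t. (LINT x|lborel. u t x $ i * g x) - (LINT x|lborel. v t x $ i * g x)) \<longlongrightarrow> (LINT x|lborel. (u 0 x - v 0 x) $ i * g x)) (at_right 0)"
      unfolding eq [OF order_refl] by (intro tendsto_diff X3D(3) u v g)
    then show ?thesis
    proof (rule Lim_transform_eventually)
      show "\<forall>\<^sub>F t in at_right 0. (LINT x|lborel. u t x $ i * g x) - (LINT x|lborel. v t x $ i * g x) = (LINT x|lborel. (u t x - v t x) $ i * g x)"
        by (intro eventually_mono [OF eventually_at_right_less [of "0::real"]]) (simp only: eq less_imp_le)
    qed
  qed
  show ?thesis using 1 2 3 4 by (simp add: X3_def C_w_def)
qed

lemma X3_shift:
  assumes u: "u \<in> X3" and a: "0 < a"
  shows "(\<lambda>t. u (a + t)) \<in> X3"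
proof (rule X3I)
  have lim: "((\<lambda>s. vweak_norm 3 (\<lambda>x. u (a + s) x - u (a + t) x)) \<longlongrightarrow> 0) (at t)" if t: "0 \<le> t" for t
  proof -
    have "filterlim (\<lambda>s. a + s) (at (a + t)) (at t)"
      unfolding filterlim_at by (auto intro!: tendsto_intros simp: eventually_at_filter)
    from filterlim_compose [OF X3D(2) [OF u] this] show ?thesis using a t by simp
  qed
  show "((\<lambda>s. vweak_norm 3 (\<lambda>x. u (a + s) x - u (a + t) x)) \<longlongrightarrow> 0) (at t)" if "0 < t" for t
    using that by (intro lim) simp
  show "((\<lambda>s. vweak_norm 3 (\<lambda>x. u (a + s) x - u (a + 0) x)) \<longlongrightarrow> 0) (at_right 0)"
    by (rule tendsto_mono [OF _ lim [OF order_refl]]) (simp add: at_le)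
  show "u (a + t) \<in> weak_L 3" if "0 \<le> t" for t using a that by (intro X3D u) simp
  show "vweak_norm 3 (u (a + t)) \<le> norm_X3 u" if "0 < t" for t using a that by (intro vweak_norm_le_norm_X3) simp
  show "norm_X3 u < \<infinity>" by (rule norm_X3_finite [OF u])
qed

section \<open>Periodisation in time\<close>

text \<open>Vanishes at distance at most \<open>1 / (k + 1)\<close> from the end points of \<open>[0, a]\<close> and equals \<open>1\<close> at
  distance at least \<open>2 / (k + 1)\<close>.\<close>
definition cutoff :: "nat \<Rightarrow> real \<Rightarrow> real \<Rightarrow> real" where
  "cutoff k a \<tau> = max 0 (min 1 (real (Suc k) * min \<tau> (a - \<tau>) - 1))"

lemma cutoff_bounds: "0 \<le> cutoff k a \<tau>" "cutoff k a \<tau> \<le> 1" "\<bar>cutoff k a \<tau>\<bar> \<le> 1"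
  by (auto simp: cutoff_def)

lemma cutoff_eq_0: "\<tau> \<le> 1 / real (Suc k) \<or> a - 1 / real (Suc k) \<le> \<tau> \<Longrightarrow> cutoff k a \<tau> = 0"
proof -
  assume "\<tau> \<le> 1 / real (Suc k) \<or> a - 1 / real (Suc k) \<le> \<tau>"
  then have "min \<tau> (a - \<tau>) \<le> 1 / real (Suc k)" by linarith
  then have "real (Suc k) * min \<tau> (a - \<tau>) \<le> real (Suc k) * (1 / real (Suc k))" by (intro mult_left_mono) auto
  also have "\<dots> = 1" by simp
  finally show ?thesis unfolding cutoff_def by linarith
qed

lemma cutoff_continuous: "continuous_on UNIV (cutoff k a)"
  unfolding cutoff_def by (intro continuous_intros)

lemma cutoff_tendsto_1:
  assumes "0 < \<tau>" "\<tau> < a"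
  shows "(\<lambda>k. cutoff k a \<tau>) \<longlonglongrightarrow> 1"
proof (rule tendsto_eventually)
  define m where "m = min \<tau> (a - \<tau>)"
  have m: "m > 0" using assms by (simp add: m_def)
  obtain K :: nat where K: "2 / m < real K" using reals_Archimedean2 by blast
  show "\<forall>\<^sub>F k in sequentially. cutoff k a \<tau> = 1"
    using eventually_ge_at_top [of K]
  proof eventually_elim
    case (elim k)
    then have "2 / m \<le> real (Suc k)" using K by simp
    then have "2 \<le> real (Suc k) * m" using m by (simp add: pos_divide_le_eq del: of_nat_Suc)
    then show ?case unfolding cutoff_def m_def [symmetric] by linarith
  qed
qed

text \<open>The representative of \<open>\<tau>\<close> modulo \<open>a\<close> in \<open>[0, a)\<close>.\<close>
definition time_mod :: "real \<Rightarrow> real \<Rightarrow> real" where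
  "time_mod a \<tau> = \<tau> - a * of_int \<lfloor>\<tau> / a\<rfloor>"

lemma time_mod_bounds:
  assumes "0 < a" shows "0 \<le> time_mod a \<tau>" "time_mod a \<tau> < a"
proof -
  have "a * of_int \<lfloor>\<tau> / a\<rfloor> \<le> a * (\<tau> / a)" using assms by (intro mult_left_mono) auto
  then show "0 \<le> time_mod a \<tau>" using assms by (simp add: time_mod_def)
  have "a * (\<tau> / a) < a * (of_int \<lfloor>\<tau> / a\<rfloor> + 1)" using assms by (intro mult_strict_left_mono) auto
  then show "time_mod a \<tau> < a" using assms by (simp add: time_mod_def algebra_simps)
qed

lemma time_mod_unique:
  assumes "0 < a" "0 \<le> \<tau> - a * of_int n" "\<tau> - a * of_int n < a"
  shows "time_mod a \<tau> = \<tau> - a * of_int n"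
proof -
  have "\<lfloor>\<tau> / a\<rfloor> = n"
    by (rule floor_unique) (use assms in \<open>auto simp: field_simps\<close>)
  then show ?thesis by (simp add: time_mod_def)
qed

lemma time_mod_id: "0 < \<tau> \<Longrightarrow> \<tau> < a \<Longrightarrow> time_mod a \<tau> = \<tau>"
  using time_mod_unique [of a \<tau> 0] by simp

lemma time_mod_add: "0 < a \<Longrightarrow> time_mod a (a + \<tau>) = time_mod a \<tau>"
  by (simp add: time_mod_def add_divide_distrib algebra_simps)

text \<open>The cutoff removes the jump at the multiples of \<open>a\<close>, and it also removes the neighbourhood of
  \<open>0\<close>, where an \<open>X\<^sub>3\<close> field is only weakly continuous.\<close>
definition periodise :: "nat \<Rightarrow> real \<Rightarrow> (real \<Rightarrow> real^3 \<Rightarrow> real^3) \<Rightarrow> real \<Rightarrow> real^3 \<Rightarrow> real^3" where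
  "periodise k a u \<tau> x = cutoff k a (time_mod a \<tau>) *\<^sub>R u (time_mod a \<tau>) x"

lemma periodise_add: "0 < a \<Longrightarrow> periodise k a u (a + \<tau>) = periodise k a u \<tau>"
  by (intro ext) (simp only: periodise_def time_mod_add)

lemma periodise_weak_L:
  assumes "u \<in> X3" "0 < a" shows "periodise k a u \<tau> \<in> weak_L 3"
proof -
  have "(\<lambda>x. cutoff k a (time_mod a \<tau>) *\<^sub>R u (time_mod a \<tau>) x) \<in> weak_L 3"
    using assms time_mod_bounds(1) by (intro weak_L_scaleR X3D)
  then show ?thesis by (simp add: periodise_def [abs_def])
qed

lemma periodise_norm_le:
  assumes u: "u \<in> X3" and a: "0 < a" shows "vweak_norm 3 (periodise k a u \<tau>) \<le> norm_X3 u"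
proof -
  have t: "0 \<le> time_mod a \<tau>" using a by (rule time_mod_bounds)
  have "vweak_norm 3 (\<lambda>x. cutoff k a (time_mod a \<tau>) *\<^sub>R u (time_mod a \<tau>) x)
      \<le> ennreal \<bar>cutoff k a (time_mod a \<tau>)\<bar> * vweak_norm 3 (u (time_mod a \<tau>))"
    by (intro vweak_norm_scaleR_le weak_LD X3D u t)
  also have "\<dots> \<le> ennreal 1 * norm_X3 u"
    by (intro mult_mono ennreal_leI cutoff_bounds vweak_norm_le_norm_X3 t) auto
  finally show ?thesis by (simp add: periodise_def [abs_def])
qed

text \<open>To the right of a multiple of \<open>a\<close> the cutoff vanishes because \<^const>\<open>time_mod\<close> is close to \<open>0\<close>,
  to the left because it is close to \<open>a\<close>.\<close>
lemma periodise_near_period: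
  assumes a: "0 < a" and t: "time_mod a t = 0"
  shows "\<forall>\<^sub>F s in nhds t. periodise k a u s = (\<lambda>x. 0)"
proof -
  define n where "n = \<lfloor>t / a\<rfloor>"
  have tn: "t = a * of_int n" using t by (simp add: time_mod_def n_def)
  define d where "d = min a (1 / real (Suc k))"
  have d: "d > 0" using a by (simp add: d_def)
  have d_le: "d \<le> a" "d \<le> 1 / real (Suc k)" by (auto simp: d_def)
  have "\<forall>\<^sub>F s in nhds t. s \<in> {t - d<..<t + d}" using d by (intro eventually_nhds_in_open) auto
  then show ?thesis
  proof eventually_elim
    case (elim s)
    then have e: "t - d < s" "s < t + d" by auto
    have "cutoff k a (time_mod a s) = 0"
    proof (cases "t \<le> s")
      case True
      have "time_mod a s = s - a * of_int n"
        by (rule time_mod_unique) (use a True e tn d_le in linarith)+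
      then have "time_mod a s \<le> 1 / real (Suc k)" using e tn d_le by linarith
      then show ?thesis by (intro cutoff_eq_0) simp
    next
      case False
      have eq: "s - a * of_int (n - 1) = s - t + a" using tn by (simp add: algebra_simps)
      have "time_mod a s = s - a * of_int (n - 1)"
      proof (rule time_mod_unique [OF a])
        show "0 \<le> s - a * of_int (n - 1)" unfolding eq using e d_le by linarith
        show "s - a * of_int (n - 1) < a" unfolding eq using False by linarith
      qed
      then have "a - 1 / real (Suc k) \<le> time_mod a s" unfolding eq using e d_le by linarith
      then show ?thesis by (intro cutoff_eq_0) simp
    qed
    then show ?case by (simp add: periodise_def fun_eq_iff)
  qed
qed

lemma periodise_continuous_interior:
  assumes u: "u \<in> X3" and a: "0 < a" and m: "0 < time_mod a t"
  shows "((\<lambda>s. vweak_norm 3 (\<lambda>x. periodise k a u s x - periodise k a u t x)) \<longlongrightarrow> 0) (at t)"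
proof -
  define n where "n = \<lfloor>t / a\<rfloor>"
  \<comment> \<open>off the multiples of \<open>a\<close>, reduction modulo \<open>a\<close> is locally a translation\<close>
  define h where "h s = s - a * of_int n" for s
  have ht: "h t = time_mod a t" by (simp add: h_def time_mod_def n_def)
  have ht0: "0 < h t" "h t < a" using m time_mod_bounds(2) [OF a] by (simp_all add: ht)
  have h_lim: "(h \<longlongrightarrow> h t) (at t)" unfolding h_def by (intro tendsto_intros)
  have near: "\<forall>\<^sub>F s in at t. 0 < h s \<and> h s < a"
    using order_tendstoD [OF h_lim] ht0 by (intro eventually_conj) auto
  have L: "0 \<le> r \<Longrightarrow> u r \<in> weak_L 3" for r by (rule X3D [OF u])
  let ?c = "cutoff k a"
  define N where "N = vweak_norm 3 (u (h t))"
  have N: "N < \<infinity>" unfolding N_def using ht0 by (intro weak_LD L) simp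
  have z: "((\<lambda>s. vweak_norm 3 (\<lambda>x. u (h s) x - u (h t) x) + N * ennreal \<bar>?c (h s) - ?c (h t)\<bar>) \<longlongrightarrow> 0 + N * ennreal 0) (at t)"
  proof (intro tendsto_add ennreal_tendsto_cmult tendsto_ennrealI)
    have "filterlim h (at (h t)) (at t)"
      unfolding filterlim_at using h_lim by (auto simp: h_def eventually_at_filter)
    from filterlim_compose [OF X3D(2) [OF u ht0(1)] this]
    show "((\<lambda>s. vweak_norm 3 (\<lambda>x. u (h s) x - u (h t) x)) \<longlongrightarrow> 0) (at t)" .
    have "isCont ?c (h t)" using cutoff_continuous continuous_on_eq_continuous_at open_UNIV by blast
    then have "((\<lambda>s. ?c (h s)) \<longlongrightarrow> ?c (h t)) (at t)" using h_lim by (rule isCont_tendsto_compose)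
    then have "((\<lambda>s. ?c (h s) - ?c (h t)) \<longlongrightarrow> ?c (h t) - ?c (h t)) (at t)" by (intro tendsto_intros)
    then show "((\<lambda>s. \<bar>?c (h s) - ?c (h t)\<bar>) \<longlongrightarrow> 0) (at t)" by (simp add: tendsto_rabs_zero)
  qed (use N in simp)
  then have z: "((\<lambda>s. vweak_norm 3 (\<lambda>x. u (h s) x - u (h t) x) + N * ennreal \<bar>?c (h s) - ?c (h t)\<bar>) \<longlongrightarrow> 0) (at t)" by simp
  show ?thesis
  proof (rule tendsto_sandwich [OF _ _ tendsto_const z])
    show "\<forall>\<^sub>F s in at t. vweak_norm 3 (\<lambda>x. periodise k a u s x - periodise k a u t x)
        \<le> vweak_norm 3 (\<lambda>x. u (h s) x - u (h t) x) + N * ennreal \<bar>?c (h s) - ?c (h t)\<bar>"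
      using near
    proof eventually_elim
      case (elim s)
      have ms: "time_mod a s = h s" unfolding h_def by (rule time_mod_unique) (use elim a in \<open>auto simp: h_def\<close>)
      have d: "(\<lambda>x. u (h s) x - u (h t) x) \<in> weak_L 3" using elim ht0 by (intro weak_L_diff L) auto
      have Lt: "u (h t) \<in> weak_L 3" using ht0 by (intro L) auto
      have "(\<lambda>x. periodise k a u s x - periodise k a u t x)
          = (\<lambda>x. ?c (h s) *\<^sub>R (u (h s) x - u (h t) x) + (?c (h s) - ?c (h t)) *\<^sub>R u (h t) x)"
        by (simp add: periodise_def ms ht [symmetric] algebra_simps)
      then have "vweak_norm 3 (\<lambda>x. periodise k a u s x - periodise k a u t x)
          \<le> vweak_norm 3 (\<lambda>x. ?c (h s) *\<^sub>R (u (h s) x - u (h t) x)) + vweak_norm 3 (\<lambda>x. (?c (h s) - ?c (h t)) *\<^sub>R u (h t) x)"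
        using vweak_norm_add_le [OF weak_LD(1) [OF weak_L_scaleR [OF d]] weak_LD(1) [OF weak_L_scaleR [OF Lt]]] by simp
      also have "\<dots> \<le> ennreal \<bar>?c (h s)\<bar> * vweak_norm 3 (\<lambda>x. u (h s) x - u (h t) x) + ennreal \<bar>?c (h s) - ?c (h t)\<bar> * N"
        unfolding N_def by (intro add_mono vweak_norm_scaleR_le weak_LD d Lt)
      also have "\<dots> \<le> ennreal 1 * vweak_norm 3 (\<lambda>x. u (h s) x - u (h t) x) + ennreal \<bar>?c (h s) - ?c (h t)\<bar> * N"
        by (intro add_right_mono mult_right_mono ennreal_leI cutoff_bounds) simp
      finally show ?case by (simp add: mult.commute)
    qed
  qed simp
qed

lemma periodise_X3:
  assumes u: "u \<in> X3" and a: "0 < a"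
  shows "periodise k a u \<in> X3"
proof (rule X3I)
  have at_period: "((\<lambda>s. vweak_norm 3 (\<lambda>x. periodise k a u s x - periodise k a u t x)) \<longlongrightarrow> 0) (at t)" if "time_mod a t = 0" for t
  proof (rule tendsto_eventually)
    have ev: "\<forall>\<^sub>F s in nhds t. periodise k a u s = (\<lambda>x. 0)" using a that by (rule periodise_near_period)
    then have "periodise k a u t = (\<lambda>x. 0)" by (rule eventually_nhds_x_imp_x)
    with ev show "\<forall>\<^sub>F s in at t. vweak_norm 3 (\<lambda>x. periodise k a u s x - periodise k a u t x) = 0"
      by (auto simp: eventually_at_filter elim!: eventually_mono)
  qed
  show "((\<lambda>s. vweak_norm 3 (\<lambda>x. periodise k a u s x - periodise k a u t x)) \<longlongrightarrow> 0) (at t)" if "0 < t" for t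
    using at_period periodise_continuous_interior [OF u a] time_mod_bounds(1) [OF a, of t]
    by (cases "time_mod a t = 0") auto
  have "time_mod a 0 = 0" by (simp add: time_mod_def)
  from at_period [OF this] show "((\<lambda>s. vweak_norm 3 (\<lambda>x. periodise k a u s x - periodise k a u 0 x)) \<longlongrightarrow> 0) (at_right 0)"
    by (rule tendsto_mono [rotated]) (simp add: at_le)
  show "periodise k a u t \<in> weak_L 3" for t by (rule periodise_weak_L [OF u a])
  show "vweak_norm 3 (periodise k a u t) \<le> norm_X3 u" for t by (rule periodise_norm_le [OF u a])
  show "norm_X3 u < \<infinity>" by (rule norm_X3_finite [OF u])
qed

section \<open>Linearity\<close>

lemma div_tensor_pairing_integrable:
  assumes a: "a \<in> weak_L 3" and b: "b \<in> weak_L 3" and s: "0 < s"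
  shows "integrable lborel (\<lambda>x. complex_of_real (a x $ j * b x $ k) * partial j (\<lambda>x. leray_test_field y s i x $ k) x)"
proof -
  obtain B where "\<And>x. norm (partial j (\<lambda>x. leray_test_field y s i x $ k) x) \<le> B"
    using partial_leray_test_field(2) [OF s] by blast
  then have "integrable lborel (\<lambda>x. (a x $ j * b x $ k) *\<^sub>R partial j (\<lambda>x. leray_test_field y s i x $ k) x)"
    by (intro weak_integrable_mult2 [OF weak_LD(3,4) [OF a] weak_LD(3,4) [OF b] partial_leray_test_field(1) [OF s]])
  then show ?thesis by (simp only: scaleR_conv_of_real)
qed

lemma act_div_tensor_diff_left:
  assumes a: "a \<in> weak_L 3" and a': "a' \<in> weak_L 3" and b: "b \<in> weak_L 3" and s: "0 < s"
  shows "act (div_tensor (\<lambda>x. a x - a' x) b) (leray_test_field y s i)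
    = act (div_tensor a b) (leray_test_field y s i) - act (div_tensor a' b) (leray_test_field y s i)"
  using div_tensor_pairing_integrable [OF a b s] div_tensor_pairing_integrable [OF a' b s]
  unfolding act_def div_tensor_def by (simp add: left_diff_distrib sum_subtractf sum_negf)

lemma act_div_tensor_diff_right:
  assumes a: "a \<in> weak_L 3" and b': "b' \<in> weak_L 3" and b: "b \<in> weak_L 3" and s: "0 < s"
  shows "act (div_tensor a (\<lambda>x. b x - b' x)) (leray_test_field y s i)
    = act (div_tensor a b) (leray_test_field y s i) - act (div_tensor a b') (leray_test_field y s i)"
  using div_tensor_pairing_integrable [OF a b s] div_tensor_pairing_integrable [OF a b' s]
  unfolding act_def div_tensor_def by (simp add: left_diff_distrib right_diff_distrib sum_subtractf sum_negf)

lemma act_div_tensor_scaleR: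
  "act (div_tensor (\<lambda>x. c *\<^sub>R a x) (\<lambda>x. c *\<^sub>R b x)) \<Phi> = complex_of_real (c\<^sup>2) * act (div_tensor a b) \<Phi>"
proof -
  have "(LINT x|lborel. complex_of_real ((c *\<^sub>R a x) $ j * (c *\<^sub>R b x) $ i) * partial j \<phi> x)
      = complex_of_real (c\<^sup>2) * (LINT x|lborel. complex_of_real (a x $ j * b x $ i) * partial j \<phi> x)" for j i \<phi>
    by (subst integral_mult_right_zero [symmetric]) (simp add: power2_eq_square mult_ac)
  then show ?thesis unfolding act_def div_tensor_def by (simp add: sum_distrib_left)
qed

lemma act_fun_diff:
  assumes v: "v \<in> weak_L 3" and w: "w \<in> weak_L 3" and \<Phi>: "\<Phi> \<in> test_fields"
  shows "act_fun (\<lambda>x. v x - w x) \<Phi> = act_fun v \<Phi> - act_fun w \<Phi>"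
proof -
  have S: "\<Phi> \<in> schwartz" using \<Phi> by (simp add: test_fields_def)
  obtain B where B: "\<And>x. norm (\<Phi> x) \<le> B" using schwartz_bounded_integrable(2) [OF S] by blast
  have int: "integrable lborel (\<lambda>x. complex_of_real (u x $ i) * \<Phi> x $ i)" if "u \<in> weak_L 3" for u i
  proof -
    have "integrable lborel (\<lambda>x. u x $ i *\<^sub>R \<Phi> x $ i)"
    proof (rule weak_integrable_mult [OF weak_LD(3,4) [OF that]])
      show "integrable lborel (\<lambda>x. \<Phi> x $ i)"
        by (rule integrable_bounded_linear [OF bounded_linear_vec_nth schwartz_bounded_integrable(1) [OF S]])
      show "norm (\<Phi> x $ i) \<le> B" for x using B [of x] Finite_Cartesian_Product.norm_nth_le [of "\<Phi> x" i] by simp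
    qed
    then show ?thesis by (simp only: scaleR_conv_of_real)
  qed
  show ?thesis unfolding act_fun_def using int [OF v] int [OF w]
    by (simp add: left_diff_distrib sum_subtractf)
qed

lemma is_duhamel_diff:
  assumes v: "v \<in> weak_L 3" "is_duhamel F t v" and w: "w \<in> weak_L 3" "is_duhamel F' t w"
  shows "is_duhamel (\<lambda>\<tau>. F \<tau> - F' \<tau>) t (\<lambda>x. v x - w x)"
proof -
  have eq: "heat_dist r (leray_dist (F \<tau> - F' \<tau>)) \<Phi> = heat_dist r (leray_dist (F \<tau>)) \<Phi> - heat_dist r (leray_dist (F' \<tau>)) \<Phi>" for r \<tau> \<Phi>
    by (simp add: heat_dist_def leray_dist_def act_def sum_subtractf)
  show ?thesis
    unfolding is_duhamel_def eq
    using v w by (auto simp: is_duhamel_def act_fun_diff set_integral_diff)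
qed

lemma duhamel_diff:
  assumes F: "duhamel_exists F t" and F': "duhamel_exists F' t"
  shows "AE x in lborel. duhamel (\<lambda>\<tau>. F \<tau> - F' \<tau>) t x = duhamel F t x - duhamel F' t x"
proof -
  note D = duhamel_spec [OF F] and D' = duhamel_spec [OF F']
  have w: "(\<lambda>x. duhamel F t x - duhamel F' t x) \<in> weak_L 3" by (intro weak_L_diff D D')
  have is_d: "is_duhamel (\<lambda>\<tau>. F \<tau> - F' \<tau>) t (\<lambda>x. duhamel F t x - duhamel F' t x)" by (intro is_duhamel_diff D D')
  show ?thesis
    by (rule duhamel_eqI [OF _ w is_duhamel_test_field(2) [OF is_d]]) (use w is_d in \<open>auto simp: duhamel_exists_def\<close>)
qed

section \<open>Smallness of the remote past\<close>

lemma norm_X3_periodise_le: "u \<in> X3 \<Longrightarrow> 0 < a \<Longrightarrow> norm_X3 (periodise k a u) \<le> norm_X3 u"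
  by (intro norm_X3_le periodise_norm_le)

text \<open>The bound for the \<open>L\<^sup>1\<close> distance of the heat kernels at the times \<open>N a\<close> and \<open>(N + 1) a\<close>, which by
  scaling does not involve \<open>a\<close>.\<close>
definition heat_gap :: "nat \<Rightarrow> real" where
  "heat_gap N = 2 * (1 - sqrt (real N / real (Suc N)) ^ 3)"

lemma heat_gap_nonneg: "0 \<le> heat_gap N"
proof -
  have "sqrt (real N / real (Suc N)) ^ 3 \<le> 1 ^ 3" by (intro power_mono) auto
  then show ?thesis by (simp add: heat_gap_def)
qed

lemma heat_gap_tendsto_0: "heat_gap \<longlonglongrightarrow> 0"
proof -
  have "(\<lambda>N. 2 * (1 - sqrt (real N / real (Suc N)) ^ 3)) \<longlonglongrightarrow> 2 * (1 - sqrt 1 ^ 3)"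
    by (intro tendsto_intros LIMSEQ_n_over_Suc_n)
  then show ?thesis by (simp add: heat_gap_def [abs_def])
qed

text \<open>With \<open>c = (a / b)\<^bsup>3/2\<^esup> \<le> 1\<close> one has \<open>c p\<^sub>a \<le> p\<^sub>b\<close> pointwise, so
  \<open>|p\<^sub>a - p\<^sub>b| \<le> (p\<^sub>b - c p\<^sub>a) + (1 - c) p\<^sub>a\<close>, and both summands have integral \<open>1 - c\<close>.\<close>
lemma heat_kernel_diff_L1:
  assumes a: "0 < a" "a \<le> b"
  shows "(\<integral>\<^sup>+x. ennreal \<bar>heat_kernel a x - heat_kernel b x\<bar> \<partial>lborel) \<le> ennreal (2 * (1 - sqrt (a / b) ^ 3))"
proof -
  have b: "0 < b" using a by simp
  define c where "c = sqrt (a / b) ^ 3"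
  have "sqrt (a / b) \<le> 1" using a b by simp
  then have "sqrt (a / b) ^ 3 \<le> 1 ^ 3" using a b by (intro power_mono) auto
  then have c: "0 \<le> c" "c \<le> 1" using a b by (auto simp: c_def)
  have le: "c * heat_kernel a x \<le> heat_kernel b x" for x
  proof -
    have "c / sqrt (4 * pi * a) ^ 3 = 1 / sqrt (4 * pi * b) ^ 3"
      using a b by (simp add: c_def real_sqrt_divide real_sqrt_mult power_divide power_mult_distrib)
    moreover have "c * heat_kernel a x = c / sqrt (4 * pi * a) ^ 3 * gauss (1 / (4 * a)) x"
      by (simp add: heat_kernel_gauss [OF a(1)])
    ultimately have "c * heat_kernel a x = gauss (1 / (4 * a)) x / sqrt (4 * pi * b) ^ 3" by simp
    also have "\<dots> \<le> gauss (1 / (4 * b)) x / sqrt (4 * pi * b) ^ 3"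
    proof (rule divide_right_mono)
      have "(norm x)\<^sup>2 / (4 * b) \<le> (norm x)\<^sup>2 / (4 * a)" using a b by (intro divide_left_mono) auto
      then show "gauss (1 / (4 * a)) x \<le> gauss (1 / (4 * b)) x"
        unfolding gauss_def by simp
    qed (use b in simp)
    also have "\<dots> = heat_kernel b x" using heat_kernel_gauss [OF b, of x] by simp
    finally show ?thesis .
  qed
  have "(\<integral>\<^sup>+x. ennreal \<bar>heat_kernel a x - heat_kernel b x\<bar> \<partial>lborel)
      \<le> (\<integral>\<^sup>+x. ennreal (heat_kernel b x + (1 - 2 * c) * heat_kernel a x) \<partial>lborel)"
  proof (intro nn_integral_mono ennreal_leI)
    fix x
    have "\<bar>heat_kernel a x - heat_kernel b x\<bar> \<le> (heat_kernel b x - c * heat_kernel a x) + (1 - c) * heat_kernel a x"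
    proof -
      have "0 \<le> (1 - c) * heat_kernel a x" using c by simp
      moreover have "heat_kernel a x - heat_kernel b x = (1 - c) * heat_kernel a x - (heat_kernel b x - c * heat_kernel a x)"
        by (simp add: algebra_simps)
      ultimately show ?thesis using le [of x] by linarith
    qed
    then show "\<bar>heat_kernel a x - heat_kernel b x\<bar> \<le> heat_kernel b x + (1 - 2 * c) * heat_kernel a x"
      by (simp add: algebra_simps)
  qed
  also have "\<dots> = ennreal (LINT x|lborel. heat_kernel b x + (1 - 2 * c) * heat_kernel a x)"
  proof (rule nn_integral_eq_integral)
    show "integrable lborel (\<lambda>x. heat_kernel b x + (1 - 2 * c) * heat_kernel a x)"
      by (intro Bochner_Integration.integrable_add integrable_mult_right heat_kernel_integrable a b)
    have "0 \<le> heat_kernel b x + (1 - 2 * c) * heat_kernel a x" for x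
    proof -
      have "0 \<le> (1 - c) * heat_kernel a x" using c by simp
      then show ?thesis using le [of x] by (simp add: algebra_simps)
    qed
    then show "AE x in lborel. 0 \<le> heat_kernel b x + (1 - 2 * c) * heat_kernel a x" by simp
  qed
  also have "(LINT x|lborel. heat_kernel b x + (1 - 2 * c) * heat_kernel a x) = 2 * (1 - c)"
    using heat_kernel_integrable [OF a(1)] heat_kernel_integrable [OF b] integral_heat_kernel [OF a(1)] integral_heat_kernel [OF b]
    by simp
  finally show ?thesis by (simp add: c_def)
qed

lemma weak_norm_heat_diff_le:
  assumes f: "f \<in> weak_fun" and a: "0 < a" and N: "0 < N"
  shows "weak_norm 3 (\<lambda>x. heat (real N * a) f x - heat (real (Suc N) * a) f x) \<le> ennreal (heat_gap N) * weak_norm 3 f"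
proof -
  have t: "0 < real N * a" "0 < real (Suc N) * a" using a N by simp_all
  have "heat (real N * a) f x - heat (real (Suc N) * a) f x
      = (LINT y|lborel. (heat_kernel (real N * a) (x - y) - heat_kernel (real (Suc N) * a) (x - y)) * f y)" for x
    unfolding heat_real [OF t(1)] heat_real [OF t(2)] left_diff_distrib
    by (intro Bochner_Integration.integral_diff [symmetric] heat_kernel_mult_integrable t f)
  then have "weak_norm 3 (\<lambda>x. heat (real N * a) f x - heat (real (Suc N) * a) f x)
      \<le> (\<integral>\<^sup>+z. ennreal \<bar>heat_kernel (real N * a) z - heat_kernel (real (Suc N) * a) z\<bar> \<partial>lborel) * weak_norm 3 f"
    using weak_norm_convolution_le [of "\<lambda>z. heat_kernel (real N * a) z - heat_kernel (real (Suc N) * a) z" f] weak_funD [OF f] by simp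
  also have "\<dots> \<le> ennreal (heat_gap N) * weak_norm 3 f"
  proof (rule mult_right_mono)
    have "real N * a / (real (Suc N) * a) = real N / real (Suc N)" using a by simp
    moreover have "real N * a \<le> real (Suc N) * a" using a by (intro mult_right_mono) auto
    ultimately show "(\<integral>\<^sup>+z. ennreal \<bar>heat_kernel (real N * a) z - heat_kernel (real (Suc N) * a) z\<bar> \<partial>lborel) \<le> ennreal (heat_gap N)"
      using heat_kernel_diff_L1 [OF t(1), of "real (Suc N) * a"] by (simp only: heat_gap_def)
  qed simp
  finally show ?thesis .
qed

lemma heat_cong_AE:
  fixes f g :: "real^3 \<Rightarrow> real"
  assumes t: "0 < t" and ae: "AE x in lborel. f x = g x" and m: "f \<in> borel_measurable lborel" "g \<in> borel_measurable lborel"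
  shows "heat t f x = heat t g x"
  unfolding heat_real [OF t]
  by (rule integral_cong_AE) (use ae m in \<open>auto elim!: eventually_mono\<close>)

text \<open>The relation \<open>step\<close> holds for the partial sums \<open>Q\<^sub>n\<close> of the \<open>S(k a) z\<close> over \<open>k < n\<close>, telescoped.
  Applying \<open>S(N a)\<close> to it gives \<open>S(N a)z = (S(N a) - S((N + 1) a)) Q\<^sub>n + S((N + n) a) z\<close>.  The first
  term is bounded through \<^const>\<open>heat_gap\<close> independently of \<open>n\<close>.  The second need not become small in
  norm, but it tends to \<open>0\<close> uniformly in space, hence in the mean over each set of finite measure,
  and this suffices for the bound.\<close>
lemma weak_norm_heat_of_bounded_sums:
  assumes z: "z \<in> weak_fun" and Q: "\<And>n. Q n \<in> weak_fun" "\<And>n. weak_norm 3 (Q n) \<le> ennreal M" and M: "0 \<le> M"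
    and a: "0 < a" and N: "0 < N"
    and step: "\<And>n. 0 < n \<Longrightarrow> AE x in lborel. heat a (Q n) x + z x = heat (real n * a) z x + Q n x"
  shows "weak_norm 3 (heat (real N * a) z) \<le> ennreal (heat_gap N * M)"
proof (rule weak_norm_le)
  fix E :: "(real^3) set" assume E [measurable]: "E \<in> sets borel" and fin: "emeasure lborel E < \<infinity>"
  define m where "m = measure lborel E"
  have em: "emeasure lborel E = ennreal m" using fin by (simp add: m_def emeasure_eq_ennreal_measure less_top)
  have t: "0 < real N * a" "0 < real (Suc N) * a" using a N by simp_all
  have m0: "0 \<le> m" by (simp add: m_def)
  obtain A where A: "A \<ge> 0" "weak_norm 3 z \<le> ennreal A" using weak_norm_realE [OF weak_fun_norm [OF z]] .
  have "(\<integral>\<^sup>+x\<in>E. ennreal \<bar>heat (real N * a) z x\<bar> \<partial>lborel) \<le> ennreal (m powr (2/3)) * ennreal (heat_gap N * M) + ennreal e" if e: "0 < e" for e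
  proof -
    \<comment> \<open>a function bounded by \<open>d\<close> has integral at most \<open>e\<close> over \<open>E\<close>\<close>
    define d where "d = e / (m + 1)"
    have d: "0 < d" "d * m \<le> e" using e m0 by (simp_all add: d_def pos_divide_le_eq mult_left_mono)
    obtain T where T: "0 < T" "\<And>t f x. T \<le> t \<Longrightarrow> f \<in> weak_fun \<Longrightarrow> weak_norm 3 f \<le> ennreal A \<Longrightarrow> \<bar>heat t f x\<bar> \<le> d"
      using heat_tendsto_0_uniform [OF d(1) A(1)] by blast
    \<comment> \<open>so late that the second term is at most \<open>d\<close> everywhere\<close>
    obtain n :: nat where n: "T / a < real n" using reals_Archimedean2 by blast
    have n0: "0 < n"
    proof (rule ccontr)
      assume "\<not> 0 < n"
      then have "T / a < 0" using n by simp
      then show False using T(1) a by (simp add: divide_less_0_iff)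
    qed
    have nT: "T \<le> real N * a + real n * a" using n a t(1) by (simp add: pos_divide_less_eq)
    have na: "0 < real n * a" using n0 a by simp
    define R where "R x = heat (real N * a) (Q n) x - heat (real (Suc N) * a) (Q n) x" for x
    have R: "R \<in> weak_fun" unfolding R_def by (intro weak_fun_diff heat_weak_fun t Q)
    have eq: "heat (real N * a) z x = R x + heat (real N * a + real n * a) z x" for x
    proof -
      have "heat (real N * a) (\<lambda>x. heat a (Q n) x + z x) x = heat (real N * a) (\<lambda>x. heat (real n * a) z x + Q n x) x"
        by (rule heat_cong_AE [OF t(1) step [OF n0]]) (intro weak_funD weak_fun_add heat_weak_fun z Q a na)+
      then have "heat (real N * a) (heat a (Q n)) x + heat (real N * a) z x
          = heat (real N * a) (heat (real n * a) z) x + heat (real N * a) (Q n) x"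
        by (simp only: heat_add [OF t(1) heat_weak_fun [OF a Q(1)] z] heat_add [OF t(1) heat_weak_fun [OF na z] Q(1)])
      moreover have "heat (real N * a) (heat a (Q n)) x = heat (real (Suc N) * a) (Q n) x"
        using heat_semigroup [OF t(1) a Q(1), of n x] by (simp add: algebra_simps)
      moreover have "heat (real N * a) (heat (real n * a) z) x = heat (real N * a + real n * a) z x"
        by (rule heat_semigroup [OF t(1) na z])
      ultimately show ?thesis unfolding R_def by linarith
    qed
    have "(\<integral>\<^sup>+x\<in>E. ennreal \<bar>heat (real N * a) z x\<bar> \<partial>lborel) \<le> (\<integral>\<^sup>+x. ennreal \<bar>R x\<bar> * indicator E x + ennreal d * indicator E x \<partial>lborel)"
    proof (rule nn_integral_mono)
      fix x
      have "\<bar>heat (real N * a) z x\<bar> \<le> \<bar>R x\<bar> + d"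
        using T(2) [OF nT z A(2), of x] unfolding eq [of x] by linarith
      then have "ennreal \<bar>heat (real N * a) z x\<bar> \<le> ennreal (\<bar>R x\<bar> + d)" by (rule ennreal_leI)
      then have "ennreal \<bar>heat (real N * a) z x\<bar> \<le> ennreal \<bar>R x\<bar> + ennreal d"
        using d by simp
      then show "ennreal \<bar>heat (real N * a) z x\<bar> * indicator E x \<le> ennreal \<bar>R x\<bar> * indicator E x + ennreal d * indicator E x"
        by (auto simp: indicator_def)
    qed
    also have "\<dots> = (\<integral>\<^sup>+x\<in>E. ennreal \<bar>R x\<bar> \<partial>lborel) + ennreal d * emeasure lborel E"
      using weak_funD [OF R] by (subst nn_integral_add) (auto simp: nn_integral_cmult)
    also have "\<dots> \<le> ennreal (m powr (2/3)) * weak_norm 3 R + ennreal e"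
    proof (rule add_mono)
      show "(\<integral>\<^sup>+x\<in>E. ennreal \<bar>R x\<bar> \<partial>lborel) \<le> ennreal (m powr (2/3)) * weak_norm 3 R"
        unfolding m_def by (rule set_integral_le_weak_norm [OF E fin])
      show "ennreal d * emeasure lborel E \<le> ennreal e"
        unfolding em using d m0 by (simp add: ennreal_mult [symmetric] ennreal_leI)
    qed
    also have "\<dots> \<le> ennreal (m powr (2/3)) * ennreal (heat_gap N * M) + ennreal e"
    proof (intro add_right_mono mult_left_mono)
      have "weak_norm 3 R \<le> ennreal (heat_gap N) * weak_norm 3 (Q n)"
        unfolding R_def by (rule weak_norm_heat_diff_le [OF Q(1) a N])
      also have "\<dots> \<le> ennreal (heat_gap N) * ennreal M" by (intro mult_left_mono Q) simp
      finally show "weak_norm 3 R \<le> ennreal (heat_gap N * M)"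
        using M heat_gap_nonneg by (simp add: ennreal_mult)
    qed simp
    finally show ?thesis .
  qed
  then show "(\<integral>\<^sup>+x\<in>E. ennreal \<bar>heat (real N * a) z x\<bar> \<partial>lborel) \<le> ennreal (measure lborel E powr (2/3)) * ennreal (heat_gap N * M)"
    unfolding m_def [symmetric] by (rule ennreal_le_epsilon) simp
qed

text \<open>Fatou's lemma on each set of finite measure.\<close>
lemma weak_norm_lower_semicontinuous:
  assumes lim: "\<And>x. (\<lambda>n. fn n x) \<longlonglongrightarrow> f x" and [measurable]: "\<And>n. fn n \<in> borel_measurable lborel"
    and le: "\<And>n. weak_norm 3 (fn n) \<le> K"
  shows "weak_norm 3 f \<le> K"
proof (rule weak_norm_le)
  fix E :: "(real^3) set" assume E [measurable]: "E \<in> sets borel" and fin: "emeasure lborel E < \<infinity>"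
  have "(\<integral>\<^sup>+x\<in>E. ennreal \<bar>f x\<bar> \<partial>lborel) = (\<integral>\<^sup>+x. liminf (\<lambda>n. ennreal \<bar>fn n x\<bar> * indicator E x) \<partial>lborel)"
  proof (rule nn_integral_cong)
    fix x
    have "(\<lambda>n. ennreal \<bar>fn n x\<bar> * indicator E x) \<longlonglongrightarrow> ennreal \<bar>f x\<bar> * indicator E x"
      using lim [of x] by (cases "x \<in> E") (auto intro!: tendsto_ennrealI tendsto_rabs)
    then show "ennreal \<bar>f x\<bar> * indicator E x = liminf (\<lambda>n. ennreal \<bar>fn n x\<bar> * indicator E x)"
      by (simp add: lim_imp_Liminf)
  qed
  also have "\<dots> \<le> liminf (\<lambda>n. \<integral>\<^sup>+x. ennreal \<bar>fn n x\<bar> * indicator E x \<partial>lborel)"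
    by (rule nn_integral_liminf) measurable
  also have "\<dots> \<le> ennreal (measure lborel E powr (2/3)) * K"
  proof (rule Liminf_le)
    show "\<forall>\<^sub>F n in sequentially. (\<integral>\<^sup>+x. ennreal \<bar>fn n x\<bar> * indicator E x \<partial>lborel) \<le> ennreal (measure lborel E powr (2/3)) * K"
      by (intro always_eventually allI order_trans [OF set_integral_le_weak_norm [OF E fin]] mult_left_mono le) simp
  qed simp
  finally show "(\<integral>\<^sup>+x\<in>E. ennreal \<bar>f x\<bar> \<partial>lborel) \<le> ennreal (measure lborel E powr (2/3)) * K" .
qed

text \<open>The bilinear form enters through the Duhamel integral \<open>D v w = - B(v, w)\<close>, which has the same norm.\<close>
locale bilinear_bound =
  fixes \<eta> :: real
  assumes eta_pos: "0 < \<eta>"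
    and eta: "\<And>v w. v \<in> X3 \<Longrightarrow> w \<in> X3 \<Longrightarrow>
      bilin_exists v w \<and> bilin v w \<in> X3 \<and> norm_X3 (bilin v w) \<le> ennreal \<eta> * norm_X3 v * norm_X3 w"
begin

abbreviation D :: "(real \<Rightarrow> real^3 \<Rightarrow> real^3) \<Rightarrow> (real \<Rightarrow> real^3 \<Rightarrow> real^3) \<Rightarrow> real \<Rightarrow> real^3 \<Rightarrow> real^3" where
  "D v w \<equiv> duhamel (\<lambda>\<tau>. div_tensor (v \<tau>) (w \<tau>))"

lemma D_exists: "v \<in> X3 \<Longrightarrow> w \<in> X3 \<Longrightarrow> 0 \<le> t \<Longrightarrow> duhamel_exists (\<lambda>\<tau>. div_tensor (v \<tau>) (w \<tau>)) t"
  using eta by (auto simp: bilin_exists_def)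

lemma D_weak_L: "v \<in> X3 \<Longrightarrow> w \<in> X3 \<Longrightarrow> 0 \<le> t \<Longrightarrow> D v w t \<in> weak_L 3"
  by (intro duhamel_spec D_exists)

lemma D_norm_le:
  assumes v: "v \<in> X3" "norm_X3 v \<le> ennreal A" and w: "w \<in> X3" "norm_X3 w \<le> ennreal B" and AB: "0 \<le> A" "0 \<le> B" and t: "0 \<le> t"
  shows "vweak_norm 3 (D v w t) \<le> ennreal (\<eta> * A * B)"
proof -
  have "vweak_norm 3 (D v w t) = vweak_norm 3 (bilin v w t)"
    using vweak_norm_uminus [of 3 "D v w t"] by (simp add: bilin_def [abs_def])
  also have "\<dots> \<le> norm_X3 (bilin v w)" by (rule vweak_norm_le_norm_X3 [OF t])
  also have "\<dots> \<le> ennreal \<eta> * norm_X3 v * norm_X3 w" using eta [OF v(1) w(1)] by blast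
  also have "\<dots> \<le> ennreal \<eta> * ennreal A * ennreal B" by (intro mult_mono v w) auto
  also have "\<dots> = ennreal (\<eta> * A * B)" using eta_pos AB by (simp add: ennreal_mult)
  finally show ?thesis .
qed

text \<open>For the periodic fields the shift by a multiple of \<open>a\<close> changes nothing.  Splitting the Duhamel
  integral at time \<open>(n + 1) a\<close> once at \<open>n a\<close> and once at \<open>a\<close> gives the telescoped relation between the
  integrals \<open>Q\<^sub>n\<close> at the times \<open>n a\<close>, and the bound \<open>\<eta>\<close> on the periodic fields gives their boundedness.\<close>
lemma heat_D_periodise_le:
  assumes v: "v \<in> X3" "norm_X3 v \<le> ennreal A" and w: "w \<in> X3" "norm_X3 w \<le> ennreal B" and AB: "0 \<le> A" "0 \<le> B"
    and a: "0 < a" and N: "0 < N"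
  shows "weak_norm 3 (heat (real N * a) (\<lambda>x. D (periodise k a v) (periodise k a w) a x $ i)) \<le> ennreal (heat_gap N * (\<eta> * A * B))"
proof -
  define V where "V = periodise k a v"
  define W where "W = periodise k a w"
  have V: "V \<in> X3" "norm_X3 V \<le> ennreal A"
    unfolding V_def by (rule periodise_X3 [OF v(1) a], rule order_trans [OF norm_X3_periodise_le [OF v(1) a] v(2)])
  have W: "W \<in> X3" "norm_X3 W \<le> ennreal B"
    unfolding W_def by (rule periodise_X3 [OF w(1) a], rule order_trans [OF norm_X3_periodise_le [OF w(1) a] w(2)])
  define G where "G \<tau> = div_tensor (V \<tau>) (W \<tau>)" for \<tau>
  have per1: "G (a + \<tau>) = G \<tau>" for \<tau>
    by (simp only: G_def V_def W_def periodise_add [OF a])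
  have per: "G (real n * a + \<tau>) = G \<tau>" for n \<tau>
  proof (induction n)
    case (Suc n)
    have "real (Suc n) * a + \<tau> = a + (real n * a + \<tau>)" by (simp add: algebra_simps)
    then show ?case using per1 [of "real n * a + \<tau>"] Suc.IH by (simp only:)
  qed simp
  have ex: "duhamel_exists G t" if "0 \<le> t" for t
    unfolding G_def using V W that by (intro D_exists)
  have L: "duhamel G t \<in> weak_L 3" if "0 \<le> t" for t using ex that by (intro duhamel_spec)
  have M0: "0 \<le> \<eta> * A * B" using eta_pos AB by simp
  show ?thesis
    unfolding V_def [symmetric] W_def [symmetric] G_def [symmetric]
  proof (rule weak_norm_heat_of_bounded_sums [where Q = "\<lambda>n x. duhamel G (real n * a) x $ i"])
    show "(\<lambda>x. duhamel G a x $ i) \<in> weak_fun" using a by (intro weak_L_component L) simp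
    fix n :: nat
    have na: "0 \<le> real n * a" using a by simp
    show "(\<lambda>x. duhamel G (real n * a) x $ i) \<in> weak_fun" by (intro weak_L_component L na)
    show "weak_norm 3 (\<lambda>x. duhamel G (real n * a) x $ i) \<le> ennreal (\<eta> * A * B)"
      using D_norm_le [OF V W AB na] weak_norm_component_le [of 3 "duhamel G (real n * a)" i]
      unfolding G_def by (rule order_trans [rotated])
    assume n: "0 < n"
    have na0: "0 < real n * a" using a n by simp
    have "AE x in lborel. duhamel G (real n * a + a) x = heat a (duhamel G (real n * a)) x + duhamel (\<lambda>\<tau>. G (real n * a + \<tau>)) a x"
      by (rule duhamel_split) (use ex na0 a in \<open>simp_all add: per\<close>)
    moreover have "AE x in lborel. duhamel G (a + real n * a) x = heat (real n * a) (duhamel G a) x + duhamel (\<lambda>\<tau>. G (a + \<tau>)) (real n * a) x"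
      by (rule duhamel_split) (use ex na0 a in \<open>simp_all add: per1\<close>)
    ultimately show "AE x in lborel. heat a (\<lambda>x. duhamel G (real n * a) x $ i) x + duhamel G a x $ i
        = heat (real n * a) (\<lambda>x. duhamel G a x $ i) x + duhamel G (real n * a) x $ i"
    proof eventually_elim
      case (elim x)
      have "heat a (duhamel G (real n * a)) x + duhamel G a x = heat (real n * a) (duhamel G a) x + duhamel G (real n * a) x"
      proof -
        have "duhamel G (a + real n * a) x = heat a (duhamel G (real n * a)) x + duhamel G a x"
          using elim(1) by (simp only: per add.commute [of "real n * a" a])
        moreover have "duhamel G (a + real n * a) x = heat (real n * a) (duhamel G a) x + duhamel G (real n * a) x"
          using elim(2) by (simp only: per1)
        ultimately show ?thesis by (rule trans [OF sym])
      qed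
      then have "(heat a (duhamel G (real n * a)) x + duhamel G a x) $ i = (heat (real n * a) (duhamel G a) x + duhamel G (real n * a) x) $ i"
        by (rule arg_cong)
      then show ?case using heat_vec_nth [OF L [OF na]] heat_vec_nth [OF L, of a] a by simp
    qed
  qed (use M0 a N in auto)
qed

text \<open>Inside \<open>(0, a)\<close> the periodised fields are \<open>cutoff k a \<tau>\<close> times the given ones, so the pairings of
  their Duhamel integrals converge as \<open>k \<rightarrow> \<infinity>\<close> by dominated convergence.  Hence the heat
  extensions converge pointwise, and the bound passes to the limit.\<close>
lemma heat_D_le:
  assumes v: "v \<in> X3" "norm_X3 v \<le> ennreal A" and w: "w \<in> X3" "norm_X3 w \<le> ennreal B" and AB: "0 \<le> A" "0 \<le> B"
    and a: "0 < a" and N: "0 < N"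
  shows "vweak_norm 3 (heat (real N * a) (D v w a)) \<le> ennreal (heat_gap N * (\<eta> * A * B))"
  unfolding vweak_norm_le_iff
proof
  fix i
  let ?G = "\<lambda>\<tau>. div_tensor (v \<tau>) (w \<tau>)"
  let ?Gk = "\<lambda>k \<tau>. div_tensor (periodise k a v \<tau>) (periodise k a w \<tau>)"
  have a0: "0 \<le> a" using a by simp
  have t: "0 < real N * a" using a N by simp
  have P: "periodise k a v \<in> X3" "periodise k a w \<in> X3" for k using v w a by (auto intro: periodise_X3)
  have Pn: "norm_X3 (periodise k a v) \<le> ennreal A" "norm_X3 (periodise k a w) \<le> ennreal B" for k
    by (rule order_trans [OF norm_X3_periodise_le [OF v(1) a] v(2)], rule order_trans [OF norm_X3_periodise_le [OF w(1) a] w(2)])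
  define z where "z x = D v w a x $ i" for x
  define zk where "zk k x = D (periodise k a v) (periodise k a w) a x $ i" for k x
  have z: "z \<in> weak_fun" unfolding z_def using v w a0 by (intro weak_L_component D_weak_L)
  have zk: "zk k \<in> weak_fun" for k unfolding zk_def using a0 by (intro weak_L_component D_weak_L P)
  have M0: "0 \<le> \<eta> * A * B" using eta_pos AB by simp
  have zn: "weak_norm 3 z \<le> ennreal (\<eta> * A * B)"
    unfolding z_def by (rule order_trans [OF weak_norm_component_le D_norm_le [OF v w AB a0]])
  have zkn: "weak_norm 3 (zk k) \<le> ennreal (\<eta> * A * B)" for k
    unfolding zk_def by (rule order_trans [OF weak_norm_component_le D_norm_le [OF P(1) Pn(1) P(2) Pn(2) AB a0]])
  have conv: "(\<lambda>k. lap_pairing (zk k) s y) \<longlonglongrightarrow> lap_pairing z s y" if s: "0 < s" for s y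
  proof -
    define K where "K \<tau> = act (?G \<tau>) (leray_test_field y (a + s - \<tau>) i)" for \<tau>
    note T = is_duhamel_test_field [OF duhamel_spec(2) [OF D_exists [OF v(1) w(1) a0]] s, where y = y and i = i, folded K_def z_def]
    have Tk: "complex_of_real (lap_pairing (zk k) s y) = (LINT \<tau>:{0<..<a}|lborel. complex_of_real ((cutoff k a \<tau>)\<^sup>2) * K \<tau>)" for k
    proof -
      have "complex_of_real (lap_pairing (zk k) s y) = (LINT \<tau>:{0<..<a}|lborel. act (?Gk k \<tau>) (leray_test_field y (a + s - \<tau>) i))"
        unfolding zk_def by (rule is_duhamel_test_field(2) [OF duhamel_spec(2) [OF D_exists [OF P a0]] s])
      also have "\<dots> = (LINT \<tau>:{0<..<a}|lborel. complex_of_real ((cutoff k a \<tau>)\<^sup>2) * K \<tau>)"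
      proof (rule set_lebesgue_integral_cong, simp, intro allI impI)
        fix \<tau> assume "\<tau> \<in> {0<..<a}"
        then have "time_mod a \<tau> = \<tau>" by (intro time_mod_id) auto
        then have "periodise k a v \<tau> = (\<lambda>x. cutoff k a \<tau> *\<^sub>R v \<tau> x)" "periodise k a w \<tau> = (\<lambda>x. cutoff k a \<tau> *\<^sub>R w \<tau> x)"
          by (simp_all add: periodise_def fun_eq_iff)
        then show "act (?Gk k \<tau>) (leray_test_field y (a + s - \<tau>) i) = complex_of_real ((cutoff k a \<tau>)\<^sup>2) * K \<tau>"
          by (simp only: act_div_tensor_scaleR K_def)
      qed
      finally show ?thesis .
    qed
    have intK: "integrable lborel (\<lambda>\<tau>. indicator {0<..<a} \<tau> *\<^sub>R K \<tau>)" using T(1) by (simp add: set_integrable_def)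
    have mK: "(\<lambda>\<tau>. indicator {0<..<a} \<tau> *\<^sub>R K \<tau>) \<in> borel_measurable lborel" using intK by simp
    have [measurable]: "cutoff k a \<in> borel_measurable borel" for k
      by (intro borel_measurable_continuous_onI cutoff_continuous)
    have "(\<lambda>k. LINT \<tau>|lborel. complex_of_real ((cutoff k a \<tau>)\<^sup>2) * (indicator {0<..<a} \<tau> *\<^sub>R K \<tau>)) \<longlonglongrightarrow> (LINT \<tau>|lborel. indicator {0<..<a} \<tau> *\<^sub>R K \<tau>)"
    proof (rule integral_dominated_convergence [where w = "\<lambda>\<tau>. norm (indicator {0<..<a} \<tau> *\<^sub>R K \<tau>)"])
      show "integrable lborel (\<lambda>\<tau>. norm (indicator {0<..<a} \<tau> *\<^sub>R K \<tau>))" using intK by (rule integrable_norm)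
      show "(\<lambda>\<tau>. complex_of_real ((cutoff k a \<tau>)\<^sup>2) * (indicator {0<..<a} \<tau> *\<^sub>R K \<tau>)) \<in> borel_measurable lborel" for k
      proof (intro borel_measurable_times mK)
        show "(\<lambda>\<tau>. complex_of_real ((cutoff k a \<tau>)\<^sup>2)) \<in> borel_measurable lborel" by measurable
      qed
      show "AE \<tau> in lborel. (\<lambda>k. complex_of_real ((cutoff k a \<tau>)\<^sup>2) * (indicator {0<..<a} \<tau> *\<^sub>R K \<tau>)) \<longlonglongrightarrow> indicator {0<..<a} \<tau> *\<^sub>R K \<tau>"
      proof (rule AE_I2)
        fix \<tau>
        show "(\<lambda>k. complex_of_real ((cutoff k a \<tau>)\<^sup>2) * (indicator {0<..<a} \<tau> *\<^sub>R K \<tau>)) \<longlonglongrightarrow> indicator {0<..<a} \<tau> *\<^sub>R K \<tau>"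
        proof (cases "\<tau> \<in> {0<..<a}")
          case True
          then have "(\<lambda>k. cutoff k a \<tau>) \<longlonglongrightarrow> 1" by (intro cutoff_tendsto_1) auto
          then have "(\<lambda>k. complex_of_real ((cutoff k a \<tau>)\<^sup>2) * (indicator {0<..<a} \<tau> *\<^sub>R K \<tau>))
              \<longlonglongrightarrow> complex_of_real (1\<^sup>2) * (indicator {0<..<a} \<tau> *\<^sub>R K \<tau>)"
            by (intro tendsto_intros)
          then show ?thesis by simp
        qed simp
      qed
      show "AE \<tau> in lborel. norm (complex_of_real ((cutoff k a \<tau>)\<^sup>2) * (indicator {0<..<a} \<tau> *\<^sub>R K \<tau>)) \<le> norm (indicator {0<..<a} \<tau> *\<^sub>R K \<tau>)" for k
      proof (rule AE_I2)
        fix \<tau>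
        have "(cutoff k a \<tau>)\<^sup>2 \<le> 1" using cutoff_bounds by (simp add: abs_square_le_1)
        then show "norm (complex_of_real ((cutoff k a \<tau>)\<^sup>2) * (indicator {0<..<a} \<tau> *\<^sub>R K \<tau>)) \<le> norm (indicator {0<..<a} \<tau> *\<^sub>R K \<tau>)"
          unfolding norm_mult norm_of_real by (intro mult_left_le_one_le) auto
      qed
    qed (rule mK)
    moreover have "(LINT \<tau>|lborel. complex_of_real ((cutoff k a \<tau>)\<^sup>2) * (indicator {0<..<a} \<tau> *\<^sub>R K \<tau>)) = complex_of_real (lap_pairing (zk k) s y)" for k
      unfolding Tk set_lebesgue_integral_def by (simp only: mult_scaleR_right)
    moreover have "(LINT \<tau>|lborel. indicator {0<..<a} \<tau> *\<^sub>R K \<tau>) = complex_of_real (lap_pairing z s y)"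
      unfolding T(2) set_lebesgue_integral_def ..
    ultimately have "(\<lambda>k. complex_of_real (lap_pairing (zk k) s y)) \<longlonglongrightarrow> complex_of_real (lap_pairing z s y)"
      by (simp only:)
    then show ?thesis by (simp only: tendsto_of_real_iff)
  qed
  have "weak_norm 3 (heat (real N * a) z) \<le> ennreal (heat_gap N * (\<eta> * A * B))"
  proof (rule weak_norm_lower_semicontinuous)
    show "(\<lambda>k. heat (real N * a) (zk k) x) \<longlonglongrightarrow> heat (real N * a) z x" for x
      by (rule heat_tendsto_of_lap_pairing [OF zk zkn z zn M0 conv t])
    show "heat (real N * a) (zk k) \<in> borel_measurable lborel" for k by (intro heat_measurable t weak_funD zk)
    show "weak_norm 3 (heat (real N * a) (zk k)) \<le> ennreal (heat_gap N * (\<eta> * A * B))" for k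
      unfolding zk_def by (rule heat_D_periodise_le [OF v w AB a N])
  qed
  moreover have "(\<lambda>x. heat (real N * a) (D v w a) x $ i) = heat (real N * a) z"
    unfolding z_def by (intro ext heat_vec_nth D_weak_L v w a0)
  ultimately show "weak_norm 3 (\<lambda>x. heat (real N * a) (D v w a) x $ i) \<le> ennreal (heat_gap N * (\<eta> * A * B))"
    by simp
qed

text \<open>The past up to time \<open>a\<close> contributes \<open>S(N a)D(a)\<close>, the rest is a Duhamel integral of shifted fields.\<close>
lemma D_late_le:
  assumes v: "v \<in> X3" "norm_X3 v \<le> ennreal A" and w: "w \<in> X3" "norm_X3 w \<le> ennreal B" and AB: "0 \<le> A" "0 \<le> B"
    and a: "0 < a" and N: "0 < N"
    and late: "\<And>t. a \<le> t \<Longrightarrow> vweak_norm 3 (v t) \<le> ennreal A'" "\<And>t. a \<le> t \<Longrightarrow> vweak_norm 3 (w t) \<le> ennreal B'"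
    and AB': "0 \<le> A'" "0 \<le> B'"
  shows "vweak_norm 3 (D v w (a + real N * a)) \<le> ennreal (heat_gap N * (\<eta> * A * B) + \<eta> * A' * B')"
proof -
  have t: "0 < real N * a" using a N by simp
  have a0: "0 \<le> a" using a by simp
  define v' where "v' t = v (a + t)" for t
  define w' where "w' t = w (a + t)" for t
  have v': "v' \<in> X3" unfolding v'_def by (rule X3_shift [OF v(1) a])
  have w': "w' \<in> X3" unfolding w'_def by (rule X3_shift [OF w(1) a])
  have vn: "norm_X3 v' \<le> ennreal A'" unfolding v'_def by (intro norm_X3_le late) simp
  have wn: "norm_X3 w' \<le> ennreal B'" unfolding w'_def by (intro norm_X3_le late) simp
  have "AE x in lborel. D v w (a + real N * a) x = heat (real N * a) (D v w a) x + D v' w' (real N * a) x"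
    unfolding v'_def w'_def
    by (rule duhamel_split)
       (use v(1) w(1) a t D_exists [OF v' w', unfolded v'_def w'_def] in \<open>auto intro!: D_exists\<close>)
  then have "vweak_norm 3 (D v w (a + real N * a)) = vweak_norm 3 (\<lambda>x. heat (real N * a) (D v w a) x + D v' w' (real N * a) x)"
    by (rule vweak_norm_cong_AE)
  also have "\<dots> \<le> vweak_norm 3 (heat (real N * a) (D v w a)) + vweak_norm 3 (D v' w' (real N * a))"
    using a0 t by (intro vweak_norm_add_le weak_LD heat_weak_L D_weak_L v w v' w') auto
  also have "\<dots> \<le> ennreal (heat_gap N * (\<eta> * A * B)) + ennreal (\<eta> * A' * B')"
    using t by (intro add_mono heat_D_le [OF v w AB a N] D_norm_le [OF v' vn w' wn AB']) simp
  also have "\<dots> = ennreal (heat_gap N * (\<eta> * A * B) + \<eta> * A' * B')"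
    using eta_pos AB AB' heat_gap_nonneg by (intro ennreal_plus [symmetric]) auto
  finally show ?thesis .
qed

text \<open>\<open>u \<otimes> u - u' \<otimes> u' = (u - u') \<otimes> u + u' \<otimes> (u - u')\<close>, tested against the test fields.\<close>
lemma D_diff:
  assumes u: "u \<in> X3" and u': "u' \<in> X3" and t: "0 \<le> t"
  shows "AE x in lborel. D u u t x - D u' u' t x = D (\<lambda>t x. u t x - u' t x) u t x + D u' (\<lambda>t x. u t x - u' t x) t x"
proof -
  define w where "w t x = u t x - u' t x" for t x
  have w: "w \<in> X3" unfolding w_def by (rule X3_diff [OF u u'])
  have L: "D w u t \<in> weak_L 3" "D u' w t \<in> weak_L 3" "D u' u' t \<in> weak_L 3"
    by (intro D_weak_L w u u' t)+
  have "AE x in lborel. D u u t x = D u' u' t x + (D w u t x + D u' w t x)"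
  proof (rule duhamel_eqI)
    show "duhamel_exists (\<lambda>\<tau>. div_tensor (u \<tau>) (u \<tau>)) t" by (intro D_exists u t)
    show "(\<lambda>x. D u' u' t x + (D w u t x + D u' w t x)) \<in> weak_L 3" by (intro weak_L_add L)
    fix i s y assume s: "0 < (s::real)"
    let ?K = "\<lambda>a b \<tau>. act (div_tensor (a \<tau>) (b \<tau>)) (leray_test_field y (t + s - \<tau>) i)"
    note T = is_duhamel_test_field [OF duhamel_spec(2) [OF D_exists [OF _ _ t]] s, where y = y and i = i]
    have "complex_of_real (lap_pairing (\<lambda>x. (D u' u' t x + (D w u t x + D u' w t x)) $ i) s y)
        = complex_of_real (lap_pairing (\<lambda>x. D u' u' t x $ i) s y)
        + (complex_of_real (lap_pairing (\<lambda>x. D w u t x $ i) s y) + complex_of_real (lap_pairing (\<lambda>x. D u' w t x $ i) s y))"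
      using lap_pairing_add [OF weak_L_component [OF L(3)] weak_fun_add [OF weak_L_component [OF L(1)] weak_L_component [OF L(2)]] s]
        lap_pairing_add [OF weak_L_component [OF L(1)] weak_L_component [OF L(2)] s]
      by simp
    also have "\<dots> = (LINT \<tau>:{0<..<t}|lborel. ?K u' u' \<tau>) + ((LINT \<tau>:{0<..<t}|lborel. ?K w u \<tau>) + (LINT \<tau>:{0<..<t}|lborel. ?K u' w \<tau>))"
      by (simp only: T(2) w u u')
    also have "\<dots> = (LINT \<tau>:{0<..<t}|lborel. ?K u' u' \<tau> + (?K w u \<tau> + ?K u' w \<tau>))"
      using T(1) [OF w u] T(1) [OF u' w] T(1) [OF u' u'] by (simp add: set_integral_add)
    also have "\<dots> = (LINT \<tau>:{0<..<t}|lborel. ?K u u \<tau>)"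
    proof (rule set_lebesgue_integral_cong, simp, intro allI impI)
      fix \<tau> assume \<tau>: "\<tau> \<in> {0<..<t}"
      have Lu: "u \<tau> \<in> weak_L 3" "u' \<tau> \<in> weak_L 3" using \<tau> by (auto intro!: X3D u u')
      have r: "0 < t + s - \<tau>" using \<tau> s by simp
      show "?K u' u' \<tau> + (?K w u \<tau> + ?K u' w \<tau>) = ?K u u \<tau>"
        unfolding w_def act_div_tensor_diff_left [OF Lu Lu(1) r] act_div_tensor_diff_right [OF Lu(2,2,1) r] by simp
    qed
    finally show "complex_of_real (lap_pairing (\<lambda>x. (D u' u' t x + (D w u t x + D u' w t x)) $ i) s y)
        = (LINT \<tau>:{0<..<t}|lborel. ?K u u \<tau>)" .
  qed
  then show ?thesis unfolding w_def by (auto elim!: eventually_mono)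
qed

end

section \<open>The contraction argument\<close>

text \<open>The infimum \<open>L\<close> of the eventual upper bounds is the upper limit of \<open>m\<close>; the hypothesis gives
  \<open>L \<le> \<theta> L\<close>.\<close>
lemma contraction_imp_tendsto_0:
  fixes m :: "real \<Rightarrow> ennreal"
  assumes b0: "0 \<le> b0" "\<forall>\<^sub>F t in at_top. m t \<le> ennreal b0" and \<theta>: "0 \<le> \<theta>" "\<theta> < 1"
    and step: "\<And>b \<delta>. 0 \<le> b \<Longrightarrow> 0 < \<delta> \<Longrightarrow> \<forall>\<^sub>F t in at_top. m t \<le> ennreal b \<Longrightarrow> \<forall>\<^sub>F t in at_top. m t \<le> ennreal (\<theta> * b + \<delta>)"
  shows "(m \<longlongrightarrow> 0) at_top"
proof -
  define S where "S = {b. 0 \<le> b \<and> (\<forall>\<^sub>F t in at_top. m t \<le> ennreal b)}"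
  have S: "b0 \<in> S" "bdd_below S" using b0 by (auto simp: S_def bdd_below_def)
  define L where "L = Inf S"
  have L0: "0 \<le> L" unfolding L_def using S by (intro cInf_greatest) (auto simp: S_def)
  have key: "L \<le> \<theta> * L + 2 * \<delta>" if \<delta>: "0 < \<delta>" for \<delta>
  proof -
    obtain b where b: "b \<in> S" "b < L + \<delta>"
      using cInf_lessD [of S "L + \<delta>"] S \<delta> by (auto simp: L_def)
    then have "\<theta> * b + \<delta> \<in> S" using step [of b \<delta>] \<theta> \<delta> by (auto simp: S_def)
    then have "L \<le> \<theta> * b + \<delta>" unfolding L_def by (rule cInf_lower [OF _ S(2)])
    also have "\<theta> * b \<le> \<theta> * (L + \<delta>)" using b \<theta> by (intro mult_left_mono) auto
    also have "\<theta> * (L + \<delta>) \<le> \<theta> * L + 1 * \<delta>" unfolding distrib_left using \<theta> \<delta> by (intro add_left_mono mult_right_mono) auto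
    finally show ?thesis by simp
  qed
  have "L \<le> \<theta> * L + e" if "0 < e" for e using key [of "e / 2"] that by simp
  then have "L \<le> \<theta> * L" by (rule field_le_epsilon)
  then have "(1 - \<theta>) * L \<le> 0" by (simp add: algebra_simps)
  then have L: "L = 0" using \<theta> L0 by (simp add: mult_le_0_iff)
  have small: "\<forall>\<^sub>F t in at_top. m t \<le> ennreal e" if e: "0 < e" for e
  proof -
    obtain b where b: "b \<in> S" "b < e" using cInf_lessD [of S e] S e L by (auto simp: L_def)
    then have "\<forall>\<^sub>F t in at_top. m t \<le> ennreal b" by (simp add: S_def)
    then show ?thesis
    proof eventually_elim
      case (elim t)
      also have "ennreal b \<le> ennreal e" using b by (intro ennreal_leI) simp
      finally show ?case .
    qed
  qed
  show ?thesis
  proof (rule order_tendstoI)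
    fix c :: ennreal assume "0 < c"
    then obtain d :: ennreal where d: "0 < d" "d < c" using dense by blast
    have "d \<noteq> top" using d(2) by (metis not_top_less top.not_eq_extremum)
    then obtain r where r: "d = ennreal r" "0 < r"
      using d(1) by (cases d) (auto simp: ennreal_less_zero_iff)
    from small [OF r(2)] show "\<forall>\<^sub>F t in at_top. m t < c"
      unfolding r(1) [symmetric] by eventually_elim (rule le_less_trans [OF _ d(2)])
  qed simp
qed

theorem theorem2p2:
  fixes \<eta> \<epsilon> :: real
    and u0 u0' :: "real^3 \<Rightarrow> real^3"
    and F F' :: "real \<Rightarrow> dist^3"
    and u u' :: "real \<Rightarrow> real^3 \<Rightarrow> real^3"
  assumes eta_pos: "\<eta> > 0"
    and eta: "\<And>v w. v \<in> X3 \<Longrightarrow> w \<in> X3 \<Longrightarrow>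
      bilin_exists v w \<and> bilin v w \<in> X3 \<and>
      norm_X3 (bilin v w) \<le> ennreal \<eta> * norm_X3 v * norm_X3 w"
    and eps: "0 < \<epsilon>" "\<epsilon> < 1 / (4 * \<eta>)"
    and data: "u0 \<in> weak_L 3" "F \<in> Y3" "vweak_norm 3 u0 + norm_Y3 F < ennreal \<epsilon>"
    and data': "u0' \<in> weak_L 3" "F' \<in> Y3" "vweak_norm 3 u0' + norm_Y3 F' < ennreal \<epsilon>"
    and sol: "u \<in> X3" "NS_solution u0 F u" "norm_X3 u \<le> ennreal (2 * \<epsilon>)"
    and sol': "u' \<in> X3" "NS_solution u0' F' u'" "norm_X3 u' \<le> ennreal (2 * \<epsilon>)"
    and lim: "((\<lambda>t. vweak_norm 3 (\<lambda>x. heat t (\<lambda>y. u0 y - u0' y) x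
                 + duhamel (\<lambda>\<tau>. F \<tau> - F' \<tau>) t x)) \<longlongrightarrow> 0) at_top"
  shows "((\<lambda>t. vweak_norm 3 (\<lambda>x. u t x - u' t x)) \<longlongrightarrow> 0) at_top"
proof -
  interpret bilinear_bound \<eta> using eta_pos eta by unfold_locales
  define w where "w t x = u t x - u' t x" for t x
  have w_fun: "w = (\<lambda>t x. u t x - u' t x)" by (simp add: w_def fun_eq_iff)
  have w: "w \<in> X3" unfolding w_def by (rule X3_diff [OF sol(1) sol'(1)])
  have wn: "norm_X3 w \<le> ennreal (4 * \<epsilon>)"
  proof (rule norm_X3_le)
    fix t :: real assume t: "0 \<le> t"
    have "vweak_norm 3 (w t) \<le> vweak_norm 3 (u t) + vweak_norm 3 (u' t)"
      unfolding w_def by (intro vweak_norm_diff_le weak_LD X3D sol sol' t)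
    also have "\<dots> \<le> ennreal (2 * \<epsilon>) + ennreal (2 * \<epsilon>)"
      by (intro add_mono order_trans [OF vweak_norm_le_norm_X3 [OF t]] sol sol')
    also have "\<dots> = ennreal (4 * \<epsilon>)" using eps by (simp add: ennreal_plus [symmetric] del: ennreal_plus)
    finally show "vweak_norm 3 (w t) \<le> ennreal (4 * \<epsilon>)" .
  qed
  define d where "d t x = heat t (\<lambda>y. u0 y - u0' y) x + duhamel (\<lambda>\<tau>. F \<tau> - F' \<tau>) t x" for t x
  have exF: "duhamel_exists F t" "duhamel_exists F' t" if "0 \<le> t" for t
    using data(2) data'(2) that by (auto simp: Y3_def)
  have w_le: "vweak_norm 3 (w t) \<le> vweak_norm 3 (d t) + (vweak_norm 3 (D w u t) + vweak_norm 3 (D u' w t))" if t: "0 < t" for t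
  proof -
    have t0: "0 \<le> t" using t by simp
    have sol_ae: "AE x in lborel. u t x = heat t u0 x + bilin u u t x + duhamel F t x"
      "AE x in lborel. u' t x = heat t u0' x + bilin u' u' t x + duhamel F' t x"
      using sol(2) sol'(2) t0 by (auto simp: NS_solution_def)
    have d_ae: "AE x in lborel. d t x = (heat t u0 x - heat t u0' x) + (duhamel F t x - duhamel F' t x)"
      using duhamel_diff [OF exF [OF t0]]
      by eventually_elim (simp add: d_def heat_vec_diff [OF data(1) data'(1)])
    have ae: "AE x in lborel. w t x = d t x - (D w u t x + D u' w t x)"
      using sol_ae d_ae D_diff [OF sol(1) sol'(1) t0]
    proof eventually_elim
      case (elim x)
      have "u t x - u' t x = d t x - (D u u t x - D u' u' t x)"
        unfolding elim(1) elim(2) elim(3) bilin_def by (simp add: algebra_simps)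
      then show ?case unfolding w_fun elim(4) .
    qed
    have L: "D w u t \<in> weak_L 3" "D u' w t \<in> weak_L 3" by (intro D_weak_L w sol sol' t0)+
    have exd: "duhamel_exists (\<lambda>\<tau>. F \<tau> - F' \<tau>) t"
      using is_duhamel_diff [OF duhamel_spec [OF exF(1) [OF t0]] duhamel_spec [OF exF(2) [OF t0]]]
        weak_L_diff [OF duhamel_spec(1) [OF exF(1) [OF t0]] duhamel_spec(1) [OF exF(2) [OF t0]]]
      by (auto simp: duhamel_exists_def)
    have dL: "d t \<in> weak_L 3"
      unfolding d_def by (intro weak_L_add weak_L_diff heat_weak_L data data' t duhamel_spec exd)
    have "vweak_norm 3 (w t) = vweak_norm 3 (\<lambda>x. d t x - (D w u t x + D u' w t x))" by (rule vweak_norm_cong_AE [OF ae])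
    also have "\<dots> \<le> vweak_norm 3 (d t) + vweak_norm 3 (\<lambda>x. D w u t x + D u' w t x)"
      by (intro vweak_norm_diff_le weak_LD dL weak_L_add L)
    also have "\<dots> \<le> vweak_norm 3 (d t) + (vweak_norm 3 (D w u t) + vweak_norm 3 (D u' w t))"
      by (intro add_left_mono vweak_norm_add_le weak_LD L)
    finally show ?thesis .
  qed
  have "((\<lambda>t. vweak_norm 3 (w t)) \<longlongrightarrow> 0) at_top"
  \<comment> \<open>the two bilinear terms contribute \<open>\<eta> * b * (2 * \<epsilon>)\<close> each\<close>
  proof (rule contraction_imp_tendsto_0 [where \<theta> = "4 * \<eta> * \<epsilon>" and ?b0.0 = "4 * \<epsilon>"])
    show "0 \<le> 4 * \<epsilon>" "0 \<le> 4 * \<eta> * \<epsilon>" using eps eta_pos by simp_all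
    show "4 * \<eta> * \<epsilon> < 1" using eps eta_pos by (simp add: field_simps)
    show "\<forall>\<^sub>F t in at_top. vweak_norm 3 (w t) \<le> ennreal (4 * \<epsilon>)"
      using eventually_ge_at_top [of 0] by eventually_elim (rule order_trans [OF vweak_norm_le_norm_X3 wn])
    fix b \<delta> :: real assume b: "0 \<le> b" and \<delta>: "0 < \<delta>" and ev: "\<forall>\<^sub>F t in at_top. vweak_norm 3 (w t) \<le> ennreal b"
    \<comment> \<open>\<open>M\<close> bounds both bilinear terms on the whole time axis; \<open>N\<close> makes their remote past small\<close>
    define M where "M = \<eta> * (4 * \<epsilon>) * (2 * \<epsilon>)"
    have M: "0 \<le> M" using eps eta_pos by (simp add: M_def)
    have "(\<lambda>N. heat_gap N * (2 * M)) \<longlonglongrightarrow> 0 * (2 * M)" by (intro tendsto_intros heat_gap_tendsto_0)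
    then have "\<forall>\<^sub>F N in sequentially. heat_gap N * (2 * M) < \<delta> / 2"
      using \<delta> by (intro order_tendstoD) auto
    then have "\<forall>\<^sub>F N in sequentially. heat_gap N * (2 * M) < \<delta> / 2 \<and> 0 < N"
      using eventually_gt_at_top [of "0::nat"] by (rule eventually_conj)
    then obtain N where N: "heat_gap N * (2 * M) < \<delta> / 2" "0 < N"
      using eventually_happens' [OF sequentially_bot] by blast
    obtain T where T: "\<And>t. T \<le> t \<Longrightarrow> vweak_norm 3 (w t) \<le> ennreal b" using ev by (auto simp: eventually_at_top_linorder)
    define T' where "T' = max 1 T"
    have d_small: "\<forall>\<^sub>F t in at_top. vweak_norm 3 (d t) < ennreal (\<delta> / 2)"
      using lim \<delta> unfolding d_def [symmetric, abs_def] by (intro order_tendstoD) auto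
    show "\<forall>\<^sub>F t in at_top. vweak_norm 3 (w t) \<le> ennreal (4 * \<eta> * \<epsilon> * b + \<delta>)"
      using d_small eventually_ge_at_top [of "real (Suc N) * T'"]
    proof eventually_elim
      case (elim t)
      \<comment> \<open>the past before \<open>a\<close> is damped over a time \<open>N * a\<close>, and after \<open>a \<ge> T\<close> the bound \<open>b\<close> holds\<close>
      define a where "a = t / real (Suc N)"
      have aT: "T' \<le> a" using elim(2) by (simp add: a_def pos_le_divide_eq mult.commute del: of_nat_Suc)
      have a: "0 < a" using aT by (simp add: T'_def)
      have ta: "t = a + real N * a"
      proof -
        have "real (Suc N) * a = t" by (simp add: a_def del: of_nat_Suc)
        then show ?thesis by (simp add: algebra_simps)
      qed
      have t: "0 < t" using a ta by (simp add: add_pos_nonneg)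
      have late_w: "vweak_norm 3 (w s) \<le> ennreal b" if "a \<le> s" for s using aT that by (intro T) (simp add: T'_def)
      have late_u: "vweak_norm 3 (u s) \<le> ennreal (2 * \<epsilon>)" "vweak_norm 3 (u' s) \<le> ennreal (2 * \<epsilon>)" if "a \<le> s" for s
        using a that by (auto intro!: order_trans [OF vweak_norm_le_norm_X3] sol sol')
      have e2: "0 \<le> 2 * \<epsilon>" "0 \<le> 4 * \<epsilon>" using eps by auto
      have 1: "vweak_norm 3 (D w u t) \<le> ennreal (heat_gap N * M + \<eta> * b * (2 * \<epsilon>))"
        unfolding ta M_def by (rule D_late_le [OF w wn sol(1,3) e2(2,1) a N(2) late_w late_u(1) b e2(1)])
      have 2: "vweak_norm 3 (D u' w t) \<le> ennreal (heat_gap N * (\<eta> * (2 * \<epsilon>) * (4 * \<epsilon>)) + \<eta> * (2 * \<epsilon>) * b)"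
        unfolding ta by (rule D_late_le [OF sol'(1,3) w wn e2 a N(2) late_u(2) late_w e2(1) b])
      have "vweak_norm 3 (w t) \<le> vweak_norm 3 (d t) + (vweak_norm 3 (D w u t) + vweak_norm 3 (D u' w t))"
        by (rule w_le [OF t])
      also have "\<dots> \<le> ennreal (\<delta> / 2) + (ennreal (heat_gap N * M + \<eta> * b * (2 * \<epsilon>))
          + ennreal (heat_gap N * (\<eta> * (2 * \<epsilon>) * (4 * \<epsilon>)) + \<eta> * (2 * \<epsilon>) * b))"
        by (intro add_mono 1 2 less_imp_le elim)
      also have "\<dots> = ennreal (\<delta> / 2 + ((heat_gap N * M + \<eta> * b * (2 * \<epsilon>)) + (heat_gap N * (\<eta> * (2 * \<epsilon>) * (4 * \<epsilon>)) + \<eta> * (2 * \<epsilon>) * b)))"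
        using \<delta> M b eps eta_pos heat_gap_nonneg [of N] by (simp add: ennreal_plus [symmetric] del: ennreal_plus)
      also have "\<dots> \<le> ennreal (4 * \<eta> * \<epsilon> * b + \<delta>)"
      proof (rule ennreal_leI)
        have "heat_gap N * M + heat_gap N * (\<eta> * (2 * \<epsilon>) * (4 * \<epsilon>)) = heat_gap N * (2 * M)"
          by (simp add: M_def algebra_simps)
        moreover have "\<eta> * b * (2 * \<epsilon>) + \<eta> * (2 * \<epsilon>) * b = 4 * \<eta> * \<epsilon> * b" by (simp add: algebra_simps)
        ultimately show "\<delta> / 2 + ((heat_gap N * M + \<eta> * b * (2 * \<epsilon>)) + (heat_gap N * (\<eta> * (2 * \<epsilon>) * (4 * \<epsilon>)) + \<eta> * (2 * \<epsilon>) * b)) \<le> 4 * \<eta> * \<epsilon> * b + \<delta>"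
          using N(1) \<delta> by linarith
      qed
      finally show ?case .
    qed
  qed
  then show ?thesis unfolding w_def .
qed

end
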